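(* Let $q=p^e$ be a power of a prime $p$ with $q\equiv 1 \pmod 6$, let $\omega$ be a generator of $\widehat{\mathbb{F}}_q^\times$, put $t=(q-1)/6$, $\omega_6:=\omega^t$, $\omega_3:=\omega^{2t}$, $\omega_2:=\omega^{3t}$. For $\lambda\in\mathbb{F}_q$ with $\lambda\neq 0$ and $\lambda^6\neq 1$, the number of $\mathbb{F}_q$-rational points of the projective hypersurface $X_\lambda^6:\ x_1^6+\cdots+x_6^6=6\lambda x_1x_2\cdots x_6$ is \begin{align*} \#X_{\lambda}^6(\mathbb{F}_q)&=\frac{q^5-1}{q-1}+360q^2\omega_2(1-\lambda^6) +q^4\, {}_5F_4\!\left(\begin{matrix}\omega_6, \omega_3, \omega_2, \overline{\omega}_3, \overline{\omega}_6\\ \epsilon, \epsilon, \epsilon, \epsilon\end{matrix}\Big|\ \tfrac{1}{\lambda^6}\right)_q\\ &+30q^3 \omega_6(-1)\, {}_3F_2\!\left(\begin{matrix}\omega_3, \omega_2, \overline{\omega}_3\\ \epsilon, \epsilon\end{matrix}\Big|\ \tfrac{1}{\lambda^6}\right)_q +30q^3\, {}_3F_2\!\left(\begin{matrix}\omega_6, \omega_2, \overline{\omega}_6\\ \epsilon, \epsilon\end{matrix}\Big|\ \tfrac{1}{\lambda^6}\right)_q\\ &-15q^3\omega_6(-1) J(\omega_2, \overline{\omega}_3,\overline{\omega}_6)\, {}_4F_3\!\left(\begin{matrix}\omega_6, \overline{\omega}_6, \overline{\omega}_3, \omega_3\\ \epsilon, \epsilon, \omega_2\end{matrix}\Big|\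 \tfrac{1}{\lambda^6}\right)_q\\ &-20q^3\omega_6(-1) J(\omega_6,\omega_3,\omega_2)\, {}_4F_3\!\left(\begin{matrix}\omega_6, \omega_2, \overline{\omega}_3, \overline{\omega}_6\\ \epsilon, \omega_3, \omega_3\end{matrix}\Big|\ \tfrac{1}{\lambda^6}\right)_q\\ &+60q^2 \omega_6(-1)J(\omega_6, \omega_6, \overline{\omega}_3)J(\omega_2,\overline{\omega}_3,\overline{\omega}_6)\, {}_3F_2\!\left(\begin{matrix}\omega_6, \overline{\omega}_3, \omega_2\\ \epsilon, \overline{\omega}_6\end{matrix}\Big|\ \tfrac{1}{\lambda^6}\right)_q\\ &+60q^2J(\omega_3,\omega_3,\omega_3)J(\omega_2, \overline{\omega}_3, \overline{\omega}_6)\, {}_3F_2\!\left(\begin{matrix}\omega_3, \overline{\omega}_6, \omega_2\\ \epsilon, \omega_6\end{matrix}\Big|\ \tfrac{1}{\lambda^6}\right)_q +90q^3\, {}_3F_2\!\left(\begin{matrix}\omega_2, \overline{\omega}_3, \overline{\omega}_6\\ \omega_6, \omega_3\end{matrix}\Big|\ \tfrac{1}{\lambda^6}\right)_q\\ &-30q^2J(\omega_6,\omega_6)J(\omega_6, \omega_3, \omega_2)\, {}_3F_2\!\left(\begin{matrix}\omega_6, \omega_2, \overline{\omega}_6\\ \omega_3, \overline{\omega}_3\end{matrix}\Big|\ \tfrac{1}{\lambda^6}\right)_q\\ &-120q^2J(\omega_6,\omega_3,\omega_2)\, {}_2F_1\!\left(\begin{matrix}\omega_6, \omega_3\\ \epsilon\end{matrix}\Big|\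 \tfrac{1}{\lambda^6}\right)_q -120q^2 J(\omega_2,\overline{\omega}_3,\overline{\omega}_6)\, {}_2F_1\!\left(\begin{matrix}\overline{\omega}_3, \overline{\omega}_6\\ \epsilon\end{matrix}\Big|\ \tfrac{1}{\lambda^6}\right)_q\\ &-180q^2J(\omega_6,\omega_3, \omega_2)\, {}_2F_1\!\left(\begin{matrix}\omega_3, \overline{\omega}_3\\ \omega_2\end{matrix}\Big|\ \tfrac{1}{\lambda^6}\right)_q -180q^2J(\omega_6,\omega_3, \omega_2)\, {}_2F_1\!\left(\begin{matrix}\omega_3, \overline{\omega}_6\\ \overline{\omega}_3\end{matrix}\Big|\ \tfrac{1}{\lambda^6}\right)_q . \end{align*} Here ${}_{n+1}F_n\!\left(\begin{matrix}A_0,\dots,A_n\\ B_1,\dots,B_n\end{matrix}\Big|\ x\right)_q$ denotes Greene's hypergeometric function as defined in the context.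
   Context: $\mathbb{F}_q$ is the finite field with $q$ elements, $\widehat{\mathbb{F}}_q^\times$ the group of multiplicative characters $\mathbb{F}_q^\times\to\mathbb{C}^\times$; every character $\chi$ (including the trivial character $\epsilon$) is extended to $\mathbb{F}_q$ by $\chi(0)=0$. $\overline{\chi}$ denotes the complex conjugate (inverse) character. Jacobi sums: $J(\chi_1,\dots,\chi_n)=\sum_{x_1+\cdots+x_n=1,\ x_i\in\mathbb{F}_q}\chi_1(x_1)\cdots\chi_n(x_n)$; in particular $J(\chi,\psi)=\sum_{x\in\mathbb{F}_q}\chi(x)\psi(1-x)$. Normalized Jacobi sum: $\binom{A}{B}:=\frac{B(-1)}{q}J(A,\overline{B})$. Greene's hypergeometric function: for $n\ge 2$, characters $A_0,\dots,A_n,B_1,\dots,B_n$ and $x\in\mathbb{F}_q$, ${}_{n+1}F_n\!\left(\begin{matrix}A_0,\dots,A_n\\ B_1,\dots,B_n\end{matrix}\Big|\ x\right)_q:=\frac{q}{q-1}\sum_{\chi\in\widehat{\mathbb{F}}_q^\times}\binom{A_0\chi}{\chi}\binom{A_1\chi}{B_1\chi}\cdots\binom{A_n\chi}{B_n\chi}\chi(x)$, and for $n=1$, ${}_{2}F_1\!\left(\begin{matrix}A_0,A_1\\ B_1\end{matrix}\Big|\ x\right)_q:=\epsilon(x)\frac{A_1B_1(-1)}{q}\sum_{y\in\mathbb{F}_q}A_1(y)\overline{A_1}B_1(1-y)\overline{A_0}(1-xy)$. *)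

theory Defs
  imports Complex_Main "HOL-Library.Cardinality"
begin

text \<open>Multiplicative characters of a finite field, extended by 0 at 0
  (this convention applies to every character, including the trivial one).\<close>
definition mult_char :: "('a::field \<Rightarrow> complex) \<Rightarrow> bool" where
  "mult_char \<chi> \<longleftrightarrow> \<chi> 0 = 0 \<and> (\<forall>x. x \<noteq> 0 \<longrightarrow> \<chi> x \<noteq> 0)
     \<and> (\<forall>x y. x \<noteq> 0 \<longrightarrow> y \<noteq> 0 \<longrightarrow> \<chi> (x * y) = \<chi> x * \<chi> y)"

definition triv_char :: "'a::field \<Rightarrow> complex" where
  "triv_char x = (if x = 0 then 0 else 1)"

definition char_mult :: "('a::field \<Rightarrow> complex) \<Rightarrow> ('a \<Rightarrow> complex) \<Rightarrow> 'a \<Rightarrow> complex" where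
  "char_mult A B = (\<lambda>x. A x * B x)"

definition char_cnj :: "('a::field \<Rightarrow> complex) \<Rightarrow> 'a \<Rightarrow> complex" where
  "char_cnj A = (\<lambda>x. cnj (A x))"

definition char_pow :: "('a::field \<Rightarrow> complex) \<Rightarrow> nat \<Rightarrow> 'a \<Rightarrow> complex" where
  "char_pow \<omega> k = (\<lambda>x. if x = 0 then 0 else \<omega> x ^ k)"

definition char_generator :: "('a::field \<Rightarrow> complex) \<Rightarrow> bool" where
  "char_generator \<omega> \<longleftrightarrow> mult_char \<omega> \<and> (\<forall>\<chi>. mult_char \<chi> \<longrightarrow> (\<exists>k. \<chi> = char_pow \<omega> k))"

definition jacobi :: "('a::{finite,field} \<Rightarrow> complex) list \<Rightarrow> complex" where
  "jacobi cs = (\<Sum>xs\<in>{xs. length xs = length cs \<and> sum_list xs = 1}.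
                   prod_list (map2 (\<lambda>c x. c x) cs xs))"

definition nbinom :: "('a::{finite,field} \<Rightarrow> complex) \<Rightarrow> ('a \<Rightarrow> complex) \<Rightarrow> complex" where
  "nbinom A B = B (-1) / of_nat CARD('a) * jacobi [A, char_cnj B]"

text \<open>Greene's hypergeometric function (n+1)F(n) with upper parameters As = [A_0,...,A_n]
  and lower parameters Bs = [B_1,...,B_n]; the case n = 1 uses the special formula.\<close>
definition greene_F :: "('a::{finite,field} \<Rightarrow> complex) list \<Rightarrow> ('a \<Rightarrow> complex) list \<Rightarrow> 'a \<Rightarrow> complex" where
  "greene_F As Bs x =
    (if length Bs = 1 then
       triv_char x * char_mult (As ! 1) (Bs ! 0) (-1) / of_nat CARD('a) *
       (\<Sum>y\<in>UNIV. (As ! 1) y * char_mult (char_cnj (As ! 1)) (Bs ! 0) (1 - y)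
                  * char_cnj (As ! 0) (1 - x * y))
     else
       of_nat CARD('a) / (of_nat CARD('a) - 1) *
       (\<Sum>\<chi>\<in>{\<chi>. mult_char \<chi>}.
          nbinom (char_mult (hd As) \<chi>) \<chi> *
          prod_list (map2 (\<lambda>A B. nbinom (char_mult A \<chi>) (char_mult B \<chi>)) (tl As) Bs) *
          \<chi> x))"

text \<open>Number of F_q-rational points of the projective hypersurface
  x_1^6 + ... + x_6^6 = 6 lambda x_1 ... x_6 : nonzero affine solutions divided by q - 1.\<close>
definition dwork6_points :: "'a::{finite,field} \<Rightarrow> complex" where
  "dwork6_points lam =
     of_nat (card {xs :: 'a list. length xs = 6 \<and> xs \<noteq> replicate 6 0 \<and>
                     sum_list (map (\<lambda>x. x ^ 6) xs) = 6 * lam * prod_list xs})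
     / (of_nat CARD('a) - 1)"

end

theory Submission
  imports Defs "HOL-Algebra.Algebraic_Closure_Type"
begin

text \<open>
  Write \<open>g(\<chi>)\<close> for the Gauss sum of \<open>\<chi>\<close> with respect to a fixed nontrivial additive character \<open>\<psi>\<close>.
  Detecting the equation with \<open>\<psi>\<close> and expanding \<open>\<psi>(y) - 1\<close> over the multiplicative characters
  turns the number of affine solutions into a sum over characters \<open>\<eta>\<close> of \<open>1 / g(\<eta>\<^sup>6)\<close> times a fixed
  polynomial in \<open>g(\<eta>), g(\<eta> \<omega>\<^sub>6), \<dots>, g(\<eta> \<omega>\<^sub>6\<^sup>5)\<close>, namely the constant term modulo \<open>z\<^sup>6 = 1\<close> of
  \<open>(\<Sum>\<^sub>j g(\<eta> \<omega>\<^sub>6\<^sup>j) z\<^sup>j)\<^sup>6\<close>. The Hasse--Davenport product relation replaces \<open>g(\<eta>\<^sup>6)\<close> by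
  \<open>\<Prod>\<^sub>j g(\<eta> \<omega>\<^sub>6\<^sup>j)\<close>. Up to the cyclic shift \<open>\<eta> \<mapsto> \<eta> \<omega>\<^sub>6\<close> the polynomial has 14 monomials; one of them gives
  an elementary \<open>\<^sub>1F\<^sub>0\<close>, and each of the others is, after \<open>\<chi> = \<eta>\<inverse>\<close>, the series of one of Greene's functions.
  The correction terms that come from solutions with a zero coordinate account precisely for the
  failure of \<open>g(\<chi>) g(\<chi>\<inverse>) = \<chi>(-1) q\<close> at the trivial character.

  The product relation is only needed for multiplication by 2 and by 3. The latter is elementary:
  evaluating monic quadratic polynomials at the three cube roots of unity reduces it to counting the roots
  of \<open>u\<^sup>3 - 3uv = U\<close>.
\<close>

text \<open>Every character, the trivial one included, vanishes at 0, so no combination of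
  characters represents \<open>\<psi>\<close> there; moreover, taking q/g(\<chi>) as coefficients
  changes the trivial one from -1 to -q. Subtracting 1 from \<open>\<psi>\<close> repairs both at
  once. Reciprocals of Gauss sums are wanted because the product relation then cancels factors of
  the monomials. It also brings in the value of \<eta> at 6^6, which the coefficient 6 of the
  equation absorbs; this leaves 1/lam^6 as the argument. The subtracted 1 leaves a diagonal sum that
  does not involve the product of the variables. It has the same orbit polynomial, with the trivial
  Gauss sum replaced by 0. On the other side, when \<eta> is a power of \<omega>6, a monomial
  lacking the trivial Gauss sum gets -1/q from the normalized Jacobi sums where 1/g would give -1.
  The two effects cancel orbit by orbit, so the comparison with Greene's series needs no exceptional
  characters. The relation for six arises by pairing the twists j and j+3 and applying the relation
  for three to the square of the character. For three, a pointwise upper bound on the number of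
  roots of the cubic suffices, because the totals agree.\<close>

lemma finite_field_generator:
  "\<exists>g::'a::{finite,field}. g \<noteq> 0 \<and> (\<forall>x. x \<noteq> 0 \<longrightarrow> (\<exists>i. x = g ^ i))"
proof -
  define R where "R = (ring_of_type_algebra :: 'a ring)"
  interpret R: Ring.field R unfolding R_def by (rule field_from_type_algebra)
  have ops: "\<one>\<^bsub>R\<^esub> = 1" "x \<otimes>\<^bsub>R\<^esub> y = x * y" for x y
    by (simp_all add: R_def ring_of_type_algebra_def)
  have pow: "a [^]\<^bsub>R\<^esub> i = a ^ i" for a and i :: nat
    by (induction i) (simp_all only: R.nat_pow_0 R.nat_pow_Suc ops power_0 power_Suc2)
  have car: "carrier (Multiplicative_Group.mult_of R) = UNIV - {0}"
    by (simp add: R_def ring_of_type_algebra_def)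
  have fin: "finite (carrier R)"
    by (simp add: R_def ring_of_type_algebra_def)
  from R.finite_field_mult_group_has_gen[OF fin] obtain g
    where gR: "g \<in> carrier (Multiplicative_Group.mult_of R)"
      and g: "carrier (Multiplicative_Group.mult_of R) = {g [^]\<^bsub>R\<^esub> i | i::nat. i \<in> UNIV}"
    by (elim bexE) (simp only: )
  from gR have "g \<noteq> 0" unfolding car by simp
  moreover have "\<exists>i. x = g ^ i" if "x \<noteq> 0" for x
    using that g unfolding car pow by auto
  ultimately show ?thesis by blast
qed

lemma card_field_gt_1: "CARD('a::{finite,field}) > 1"
  using card_mono[of "UNIV :: 'a set" "{0, 1}"] by simp

lemma finite_field_power_card:
  fixes x :: "'a::{finite,field}"
  assumes "x \<noteq> 0"
  shows "x ^ (CARD('a) - 1) = 1"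
proof -
  have "(\<Prod>y\<in>UNIV-{0}. y) = (\<Prod>y\<in>UNIV-{0}. x * y)"
    by (rule prod.reindex_bij_witness[of _ "\<lambda>y. x * y" "\<lambda>y. y / x"]) (use assms in auto)
  also have "\<dots> = x ^ (CARD('a) - 1) * (\<Prod>y\<in>UNIV-{0}. y)"
    by (simp add: prod.distrib card_Diff_subset)
  finally show ?thesis by simp
qed

subsection \<open>Multiplicative characters\<close>

lemma mult_char_0 [simp]: "mult_char \<chi> \<Longrightarrow> \<chi> 0 = 0"
  by (simp add: mult_char_def)

lemma mult_char_eq_0_iff [simp]: "mult_char \<chi> \<Longrightarrow> \<chi> x = 0 \<longleftrightarrow> x = 0"
  by (auto simp: mult_char_def)

lemma mult_char_mult: "mult_char \<chi> \<Longrightarrow> \<chi> (x * y) = \<chi> x * \<chi> y"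
  unfolding mult_char_def by (metis mult_zero_left mult_zero_right)

lemma mult_char_1 [simp]: "mult_char \<chi> \<Longrightarrow> \<chi> 1 = 1"
  using mult_char_mult[of \<chi> 1 1] mult_char_eq_0_iff[of \<chi> 1] by simp

lemma mult_char_power: "mult_char \<chi> \<Longrightarrow> \<chi> (x ^ n) = \<chi> x ^ n"
  by (induction n) (simp_all add: mult_char_mult)

lemma mult_char_inverse: "mult_char \<chi> \<Longrightarrow> \<chi> (inverse x) = inverse (\<chi> x)"
  using mult_char_mult[of \<chi> x "inverse x"] by (cases "x = 0") (auto simp: field_simps)

lemma mult_char_divide: "mult_char \<chi> \<Longrightarrow> \<chi> (x / y) = \<chi> x / \<chi> y"
  by (simp add: divide_inverse mult_char_mult mult_char_inverse)

lemma mult_char_power_card: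
  fixes \<chi> :: "'a::{finite,field} \<Rightarrow> complex"
  assumes "mult_char \<chi>" "x \<noteq> 0"
  shows "\<chi> x ^ (CARD('a) - 1) = 1"
  by (metis assms finite_field_power_card mult_char_1 mult_char_power)

lemma norm_mult_char:
  fixes \<chi> :: "'a::{finite,field} \<Rightarrow> complex"
  assumes "mult_char \<chi>" "x \<noteq> 0"
  shows "norm (\<chi> x) = 1"
proof -
  have "norm (\<chi> x) ^ (CARD('a) - 1) = 1"
    using arg_cong[OF mult_char_power_card[OF assms], of norm] by (simp add: norm_power)
  then show ?thesis
    using card_field_gt_1[where 'a='a] power_eq_1_iff[of "norm (\<chi> x)" "CARD('a) - 1"] by simp
qed

lemma cnj_mult_char:
  fixes \<chi> :: "'a::{finite,field} \<Rightarrow> complex"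
  assumes "mult_char \<chi>"
  shows "cnj (\<chi> x) = inverse (\<chi> x)"
proof (cases "x = 0")
  case False
  then have "\<chi> x * cnj (\<chi> x) = 1"
    using norm_mult_char[OF assms] by (simp add: complex_norm_square[symmetric])
  then show ?thesis by (metis inverse_unique)
qed (use assms in simp)

lemma mult_char_minus_1_cases:
  assumes "mult_char \<chi>"
  shows "\<chi> (-1) = 1 \<or> \<chi> (-1) = -1"
proof -
  have "\<chi> (-1) ^ 2 = 1"
    using mult_char_power[OF assms, of "-1" 2] assms by simp
  then show ?thesis by (simp add: power2_eq_1_iff)
qed

lemma mult_char_minus_1_square [simp]: "mult_char \<chi> \<Longrightarrow> \<chi> (-1) * \<chi> (-1) = 1"
  using mult_char_minus_1_cases[of \<chi>] by auto

lemma mult_char_minus: "mult_char \<chi> \<Longrightarrow> \<chi> (- x) = \<chi> (-1) * \<chi> x"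
  using mult_char_mult[of \<chi> "-1" x] by simp

lemma mult_charI:
  assumes "\<chi> 0 = 0" "\<And>x. x \<noteq> 0 \<Longrightarrow> \<chi> x \<noteq> 0"
    and "\<And>x y. x \<noteq> 0 \<Longrightarrow> y \<noteq> 0 \<Longrightarrow> \<chi> (x * y) = \<chi> x * \<chi> y"
  shows "mult_char \<chi>"
  unfolding mult_char_def using assms by blast

lemma mult_char_triv [simp]: "mult_char triv_char"
  by (rule mult_charI) (simp_all add: triv_char_def mult_char_mult)

lemma mult_char_char_mult [simp]: "mult_char A \<Longrightarrow> mult_char B \<Longrightarrow> mult_char (char_mult A B)"
  by (rule mult_charI) (simp_all add: char_mult_def mult_char_mult)

lemma mult_char_char_cnj [simp]: "mult_char A \<Longrightarrow> mult_char (char_cnj A)"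
  by (rule mult_charI) (simp_all add: char_cnj_def mult_char_mult)

lemma mult_char_char_pow [simp]: "mult_char A \<Longrightarrow> mult_char (char_pow A k)"
  by (rule mult_charI) (simp_all add: char_pow_def mult_char_mult power_mult_distrib)

lemma char_mult_commute: "char_mult A B = char_mult B A"
  by (simp add: char_mult_def mult.commute)

lemma char_mult_assoc: "char_mult (char_mult A B) C = char_mult A (char_mult B C)"
  by (simp add: char_mult_def mult.assoc)

lemma char_mult_left_commute: "char_mult A (char_mult B C) = char_mult B (char_mult A C)"
  by (simp add: char_mult_def mult.left_commute)

lemma char_mult_triv [simp]:
  "mult_char A \<Longrightarrow> char_mult triv_char A = A" "mult_char A \<Longrightarrow> char_mult A triv_char = A"
  by (auto simp: char_mult_def triv_char_def fun_eq_iff)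

lemma char_mult_cnj [simp]:
  fixes A :: "'a::{finite,field} \<Rightarrow> complex"
  assumes "mult_char A"
  shows "char_mult A (char_cnj A) = triv_char" "char_mult (char_cnj A) A = triv_char"
  using assms by (auto simp: char_mult_def triv_char_def char_cnj_def fun_eq_iff cnj_mult_char)

lemma char_cnj_cnj [simp]: "char_cnj (char_cnj A) = A"
  by (simp add: char_cnj_def)

lemma char_cnj_triv [simp]: "char_cnj triv_char = triv_char"
  by (simp add: char_cnj_def triv_char_def fun_eq_iff)

lemma char_cnj_mult: "char_cnj (char_mult A B) = char_mult (char_cnj A) (char_cnj B)"
  by (simp add: char_cnj_def char_mult_def)

lemma char_mult_cnj_left_cancel [simp]:
  fixes A :: "'a::{finite,field} \<Rightarrow> complex"
  assumes "mult_char A" "mult_char B"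
  shows "char_mult A (char_mult (char_cnj A) B) = B" "char_mult (char_cnj A) (char_mult A B) = B"
  using assms by (simp_all flip: char_mult_assoc)

lemma char_mult_eq_triv_iff:
  fixes A :: "'a::{finite,field} \<Rightarrow> complex"
  assumes "mult_char A" "mult_char B"
  shows "char_mult A B = triv_char \<longleftrightarrow> B = char_cnj A"
proof
  assume "char_mult A B = triv_char"
  then have "char_mult (char_cnj A) (char_mult A B) = char_mult (char_cnj A) triv_char" by simp
  then show "B = char_cnj A" using assms by simp
qed (use assms in simp)

lemma char_cnj_eq_triv_iff [simp]: "char_cnj A = triv_char \<longleftrightarrow> A = triv_char"
  using char_cnj_cnj char_cnj_triv by metis

lemma finite_mult_chars: "finite {\<chi> :: 'a::{finite,field} \<Rightarrow> complex. mult_char \<chi>}"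
proof (rule finite_subset)
  let ?R = "insert 0 {z :: complex. z ^ (CARD('a) - 1) = 1}"
  show "{\<chi> :: 'a \<Rightarrow> complex. mult_char \<chi>} \<subseteq> {\<chi>. \<forall>x. (x \<in> UNIV \<longrightarrow> \<chi> x \<in> ?R) \<and> (x \<notin> UNIV \<longrightarrow> \<chi> x = 0)}"
  proof (intro subsetI CollectI allI conjI impI)
    fix \<chi> :: "'a \<Rightarrow> complex" and x
    assume "\<chi> \<in> {\<chi>. mult_char \<chi>}"
    then show "\<chi> x \<in> ?R" using mult_char_power_card[of \<chi> x] by (cases "x = 0") auto
  qed simp
  have "finite ?R"
    using finite_roots_unity[of "CARD('a) - 1", where 'a=complex] card_field_gt_1[where 'a='a] by simp
  then show "finite {\<chi> :: 'a \<Rightarrow> complex. \<forall>x. (x \<in> UNIV \<longrightarrow> \<chi> x \<in> ?R) \<and> (x \<notin> UNIV \<longrightarrow> \<chi> x = 0)}"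
    by (intro finite_set_of_finite_funs) auto
qed

text \<open>The separating character sends a generator of the multiplicative group to a primitive
  (q-1)-th root of unity; it is injective, so it works for every \<open>x\<close>.\<close>

lemma mult_chars_separate:
  fixes x :: "'a::{finite,field}"
  assumes "x \<noteq> 0" "x \<noteq> 1"
  obtains \<chi> where "mult_char \<chi>" "\<chi> x \<noteq> 1"
proof -
  define n where "n = CARD('a) - 1"
  have n: "n > 0" using card_field_gt_1[where 'a='a] by (simp add: n_def)
  obtain g :: 'a where g: "g \<noteq> 0" "\<And>x. x \<noteq> 0 \<Longrightarrow> \<exists>i. x = g ^ i"
    using finite_field_generator by blast
  have g_mod: "g ^ i = g ^ (i mod n)" for i
  proof -
    have "g ^ i = (g ^ n) ^ (i div n) * g ^ (i mod n)"
      by (simp flip: power_mult power_add)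
    then show ?thesis using finite_field_power_card[OF g(1)] by (simp add: n_def)
  qed
  \<comment> \<open>The first \<open>n\<close> powers fill a set of \<open>n\<close> elements, so
    they are distinct and \<open>g\<close> has order exactly \<open>n\<close>.\<close>
  have "(\<lambda>i. g ^ i) ` {..<n} = UNIV - {0}"
  proof
    show "UNIV - {0} \<subseteq> (\<lambda>i. g ^ i) ` {..<n}"
    proof
      fix x assume "x \<in> UNIV - {0::'a}"
      then obtain i where "x = g ^ i" using g(2) by auto
      then have "x = g ^ (i mod n)" using g_mod by simp
      then show "x \<in> (\<lambda>i. g ^ i) ` {..<n}" using n by simp
    qed
  qed (use g in auto)
  then have "inj_on (\<lambda>i. g ^ i) {..<n}"
    by (intro eq_card_imp_inj_on) (simp_all add: n_def card_Diff_subset)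
  then have inj: "i mod n = j mod n" if "g ^ i = g ^ j" for i j
    using that g_mod[of i] g_mod[of j] n by (auto simp: inj_on_def)
  define e where "e = cis (2 * pi / real n)"
  have e_pow: "e ^ i = cis (2 * pi * real i / real n)" for i
    by (simp add: e_def DeMoivre mult_ac)
  have e_n: "e ^ n = 1" using n by (simp add: e_pow)
  have e_mod: "e ^ i = e ^ (i mod n)" for i
  proof -
    have "e ^ i = (e ^ n) ^ (i div n) * e ^ (i mod n)"
      by (simp flip: power_mult power_add)
    then show ?thesis by (simp add: e_n)
  qed
  \<comment> \<open>An arbitrary discrete logarithm: only its class modulo \<open>n\<close> is
    determined, and only that class enters \<open>e ^ L x\<close>.\<close>
  define L where "L x = (SOME i. x = g ^ i)" for x
  have L: "x = g ^ L x" if "x \<noteq> 0" for x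
    unfolding L_def using g(2)[OF that] by (rule someI_ex)
  define \<chi> where "\<chi> x = (if x = 0 then 0 else e ^ L x)" for x
  have "e ^ L (x * y) = e ^ L x * e ^ L y" if "x \<noteq> 0" "y \<noteq> 0" for x y
  proof -
    have "g ^ L (x * y) = g ^ (L x + L y)"
      using L[of x] L[of y] L[of "x * y"] that by (simp add: power_add)
    then show ?thesis using inj e_mod by (metis power_add)
  qed
  then have "mult_char \<chi>"
    by (intro mult_charI) (auto simp: \<chi>_def e_def)
  moreover have "\<chi> x \<noteq> 1"
  proof
    assume "\<chi> x = 1"
    then have "e ^ (L x mod n) = e ^ 0"
      using assms e_mod by (simp add: \<chi>_def)
    then have "L x mod n = 0"
      using bij_betw_imp_inj_on[OF bij_betw_roots_unity[OF n]] n
      unfolding e_pow by (auto simp: inj_on_def)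
    then show False using L[OF assms(1)] g_mod[of "L x"] assms(2) by simp
  qed
  ultimately show thesis using that by blast
qed

lemma sum_mult_char_shift:
  fixes f :: "('a::{finite,field} \<Rightarrow> complex) \<Rightarrow> 'b::comm_monoid_add"
  assumes "mult_char A"
  shows "(\<Sum>\<chi> | mult_char \<chi>. f (char_mult \<chi> A)) = (\<Sum>\<chi> | mult_char \<chi>. f \<chi>)"
  by (rule sum.reindex_bij_witness[of _ "\<lambda>\<chi>. char_mult \<chi> (char_cnj A)" "\<lambda>\<chi>. char_mult \<chi> A"])
    (use assms in \<open>simp_all add: char_mult_assoc\<close>)

lemma sum_mult_char_cnj:
  fixes f :: "('a::{finite,field} \<Rightarrow> complex) \<Rightarrow> 'b::comm_monoid_add"
  shows "(\<Sum>\<chi> | mult_char \<chi>. f (char_cnj \<chi>)) = (\<Sum>\<chi> | mult_char \<chi>. f \<chi>)"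
  by (rule sum.reindex_bij_witness[of _ char_cnj char_cnj]) simp_all

lemma sum_scale:
  fixes f :: "'a::{finite,field} \<Rightarrow> 'b::comm_monoid_add"
  assumes "a \<noteq> 0"
  shows "(\<Sum>x\<in>UNIV. f (a * x)) = (\<Sum>x\<in>UNIV. f x)"
  by (rule sum.reindex_bij_witness[of _ "\<lambda>x. x / a" "\<lambda>x. a * x"]) (use assms in auto)

lemma sum_translate:
  fixes f :: "'a::{finite,field} \<Rightarrow> 'b::comm_monoid_add"
  shows "(\<Sum>x\<in>UNIV. f (x + a)) = (\<Sum>x\<in>UNIV. f x)"
  by (rule sum.reindex_bij_witness[of _ "\<lambda>x. x - a" "\<lambda>x. x + a"]) auto

lemma sum_reflect:
  fixes f :: "'a::{finite,field} \<Rightarrow> 'b::comm_monoid_add"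
  shows "(\<Sum>x\<in>UNIV. f (a - x)) = (\<Sum>x\<in>UNIV. f x)"
  by (rule sum.reindex_bij_witness[of _ "\<lambda>x. a - x" "\<lambda>x. a - x"]) auto

lemma sum_triv_char:
  "(\<Sum>x\<in>UNIV. triv_char (x::'a::{finite,field})) = of_nat CARD('a) - 1"
proof -
  have "(\<Sum>x\<in>UNIV. triv_char (x::'a)) = (\<Sum>x\<in>UNIV-{0::'a}. 1 :: complex)"
    by (intro sum.mono_neutral_cong_right) (auto simp: triv_char_def)
  then show ?thesis using card_field_gt_1[where 'a='a] by (simp add: card_Diff_subset)
qed

lemma sum_mult_char:
  assumes "mult_char (\<chi> :: 'a::{finite,field} \<Rightarrow> complex)"
  shows "(\<Sum>x\<in>UNIV. \<chi> x) = (if \<chi> = triv_char then of_nat CARD('a) - 1 else 0)"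
proof (cases "\<chi> = triv_char")
  case False
  then obtain a where "a \<noteq> 0" "\<chi> a \<noteq> 1"
    using assms by (auto simp: triv_char_def fun_eq_iff split: if_splits)
  moreover have "\<chi> a * (\<Sum>x\<in>UNIV. \<chi> x) = (\<Sum>x\<in>UNIV. \<chi> x)"
    using sum_scale[OF \<open>a \<noteq> 0\<close>, of \<chi>] by (simp add: mult_char_mult[OF assms] sum_distrib_left)
  ultimately show ?thesis using False by simp
qed (simp add: sum_triv_char)

lemma sum_over_mult_chars_eq_0:
  fixes x :: "'a::{finite,field}"
  assumes "x \<noteq> 1"
  shows "(\<Sum>\<chi> | mult_char \<chi>. \<chi> x) = 0"
proof (cases "x = 0")
  case False
  obtain A where A: "mult_char A" "A x \<noteq> 1"
    using mult_chars_separate[OF False assms] .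
  have "A x * (\<Sum>\<chi> | mult_char \<chi>. \<chi> x) = (\<Sum>\<chi> | mult_char \<chi>. \<chi> x)"
    using sum_mult_char_shift[OF A(1), of "\<lambda>\<chi>. \<chi> x"]
    by (simp add: char_mult_def sum_distrib_left mult.commute)
  then show ?thesis using A(2) by simp
qed simp

text \<open>Double counting of the sum of \<chi>(x) over all \<chi> and x: summed over \<chi>, only
  x = 1 contributes; summed over x, only the trivial character does.\<close>

lemma card_mult_chars: "card {\<chi> :: 'a::{finite,field} \<Rightarrow> complex. mult_char \<chi>} = CARD('a) - 1"
proof -
  let ?X = "{\<chi> :: 'a \<Rightarrow> complex. mult_char \<chi>}"
  have "of_nat (card ?X) = (\<Sum>\<chi>\<in>?X. \<chi> 1)" by simp
  also have "\<dots> = (\<Sum>x\<in>UNIV. \<Sum>\<chi>\<in>?X. \<chi> x)"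
    by (subst sum.remove[of UNIV "1::'a"]) (auto simp: sum_over_mult_chars_eq_0)
  also have "\<dots> = (\<Sum>\<chi>\<in>?X. \<Sum>x\<in>UNIV. \<chi> x)" by (rule sum.swap)
  also have "\<dots> = (\<Sum>\<chi>\<in>?X. if \<chi> = triv_char then of_nat CARD('a) - 1 else 0)"
    by (intro sum.cong) (simp_all add: sum_mult_char)
  also have "\<dots> = of_nat (CARD('a) - 1)"
    using card_field_gt_1[where 'a='a] by (simp add: sum.delta finite_mult_chars)
  finally show ?thesis by (simp only: of_nat_eq_iff)
qed

lemma sum_over_mult_chars:
  "(\<Sum>\<chi> | mult_char \<chi>. \<chi> (x::'a::{finite,field})) = (if x = 1 then of_nat CARD('a) - 1 else 0)"
  using card_field_gt_1[where 'a='a]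
  by (auto simp: sum_over_mult_chars_eq_0 card_mult_chars)

text \<open>Fourier expansion of \<open>f\<close> on the multiplicative group: under x -> x^n the
  sum over x retains only the characters whose n-th power is trivial. It replaces counting n-th
  roots.\<close>

lemma sum_power_eq_sum_chars:
  fixes f :: "'a::{finite,field} \<Rightarrow> complex"
  shows "(\<Sum>x\<in>UNIV. f (x ^ n) * triv_char x) =
    (\<Sum>\<chi> | mult_char \<chi> \<and> char_pow \<chi> n = triv_char. \<Sum>x\<in>UNIV. f x * \<chi> x)"
proof -
  let ?X = "{\<chi> :: 'a \<Rightarrow> complex. mult_char \<chi>}" and ?q = "of_nat CARD('a) :: complex"
  have q: "?q - 1 \<noteq> 0" using card_field_gt_1[where 'a='a] by simp
  have sub: "(\<Sum>x\<in>UNIV. \<chi> (x ^ n) * triv_char x) = (if char_pow \<chi> n = triv_char then ?q - 1 else 0)"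
    if "mult_char \<chi>" for \<chi> :: "'a \<Rightarrow> complex"
  proof -
    have "(\<Sum>x\<in>UNIV. \<chi> (x ^ n) * triv_char x) = (\<Sum>x\<in>UNIV. char_pow \<chi> n x)"
      using that by (intro sum.cong) (auto simp: mult_char_power char_pow_def triv_char_def)
    then show ?thesis using that by (simp add: sum_mult_char)
  qed
  \<comment> \<open>Fourier inversion; the factor \<open>triv_char y\<close> is forced because all
    characters vanish at 0.\<close>
  have exp: "(?q - 1) * f y * triv_char y = (\<Sum>\<chi>\<in>?X. \<chi> y * (\<Sum>u\<in>UNIV. f u * char_cnj \<chi> u))" for y
  proof -
    have "(\<Sum>\<chi>\<in>?X. \<chi> y * (\<Sum>u\<in>UNIV. f u * char_cnj \<chi> u)) =
        (\<Sum>\<chi>\<in>?X. \<Sum>u\<in>UNIV. f u * \<chi> (y / u))"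
      by (intro sum.cong)
        (simp_all add: sum_distrib_left char_cnj_def cnj_mult_char mult_char_divide divide_inverse
          mult_char_mult mult_char_inverse mult_ac)
    also have "\<dots> = (\<Sum>u\<in>UNIV. f u * (\<Sum>\<chi>\<in>?X. \<chi> (y / u)))"
      by (subst sum.swap) (simp add: sum_distrib_left)
    also have "\<dots> = (\<Sum>u\<in>UNIV. if u = y then f y * ((?q - 1) * triv_char y) else 0)"
      by (intro sum.cong) (auto simp: sum_over_mult_chars triv_char_def)
    finally show ?thesis by (simp add: mult_ac)
  qed
  have "(?q - 1) * (\<Sum>x\<in>UNIV. f (x ^ n) * triv_char x) =
      (\<Sum>x\<in>UNIV. (?q - 1) * f (x ^ n) * triv_char (x ^ n) * triv_char x)"
    by (auto simp: sum_distrib_left mult_ac triv_char_def intro!: sum.cong)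
  also have "\<dots> = (\<Sum>x\<in>UNIV. \<Sum>\<chi>\<in>?X. (\<Sum>u\<in>UNIV. f u * char_cnj \<chi> u) * (\<chi> (x ^ n) * triv_char x))"
    unfolding exp by (simp add: sum_distrib_left sum_distrib_right mult_ac)
  also have "\<dots> = (\<Sum>\<chi>\<in>?X. (\<Sum>u\<in>UNIV. f u * char_cnj \<chi> u) * (if char_pow \<chi> n = triv_char then ?q - 1 else 0))"
    by (subst sum.swap) (auto simp: sub simp flip: sum_distrib_left intro!: sum.cong)
  also have "\<dots> = (?q - 1) * (\<Sum>\<chi> | mult_char \<chi> \<and> char_pow \<chi> n = triv_char. \<Sum>u\<in>UNIV. f u * char_cnj \<chi> u)"
    by (subst sum_distrib_left, intro sum.mono_neutral_cong_right finite_mult_chars) auto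
  also have "(\<Sum>\<chi> | mult_char \<chi> \<and> char_pow \<chi> n = triv_char. \<Sum>u\<in>UNIV. f u * char_cnj \<chi> u) =
     (\<Sum>\<chi> | mult_char \<chi> \<and> char_pow \<chi> n = triv_char. \<Sum>u\<in>UNIV. f u * \<chi> u)"
  proof (rule sum.reindex_bij_witness[of _ char_cnj char_cnj])
    have "char_pow (char_cnj \<chi>) n = char_cnj (char_pow \<chi> n)" for \<chi> :: "'a \<Rightarrow> complex"
      by (simp add: char_pow_def char_cnj_def fun_eq_iff)
    then show "char_cnj a \<in> {\<chi>. mult_char \<chi> \<and> char_pow \<chi> n = triv_char}"
      if "a \<in> {\<chi>. mult_char \<chi> \<and> char_pow \<chi> n = triv_char}" for a :: "'a \<Rightarrow> complex" using that by simp
    then show "char_cnj a \<in> {\<chi>. mult_char \<chi> \<and> char_pow \<chi> n = triv_char}"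
      if "a \<in> {\<chi>. mult_char \<chi> \<and> char_pow \<chi> n = triv_char}" for a :: "'a \<Rightarrow> complex" using that .
  qed simp_all
  finally show ?thesis using q by simp
qed

subsection \<open>Additive characters\<close>

locale additive_character =
  fixes \<psi> :: "'a::{finite,field} \<Rightarrow> complex"
  assumes add: "\<psi> (x + y) = \<psi> x * \<psi> y"
    and zero [simp]: "\<psi> 0 = 1"
    and nontrivial: "\<exists>x. \<psi> x \<noteq> 1"

text \<open>In place of the trace to the prime field, a maximal additively closed set
  \<open>H\<close> avoiding 1 is used. Maximality makes every element congruent modulo
  \<open>H\<close> to a multiple of 1, and the character is read off from the quotient of order
  p.\<close>

lemma additive_character_exists: "\<exists>\<psi> :: 'a::{finite,field} \<Rightarrow> complex. additive_character \<psi>"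
proof -
  define p where "p = CHAR('a)"
  have "p > 0" unfolding p_def by (simp add: finite_imp_CHAR_pos)
  then have "prime p" unfolding p_def by (simp add: prime_CHAR_semidom)
  then have p1: "p > 1" by (rule prime_gt_1_nat)
  have char_dvd: "of_nat k = (0::'a) \<longleftrightarrow> p dvd k" for k
    unfolding p_def by (rule of_nat_eq_0_iff_char_dvd)
  have inv: "\<exists>j. of_nat j * of_nat k = (1::'a)" if "\<not> p dvd k" for k
  proof -
    have "of_nat (k ^ (CARD('a) - 2)) * of_nat k = (of_nat k :: 'a) ^ Suc (CARD('a) - 2)"
      by simp
    also have "Suc (CARD('a) - 2) = CARD('a) - 1"
      using card_field_gt_1[where 'a='a] by simp
    finally show ?thesis
      using finite_field_power_card[of "of_nat k :: 'a"] that char_dvd by metis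
  qed
  let ?S = "{H :: 'a set. 0 \<in> H \<and> (\<forall>x\<in>H. \<forall>y\<in>H. x + y \<in> H) \<and> 1 \<notin> H}"
  have "{0} \<in> ?S" by simp
  then obtain H where "H \<in> ?S" and max: "\<And>H'. H' \<in> ?S \<Longrightarrow> H \<subseteq> H' \<Longrightarrow> H = H'"
    using finite_has_maximal2[of ?S "{0}"] by auto
  then have H: "0 \<in> H" "\<And>x y. x \<in> H \<Longrightarrow> y \<in> H \<Longrightarrow> x + y \<in> H" "1 \<notin> H" by auto
  have mult_H: "of_nat k * h \<in> H" if "h \<in> H" for k h
    by (induction k) (use H that in \<open>simp_all add: distrib_right\<close>)
  \<comment> \<open>\<open>H\<close> is only known to be closed under addition, so negation is
    performed as multiplication by p - 1.\<close>
  have neg: "of_nat (p - 1) * x = - x" for x :: 'a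
    using char_dvd[of p] p1 by (simp add: of_nat_diff)
  have dvdI: "p dvd k" if "of_nat k \<in> H" for k
    using inv[of k] mult_H[OF that] H(3) by metis
  have decomp: "\<exists>k. \<exists>h\<in>H. x = h + of_nat k" for x
  proof (rule ccontr)
    assume none: "\<not> (\<exists>k. \<exists>h\<in>H. x = h + of_nat k)"
    \<comment> \<open>Adjoining the multiples of \<open>x\<close> enlarges \<open>H\<close>, so by
      maximality 1 must enter. Solving that equation for \<open>x\<close> gives the excluded
      decomposition.\<close>
    let ?H = "{h + of_nat k * x | h k. h \<in> H}"
    have "h = h + of_nat 0 * x" for h by simp
    then have sub: "H \<subseteq> ?H" by blast
    have "x = 0 + of_nat 1 * x" by simp
    then have x: "x \<in> ?H" using H(1) by blast
    have "x = x + of_nat 0" by simp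
    then have "x \<notin> H" using none by blast
    have "?H \<notin> ?S"
    proof
      assume "?H \<in> ?S"
      from max[OF this sub] x \<open>x \<notin> H\<close> show False by simp
    qed
    moreover have "0 \<in> ?H" using sub H(1) by blast
    moreover have "a + b \<in> ?H" if "a \<in> ?H" "b \<in> ?H" for a b
    proof -
      obtain h k where "h \<in> H" "a = h + of_nat k * x" using \<open>a \<in> ?H\<close> by blast
      moreover obtain h' k' where "h' \<in> H" "b = h' + of_nat k' * x" using \<open>b \<in> ?H\<close> by blast
      ultimately have "a + b = (h + h') + of_nat (k + k') * x" "h + h' \<in> H"
        using H(2) by (simp_all add: algebra_simps)
      then show ?thesis by blast
    qed
    ultimately have "1 \<in> ?H" by blast
    then obtain h k where h: "h \<in> H" "1 = h + of_nat k * x" by blast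
    show False
    proof (cases "p dvd k")
      case True
      then show False using h H(3) char_dvd[of k] by simp
    next
      case False
      then obtain j where j: "of_nat j * of_nat k = (1::'a)" using inv by blast
      have "of_nat j * (of_nat k * x) = x"
        using j by (simp flip: mult.assoc)
      moreover have "1 - h = of_nat k * x" using h(2) by (metis add_diff_cancel_left')
      ultimately have "x = of_nat j * (1 - h)" by simp
      also have "\<dots> = of_nat j * (of_nat (p - 1) * h) + of_nat j"
        by (simp only: neg) (simp add: algebra_simps)
      finally show False using none mult_H h(1) by blast
    qed
  qed
  define e where "e = cis (2 * pi / real p)"
  have e_pow: "e ^ i = cis (2 * pi * real i / real p)" for i
    by (simp add: e_def DeMoivre mult_ac)
  have e_p: "e ^ p = 1" using p1 by (simp add: e_pow)
  \<comment> \<open>The chosen \<open>k\<close> is determined modulo p, because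
    \<open>of_nat k \<in> H\<close> forces p to divide k; hence \<open>e ^ L x\<close> does not
    depend on the choice.\<close>
  define L where "L x = (SOME k. \<exists>h\<in>H. x = h + of_nat k)" for x
  have L: "\<exists>h\<in>H. x = h + of_nat (L x)" for x
    unfolding L_def using decomp[of x] by (rule someI_ex)
  have e_eq: "e ^ L x = e ^ k" if "h \<in> H" "x = h + of_nat k" for x h k
  proof -
    obtain h' where h': "h' \<in> H" "x = h' + of_nat (L x)" using L by blast
    have "of_nat (L x + (p - 1) * k) = of_nat (L x) + of_nat (p - 1) * (of_nat k :: 'a)"
      by (simp only: of_nat_add of_nat_mult)
    also have "\<dots> = of_nat (p - 1) * h' + h"
      using that(2) h'(2) unfolding neg by (simp add: algebra_simps)
    finally have "p dvd L x + (p - 1) * k"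
      using mult_H[OF h'(1)] H(2) that(1) dvdI by metis
    then have "e ^ (L x + (p - 1) * k) = 1"
      by (auto simp: power_mult e_p elim!: dvdE)
    then have "e ^ (L x + (p - 1) * k) * e ^ k = e ^ k" by simp
    moreover have "L x + (p - 1) * k + k = L x + p * k"
      using p1 by (cases p) auto
    ultimately have "e ^ (L x + p * k) = e ^ k" by (metis power_add)
    then show ?thesis by (simp add: power_add power_mult e_p)
  qed
  have "additive_character (\<lambda>x. e ^ L x)"
  proof
    fix x y
    obtain h h' where h: "h \<in> H" "x = h + of_nat (L x)" "h' \<in> H" "y = h' + of_nat (L y)"
      using L by metis
    have "x + y = (h + of_nat (L x)) + (h' + of_nat (L y))"
      using h(2,4) by (rule arg_cong2)
    also have "\<dots> = (h + h') + of_nat (L x + L y)" by simp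
    finally have "x + y = (h + h') + of_nat (L x + L y)" .
    then show "e ^ L (x + y) = e ^ L x * e ^ L y"
      using e_eq H(2)[OF h(1,3)] by (metis power_add)
  next
    show "e ^ L 0 = 1" using e_eq[of 0 0 0] H(1) by simp
  next
    have "e ^ L 1 = e ^ 1" using e_eq[of 0 1 1] H(1) by simp
    moreover have "e ^ 1 \<noteq> e ^ 0"
      using bij_betw_imp_inj_on[OF bij_betw_roots_unity[OF \<open>p > 0\<close>]] p1
      unfolding e_pow by (metis inj_onD lessThan_iff zero_less_one order.strict_trans zero_neq_one)
    ultimately show "\<exists>x. e ^ L x \<noteq> 1" by (metis power_0)
  qed
  then show ?thesis by blast
qed

subsection \<open>Jacobi sums over arbitrary totals\<close>

text \<open>The total is a parameter because the recursion lowers it, and because summing over all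
  totals against \<open>\<psi>\<close> turns this iterated convolution into a product of Gauss
  sums.\<close>

fun jacobi_at :: "('a::{finite,field} \<Rightarrow> complex) list \<Rightarrow> 'a \<Rightarrow> complex" where
  "jacobi_at [] s = (if s = 0 then 1 else 0)"
| "jacobi_at (c # cs) s = (\<Sum>x\<in>UNIV. c x * jacobi_at cs (s - x))"

lemma finite_lists_length_eq_UNIV:
  "finite {xs :: 'a::finite list. length xs = n \<and> P xs}"
  by (rule finite_subset[OF _ finite_lists_length_eq[of UNIV n]]) auto

lemma sum_lists_Suc:
  fixes f :: "'a::finite list \<Rightarrow> 'b::comm_monoid_add"
  shows "(\<Sum>xs | length xs = Suc n \<and> P xs. f xs) =
    (\<Sum>x\<in>UNIV. \<Sum>xs | length xs = n \<and> P (x # xs). f (x # xs))"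
proof -
  have "(\<Sum>x\<in>UNIV. \<Sum>xs | length xs = n \<and> P (x # xs). f (x # xs)) =
      (\<Sum>(x, xs)\<in>Sigma UNIV (\<lambda>x. {xs. length xs = n \<and> P (x # xs)}). f (x # xs))"
    by (rule sum.Sigma) (simp_all add: finite_lists_length_eq_UNIV)
  also have "\<dots> = (\<Sum>xs | length xs = Suc n \<and> P xs. f xs)"
    by (rule sum.reindex_bij_witness[of _ "\<lambda>xs. (hd xs, tl xs)" "\<lambda>(x, xs). x # xs"])
      (auto simp: length_Suc_conv)
  finally show ?thesis by simp
qed

lemma jacobi_at_eq:
  "jacobi_at cs s = (\<Sum>xs | length xs = length cs \<and> sum_list xs = s.
     prod_list (map2 (\<lambda>c x. c x) cs xs))"
proof (induction cs arbitrary: s)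
  case Nil
  have "{xs. length xs = 0 \<and> sum_list xs = s} = (if s = 0 then {[]} else {})" by auto
  then show ?case by simp
next
  case (Cons c cs)
  have "(x + sum_list xs = s) = (sum_list xs = s - x)" for x :: 'a and xs
    by (auto simp: algebra_simps)
  then show ?case by (simp add: sum_lists_Suc Cons sum_distrib_left)
qed

lemma jacobi_eq_jacobi_at: "jacobi cs = jacobi_at cs 1"
  by (simp add: jacobi_def jacobi_at_eq)

lemma jacobi_2: "jacobi [A, B] = (\<Sum>x\<in>UNIV. A x * B (1 - x))"
  by (simp add: jacobi_eq_jacobi_at if_distrib cong: if_cong)

lemma jacobi_3: "jacobi [A, B, C] = (\<Sum>x\<in>UNIV. \<Sum>y\<in>UNIV. A x * B y * C (1 - x - y))"
  by (simp add: jacobi_eq_jacobi_at if_distrib sum_distrib_left mult.assoc cong: if_cong)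

definition char_prod :: "('a::field \<Rightarrow> complex) list \<Rightarrow> 'a \<Rightarrow> complex" where
  "char_prod cs = foldr char_mult cs triv_char"

lemma char_prod_simps [simp]:
  "char_prod [] = triv_char" "char_prod (c # cs) = char_mult c (char_prod cs)"
  by (simp_all add: char_prod_def)

lemma mult_char_char_prod: "list_all mult_char cs \<Longrightarrow> mult_char (char_prod cs)"
  by (induction cs) simp_all

text \<open>Scale all variables by \<open>a\<close>. Nonzero totals thus reduce to total 1, and at
  total 0 the value vanishes if the product of the characters is nontrivial.\<close>

lemma jacobi_at_scale:
  assumes "list_all mult_char cs" "a \<noteq> 0"
  shows "jacobi_at cs (a * s) = char_prod cs a * jacobi_at cs s"
  using assms(1)
proof (induction cs arbitrary: s)
  case (Cons c cs)
  have "jacobi_at (c # cs) (a * s) = (\<Sum>x\<in>UNIV. c (a * x) * jacobi_at cs (a * s - a * x))"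
    using sum_scale[OF assms(2), of "\<lambda>x. c x * jacobi_at cs (a * s - x)"] by simp
  also have "\<dots> = (\<Sum>x\<in>UNIV. c a * char_prod cs a * (c x * jacobi_at cs (s - x)))"
    unfolding right_diff_distrib[symmetric] using Cons by (simp add: mult_char_mult) (simp add: mult_ac)
  finally show ?case by (simp add: char_mult_def sum_distrib_left)
qed (use assms in \<open>simp add: triv_char_def\<close>)

lemma sum_jacobi_at: "(\<Sum>s\<in>UNIV. jacobi_at cs s) = prod_list (map (\<lambda>c. \<Sum>x\<in>UNIV. c x) cs)"
proof (induction cs)
  case (Cons c cs)
  have "(\<Sum>s\<in>UNIV. jacobi_at (c # cs) s) = (\<Sum>x\<in>UNIV. c x * (\<Sum>s\<in>UNIV. jacobi_at cs (s + (- x))))"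
    by (simp add: sum_distrib_left) (rule sum.swap)
  then show ?case unfolding sum_translate by (simp add: Cons sum_distrib_right)
qed simp

section \<open>Gauss sums and their relation to Jacobi sums\<close>

context additive_character
begin

definition gauss :: "('a \<Rightarrow> complex) \<Rightarrow> complex" where
  "gauss \<chi> = (\<Sum>x\<in>UNIV. \<chi> x * \<psi> x)"

lemma card_nonzero [simp]: "complex_of_nat CARD('a) \<noteq> 0" "complex_of_nat CARD('a) - 1 \<noteq> 0" "complex_of_nat CARD('a) \<noteq> 1"
  using card_field_gt_1[where 'a='a] by auto

lemma sum_psi: "(\<Sum>x\<in>UNIV. \<psi> x) = 0"
proof -
  obtain a where "\<psi> a \<noteq> 1" using nontrivial by blast
  moreover have "\<psi> a * (\<Sum>x\<in>UNIV. \<psi> x) = (\<Sum>x\<in>UNIV. \<psi> x)"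
    using sum_translate[of \<psi> a] by (simp add: add sum_distrib_left mult.commute)
  ultimately show ?thesis by simp
qed

lemma sum_psi_scale: "(\<Sum>x\<in>UNIV. \<psi> (a * x)) = (if a = 0 then complex_of_nat CARD('a) else 0)"
  using sum_scale[of a \<psi>] sum_psi by simp

lemma gauss_triv [simp]: "gauss triv_char = -1"
proof -
  have "gauss triv_char = (\<Sum>x\<in>UNIV. \<psi> x - (if x = 0 then 1 else 0))"
    unfolding gauss_def by (intro sum.cong) (auto simp: triv_char_def)
  then show ?thesis by (simp add: sum_subtractf sum_psi)
qed

lemma sum_char_psi_scale:
  assumes "mult_char \<chi>" "a \<noteq> 0"
  shows "(\<Sum>x\<in>UNIV. \<chi> x * \<psi> (a * x)) = char_cnj \<chi> a * gauss \<chi>"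
proof -
  have "(\<Sum>x\<in>UNIV. \<chi> x * \<psi> (a * x)) = (\<Sum>x\<in>UNIV. char_cnj \<chi> a * (\<chi> (a * x) * \<psi> (a * x)))"
    using assms by (intro sum.cong) (auto simp: mult_char_mult char_cnj_def cnj_mult_char)
  then show ?thesis
    using sum_scale[OF assms(2), of "\<lambda>x. \<chi> x * \<psi> x"]
    by (simp add: gauss_def flip: sum_distrib_left)
qed

lemma gauss_cnj:
  assumes "mult_char \<chi>" "\<chi> \<noteq> triv_char"
  shows "gauss \<chi> * gauss (char_cnj \<chi>) = \<chi> (-1) * complex_of_nat CARD('a)"
proof -
  have "gauss \<chi> * gauss (char_cnj \<chi>) = (\<Sum>y\<in>UNIV. char_cnj \<chi> y * gauss \<chi> * \<psi> y)"
    by (simp add: gauss_def[of "char_cnj \<chi>"] sum_distrib_left mult_ac)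
  \<comment> \<open>The factor \<chi>(y)^-1 is absorbed into the inner sum. This remains true at y =
    0, where both sides vanish because \<chi> is nontrivial.\<close>
  also have "\<dots> = (\<Sum>y\<in>UNIV. (\<Sum>t\<in>UNIV. \<chi> t * \<psi> (y * t)) * \<psi> y)"
  proof (intro sum.cong refl)
    fix y
    show "char_cnj \<chi> y * gauss \<chi> * \<psi> y = (\<Sum>t\<in>UNIV. \<chi> t * \<psi> (y * t)) * \<psi> y"
      using assms by (cases "y = 0") (simp_all add: sum_char_psi_scale sum_mult_char char_cnj_def)
  qed
  also have "\<dots> = (\<Sum>t\<in>UNIV. \<chi> t * (\<Sum>y\<in>UNIV. \<psi> ((t + 1) * y)))"
    by (simp add: sum_distrib_left sum_distrib_right)
      (subst sum.swap, simp add: algebra_simps add)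
  also have "\<dots> = (\<Sum>t\<in>UNIV. if t = -1 then \<chi> t * complex_of_nat CARD('a) else 0)"
    unfolding sum_psi_scale by (intro sum.cong) (auto simp: eq_neg_iff_add_eq_0)
  finally show ?thesis by simp
qed

lemma gauss_nonzero [simp]:
  assumes "mult_char \<chi>"
  shows "gauss \<chi> \<noteq> 0"
  using gauss_cnj[OF assms] assms by (cases "\<chi> = triv_char") auto

text \<open>The additive Fourier transform turns convolution into multiplication.\<close>

lemma sum_jacobi_at_psi: "(\<Sum>s\<in>UNIV. jacobi_at cs s * \<psi> s) = prod_list (map gauss cs)"
proof (induction cs)
  case Nil
  have "(\<Sum>s\<in>UNIV. jacobi_at [] s * \<psi> s) = (\<Sum>s\<in>(UNIV :: 'a set). if s = 0 then 1 else 0 :: complex)"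
    by (intro sum.cong) auto
  then show ?case by simp
next
  case (Cons c cs)
  have eq: "\<psi> s = \<psi> x * \<psi> (s - x)" for s x using add[of x "s - x"] by simp
  have "(\<Sum>s\<in>UNIV. jacobi_at (c # cs) s * \<psi> s) =
     (\<Sum>s\<in>UNIV. \<Sum>x\<in>UNIV. c x * \<psi> x * (jacobi_at cs (s - x) * \<psi> (s - x)))"
    unfolding jacobi_at.simps sum_distrib_right
  proof (intro sum.cong refl)
    fix s x
    show "c x * jacobi_at cs (s - x) * \<psi> s = c x * \<psi> x * (jacobi_at cs (s - x) * \<psi> (s - x))"
      by (simp only: eq[of s x] mult_ac)
  qed
  also have "\<dots> = (\<Sum>x\<in>UNIV. c x * \<psi> x * (\<Sum>s\<in>UNIV. jacobi_at cs (s + (- x)) * \<psi> (s + (- x))))"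
    by (subst sum.swap) (simp add: sum_distrib_left)
  also have "\<dots> = (\<Sum>x\<in>UNIV. c x * \<psi> x * (\<Sum>s\<in>UNIV. jacobi_at cs s * \<psi> s))"
    using sum_translate[of "\<lambda>s. jacobi_at cs s * \<psi> s" "- x" for x] by simp
  finally show ?case by (simp add: Cons gauss_def sum_distrib_right)
qed

lemma jacobi_at_split: "(\<Sum>s\<in>UNIV. jacobi_at cs s * f s) =
   jacobi_at cs 0 * f 0 + jacobi cs * (\<Sum>s\<in>UNIV. char_prod cs s * f s)"
  if cs: "list_all mult_char cs"
proof -
  have "jacobi_at cs s * f s = (if s = 0 then jacobi_at cs 0 * f 0 else 0)
      + jacobi cs * (char_prod cs s * f s)" for s
    using jacobi_at_scale[OF cs, of s 1] mult_char_char_prod[OF cs]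
    by (simp add: jacobi_eq_jacobi_at)
  then have "(\<Sum>s\<in>UNIV. jacobi_at cs s * f s) =
      (\<Sum>s\<in>UNIV. (if s = 0 then jacobi_at cs 0 * f 0 else 0) + jacobi cs * (char_prod cs s * f s))"
    by (intro sum.cong refl)
  then show ?thesis by (simp add: sum.distrib sum_distrib_left)
qed

text \<open>With nontrivial product character the total 0 contributes nothing, and the other totals
  are multiples of the Jacobi sum by homogeneity.\<close>

lemma gauss_prod_eq_jacobi:
  assumes cs: "list_all mult_char cs" and "char_prod cs \<noteq> triv_char"
  shows "prod_list (map gauss cs) = gauss (char_prod cs) * jacobi cs"
proof -
  note mc = mult_char_char_prod[OF cs]
  obtain a where a: "a \<noteq> 0" "char_prod cs a \<noteq> 1"
    using assms(2) mc by (auto simp: triv_char_def fun_eq_iff split: if_splits)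
  then have "jacobi_at cs 0 = 0"
    using jacobi_at_scale[OF cs, of a 0] by simp
  then show ?thesis
    using jacobi_at_split[OF cs, of \<psi>] by (simp add: sum_jacobi_at_psi gauss_def)
qed

text \<open>The values at totals 0 and 1 are two unknowns. Summing over all totals, once plainly
  (giving 0, since \<open>c\<close> is nontrivial) and once against \<open>\<psi>\<close>, gives two
  linear equations for them.\<close>

lemma jacobi_eq_gauss_prod:
  assumes cs: "list_all mult_char cs" and triv: "char_prod cs = triv_char"
    and c: "c \<in> set cs" "c \<noteq> triv_char"
  shows "jacobi cs = - prod_list (map gauss cs) / complex_of_nat CARD('a)"
proof -
  have "(\<Sum>x\<in>UNIV. c x) = 0"
    using c cs by (simp add: sum_mult_char list_all_iff)
  then have "prod_list (map (\<lambda>c. \<Sum>x\<in>UNIV. c x) cs) = 0"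
    using c(1) by (auto simp: prod_list_zero_iff)
  then have "jacobi_at cs 0 = - jacobi cs * (complex_of_nat CARD('a) - 1)"
    using jacobi_at_split[OF cs, of "\<lambda>_. 1"] by (simp add: sum_jacobi_at triv sum_triv_char add_eq_0_iff)
  moreover have "prod_list (map gauss cs) = jacobi_at cs 0 - jacobi cs"
    using jacobi_at_split[OF cs, of \<psi>] gauss_triv by (simp add: sum_jacobi_at_psi triv flip: gauss_def)
  ultimately have "prod_list (map gauss cs) = - jacobi cs * (complex_of_nat CARD('a) - 1) - jacobi cs"
    by (simp only:)
  then have "prod_list (map gauss cs) = - complex_of_nat CARD('a) * jacobi cs"
    by (simp add: algebra_simps)
  then show ?thesis by simp
qed

end

subsection \<open>Hasse--Davenport product relations\<close>

lemma sum_via_power: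
  fixes f :: "'a::{finite,field} \<Rightarrow> complex"
  assumes "n > 0"
  shows "(\<Sum>x\<in>UNIV. f (x ^ n)) =
    f 0 + (\<Sum>\<chi> | mult_char \<chi> \<and> char_pow \<chi> n = triv_char. \<Sum>x\<in>UNIV. f x * \<chi> x)"
proof -
  have "f (x ^ n) = (if x = 0 then f 0 else 0) + f (x ^ n) * triv_char x" for x
    using assms by (cases "x = 0") (simp_all add: triv_char_def zero_power)
  then have "(\<Sum>x\<in>UNIV. f (x ^ n)) = (\<Sum>x\<in>UNIV. (if x = 0 then f 0 else 0) + f (x ^ n) * triv_char x)"
    by (intro sum.cong refl)
  then show ?thesis by (simp add: sum.distrib sum_power_eq_sum_chars)
qed

lemma jacobi_triv_right:
  assumes "mult_char (\<chi> :: 'a::{finite,field} \<Rightarrow> complex)" "\<chi> \<noteq> triv_char"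
  shows "(\<Sum>x\<in>UNIV. \<chi> (1 - x) * triv_char x) = -1"
proof -
  have "(\<Sum>x\<in>UNIV. \<chi> (1 - x) * triv_char x) = (\<Sum>x\<in>UNIV. \<chi> (1 - x) - (if x = 0 then 1 else 0))"
    using assms by (intro sum.cong refl) (simp add: triv_char_def)
  also have "\<dots> = -1"
    using assms sum_reflect[of \<chi> 1] by (simp add: sum_subtractf sum_mult_char)
  finally show ?thesis .
qed

lemma jacobi_2': "jacobi [A, B] = (\<Sum>x\<in>UNIV. A (1 - x) * B x)"
  using sum_reflect[of "\<lambda>x. A x * B (1 - x)" 1] by (simp add: jacobi_2)

text \<open>Complete the square: 4x(1-x) = 1 - (1-2x)^2. A nonzero element has 1 + \<rho> of it
  square roots, which brings in \<rho>.\<close>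

lemma jacobi_duplication:
  fixes \<chi> \<rho> :: "'a::{finite,field} \<Rightarrow> complex"
  assumes chi: "mult_char \<chi>" "\<chi> \<noteq> triv_char" and rho: "\<rho> \<noteq> triv_char"
    and order2: "{\<phi>. mult_char \<phi> \<and> char_pow \<phi> 2 = triv_char} = {triv_char, \<rho>}"
    and two: "(2::'a) \<noteq> 0"
  shows "\<chi> 4 * jacobi [\<chi>, \<chi>] = jacobi [\<chi>, \<rho>]"
proof -
  have "\<chi> 4 * jacobi [\<chi>, \<chi>] = (\<Sum>x\<in>UNIV. \<chi> (1 - (1 - 2 * x) ^ 2))"
    unfolding jacobi_2 sum_distrib_left
    by (intro sum.cong refl) (simp add: power2_eq_square algebra_simps flip: mult_char_mult[OF chi(1)])
  also have "\<dots> = (\<Sum>u\<in>UNIV. \<chi> (1 - u ^ 2))"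
    using sum_scale[OF two, of "\<lambda>x. \<chi> (1 - (1 - x) ^ 2)"] sum_reflect[of "\<lambda>x. \<chi> (1 - x ^ 2)" 1]
    by simp
  \<comment> \<open>The 1 is the term u = 0; it cancels the -1 of the trivial character.\<close>
  also have "\<dots> = 1 + (\<Sum>\<phi>\<in>{triv_char, \<rho>}. \<Sum>x\<in>UNIV. \<chi> (1 - x) * \<phi> x)"
    using sum_via_power[of 2 "\<lambda>x. \<chi> (1 - x)"] chi by (simp add: order2)
  also have "\<dots> = jacobi [\<chi>, \<rho>]"
    using rho jacobi_triv_right[OF chi] by (simp add: jacobi_2')
  finally show ?thesis .
qed

section \<open>Multiplication by three: counting roots of a cubic\<close>

context
  fixes \<zeta> :: "'a::{finite,field}" and \<rho> :: "'a \<Rightarrow> complex"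
  assumes zeta: "\<zeta>\<^sup>2 + \<zeta> + 1 = 0"
    and two: "(2::'a) \<noteq> 0" and three: "(3::'a) \<noteq> 0"
    and rho: "mult_char \<rho>" "\<rho> \<noteq> triv_char" "char_pow \<rho> 3 = triv_char"
begin

lemma rho_cube: "x \<noteq> 0 \<Longrightarrow> \<rho> x ^ 3 = 1"
  using fun_cong[OF rho(3), of x] by (simp add: char_pow_def triv_char_def)

lemma rho_of_cube: "x \<noteq> 0 \<Longrightarrow> \<rho> (x ^ 3) = 1"
  by (simp add: mult_char_power[OF rho(1)] rho_cube)

lemma rho_square: "\<rho> x ^ 2 = cnj (\<rho> x)"
proof (cases "x = 0")
  case False
  then have "\<rho> x ^ 2 * \<rho> x = 1" using rho_cube[OF False] by (simp add: power3_eq_cube power2_eq_square)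
  then show ?thesis using False rho by (simp add: cnj_mult_char field_simps)
qed (use rho in simp)

lemma rho_minus_1: "\<rho> (-1) = 1"
  using rho_cube[of "-1"] mult_char_minus_1_cases[OF rho(1)] by auto

text \<open>Cardano's substitution read backwards: \<alpha> and u - \<alpha> have product v, and
  their cubes add up to u^3 - 3uv.\<close>

lemma cube_root_eq:
  fixes u v U \<alpha> :: 'a
  assumes "v \<noteq> 0" "\<alpha> ^ 2 - u * \<alpha> + v = 0" "u ^ 3 - 3 * u * v = U"
  shows "\<alpha> ^ 3 \<noteq> 0" "\<alpha> ^ 3 + v ^ 3 / \<alpha> ^ 3 = U"
proof -
  have ab: "\<alpha> * (u - \<alpha>) = v" using assms(2) by Groebner_Basis.algebra
  then have "\<alpha> \<noteq> 0" using assms(1) by auto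
  then show "\<alpha> ^ 3 \<noteq> 0" by simp
  have "v ^ 3 / \<alpha> ^ 3 = (u - \<alpha>) ^ 3"
    using \<open>\<alpha> \<noteq> 0\<close> by (simp add: power_mult_distrib flip: ab)
  moreover have "\<alpha> ^ 3 + (u - \<alpha>) ^ 3 = u ^ 3 - 3 * u * (\<alpha> * (u - \<alpha>))"
    by (simp add: algebra_simps power3_eq_cube)
  then have "\<alpha> ^ 3 + (u - \<alpha>) ^ 3 = U" using assms(3) by (simp only: ab)
  ultimately show "\<alpha> ^ 3 + v ^ 3 / \<alpha> ^ 3 = U" by simp
qed

lemma card_cubic_roots_le:
  "card {u::'a. u ^ 3 - 3 * u * v = U} \<le> 3"
proof -
  let ?p = "[:- U, - 3 * v, 0, 1:]"
  have "{u. u ^ 3 - 3 * u * v = U} = {u. poly ?p u = 0}"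
    by (auto simp: power3_eq_cube algebra_simps)
  then show ?thesis using card_poly_roots_bound[of ?p] by simp
qed

lemma sqrt_minus_3: "(2 * \<zeta> + 1) ^ 2 = -3" "2 * \<zeta> + 1 \<noteq> 0"
proof -
  show "(2 * \<zeta> + 1) ^ 2 = -3" using zeta by Groebner_Basis.algebra
  then show "2 * \<zeta> + 1 \<noteq> 0" using three by auto
qed

lemma quadratic_root:
  assumes "d ^ 2 = u ^ 2 - 4 * v"
  shows "((u + d) / 2) ^ 2 - u * ((u + d) / 2) + (v::'a) = 0"
proof -
  define a where "a = (u + d) / 2"
  have "2 * a = u + d" using two by (simp add: a_def)
  then have "4 * (a ^ 2 - u * a + v) = 0" using assms by Groebner_Basis.algebra
  moreover have "(4::'a) \<noteq> 0" using two by (metis mult_2 mult_eq_0_iff numeral_Bit0)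
  ultimately show ?thesis unfolding a_def[symmetric] mult_eq_0_iff by blast
qed

text \<open>For the cubic \<open>u\<^sup>3 - 3uv = U\<close>, substitute \<open>u = \<alpha> + v / \<alpha>\<close>: then \<open>\<alpha>\<^sup>3\<close> is one of the two
  solutions \<open>A\<close> of \<open>A + v\<^sup>3 / A = U\<close>.\<close>
lemma card_cubic_roots_bound:
  fixes v U :: 'a
  assumes v: "v \<noteq> 0"
  shows "real (card {u. u ^ 3 - 3 * u * v = U})
     \<le> 1 + Re (\<Sum>A | A \<noteq> 0 \<and> A + v ^ 3 / A = U. \<rho> A ^ 2)"
    and "Im (\<Sum>A | A \<noteq> 0 \<and> A + v ^ 3 / A = U. \<rho> A ^ 2) = 0"
proof -
  let ?N = "{u. u ^ 3 - 3 * u * v = U}" and ?R = "{A. A \<noteq> 0 \<and> A + v ^ 3 / A = U}"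
  have "real (card ?N) \<le> 1 + Re (\<Sum>A\<in>?R. \<rho> A ^ 2) \<and> Im (\<Sum>A\<in>?R. \<rho> A ^ 2) = 0"
  proof (cases "?R = {}")
    case True
    have uniq: "u1 = u2" if u: "u1 \<in> ?N" "u2 \<in> ?N" for u1 u2
    proof (rule ccontr)
      assume "u1 \<noteq> u2"
      have "(u1 - u2) * (u1 ^ 2 + u1 * u2 + u2 ^ 2 - 3 * v) =
          (u1 ^ 3 - 3 * u1 * v) - (u2 ^ 3 - 3 * u2 * v)"
        by (simp add: algebra_simps power2_eq_square power3_eq_cube)
      then have "(u1 - u2) * (u1 ^ 2 + u1 * u2 + u2 ^ 2 - 3 * v) = 0" using u by simp
      then have quad: "u1 ^ 2 + u1 * u2 + u2 ^ 2 - 3 * v = 0" using \<open>u1 \<noteq> u2\<close> by simp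
      \<comment> \<open>When the quadratic cofactor vanishes, (u1 + 2 u2)^2 equals -3 (u1^2 - 4v).
        Since -3 is the square of 2\<zeta> + 1, the discriminant for u1 is a square, and Cardano
        yields an \<open>A\<close> although there is none.\<close>
      define d where "d = (u1 + 2 * u2) / (2 * \<zeta> + 1)"
      have "d * (2 * \<zeta> + 1) = u1 + 2 * u2" using sqrt_minus_3(2) by (simp add: d_def)
      then have "-3 * (d ^ 2 - (u1 ^ 2 - 4 * v)) = 0" using quad sqrt_minus_3(1) by Groebner_Basis.algebra
      then have "d ^ 2 = u1 ^ 2 - 4 * v" using three unfolding mult_eq_0_iff by simp
      note cube_root_eq[OF v quadratic_root[OF this] u(1)[unfolded mem_Collect_eq]]
      then have "((u1 + d) / 2) ^ 3 \<in> ?R" unfolding mem_Collect_eq by (rule conjI)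
      then show False unfolding True by (rule emptyE)
    qed
    have "finite ?N" by simp
    then have "card ?N \<le> Suc 0"
      by (rule card_le_Suc0_iff_eq[THEN iffD2]) (intro ballI uniq)
    then show ?thesis unfolding True by simp
  next
    case False
    then obtain A where A: "A \<noteq> 0" "A + v ^ 3 / A = U" by auto
    define B where "B = v ^ 3 / A"
    have B: "B \<noteq> 0" "A * B = v ^ 3" "A + B = U" "v ^ 3 / B = A"
      using A v by (simp_all add: B_def)
    have R: "?R = {A, B}"
    proof (intro equalityI subsetI)
      fix Y assume "Y \<in> ?R"
      then have "Y \<noteq> 0" "Y + v ^ 3 / Y = U" by auto
      then have "Y * Y + v ^ 3 = U * Y" by (simp add: field_simps)
      then have "(Y - A) * (Y - B) = 0" using B(2,3) by Groebner_Basis.algebra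
      then show "Y \<in> {A, B}" by auto
    qed (use A B in \<open>auto simp: add.commute\<close>)
    have rho_AB: "\<rho> A * \<rho> B = 1"
      using rho_of_cube[OF v] by (simp flip: mult_char_mult[OF rho(1)] B(2))
    then have rho_B: "\<rho> B = cnj (\<rho> A)"
      using A rho by (simp add: cnj_mult_char field_simps)
    show ?thesis
    proof (cases "A = B")
      case True
      have "A = (A / v) ^ 3"
        using v B(2) True by (simp add: field_simps power3_eq_cube)
      then have "\<rho> A = 1" using rho_of_cube[of "A / v"] A(1) v by simp
      moreover have "?N \<subseteq> {2 * (A / v), - (A / v)}"
      proof
        fix u assume u: "u \<in> ?N"
        \<comment> \<open>Here v = s^2 and U = 2 s^3, so the cubic is (u - 2s)(u + s)^2 with at most
          two roots; the right-hand side of the bound is 1 + 1.\<close>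
        define s where "s = A / v"
        have "A = s * v" "s * s = v" using v B(2) True
          by (simp_all add: s_def field_simps power3_eq_cube)
        then have "(u - 2 * s) * (u + s) ^ 2 = 0" using u B(3) True unfolding mem_Collect_eq by Groebner_Basis.algebra
        then show "u \<in> {2 * (A / v), - (A / v)}"
          by (auto simp: s_def[symmetric] add_eq_0_iff2)
      qed
      then have "card ?N \<le> card {2 * (A / v), - (A / v)}" by (intro card_mono) auto
      then have "card ?N \<le> 2" by (rule order_trans) (simp add: card_insert_if)
      ultimately show ?thesis using True by (simp add: R)
    next
      case AB: False
      show ?thesis
      proof (cases "\<rho> A = 1")
        case True
        \<comment> \<open>Two distinct solutions at which \<rho> is 1 make the right-hand side 3,
          which is the degree bound.\<close>
        then show ?thesis using AB card_cubic_roots_le[of v U] rho_B by (simp add: R)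
      next
        case False
        have "?N = {}"
        proof (rule ccontr)
          assume "?N \<noteq> {}"
          then obtain u where u: "u ^ 3 - 3 * u * v = U" by auto
          \<comment> \<open>The discriminant of the quadratic with roots A and B contains that of
            T^2 - uT + v up to a square. A root u would therefore split the latter, and A or B would
            be a cube, contrary to \<rho>(A) \<noteq> 1. In this case the right-hand side of the
            bound is 0.\<close>
          have disc: "(A - B) ^ 2 = (u ^ 2 - 4 * v) * (u ^ 2 - v) ^ 2"
          proof -
            have "(A - B) ^ 2 = (A + B) ^ 2 - 4 * (A * B)"
              by (simp add: algebra_simps power2_eq_square)
            also have "\<dots> = (u ^ 3 - 3 * u * v) ^ 2 - 4 * v ^ 3" by (simp only: B(2,3) u)
            also have "\<dots> = (u ^ 2 - 4 * v) * (u ^ 2 - v) ^ 2"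
              by (simp add: algebra_simps power2_eq_square power3_eq_cube)
            finally show ?thesis .
          qed
          then have nz: "u ^ 2 - v \<noteq> 0" using AB by auto
          define d where "d = (A - B) / (u ^ 2 - v)"
          have "d ^ 2 = u ^ 2 - 4 * v"
            using nz disc by (simp add: d_def power_divide)
          note alpha = cube_root_eq[OF v quadratic_root[OF this] u]
          then have "((u + d) / 2) ^ 3 = A \<or> ((u + d) / 2) ^ 3 = B"
            using R by blast
          moreover have "\<rho> (((u + d) / 2) ^ 3) = 1"
            using alpha(1) by (intro rho_of_cube) auto
          ultimately show False using False rho_B by auto
        qed
        moreover have "\<rho> A ^ 2 + \<rho> B ^ 2 = -1"
        proof -
          have "(\<rho> A - 1) * (\<rho> A ^ 2 + \<rho> A + 1) = 0"
            using rho_cube[OF A(1)] by (simp add: algebra_simps power2_eq_square power3_eq_cube)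
          then have "\<rho> A ^ 2 + \<rho> A + 1 = 0" using False by simp
          moreover have "\<rho> B ^ 2 = \<rho> A" by (simp add: rho_B rho_square flip: complex_cnj_power)
          ultimately show ?thesis by (simp add: eq_neg_iff_add_eq_0)
        qed
        ultimately show ?thesis using AB by (simp add: R)
      qed
    qed
  qed
  then show "real (card ?N) \<le> 1 + Re (\<Sum>A\<in>?R. \<rho> A ^ 2)" "Im (\<Sum>A\<in>?R. \<rho> A ^ 2) = 0"
    by blast+
qed

text \<open>Both sides of the bound above sum to \<open>q\<close> over all \<open>U\<close>.\<close>
lemma card_cubic_roots:
  fixes v U :: 'a
  assumes v: "v \<noteq> 0"
  shows "of_nat (card {u. u ^ 3 - 3 * u * v = U}) = 1 + (\<Sum>A | A \<noteq> 0 \<and> A + v ^ 3 / A = U. \<rho> A ^ 2)"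
proof -
  define N where "N U = card {u. u ^ 3 - 3 * u * v = U}" for U
  define w where "w U = (\<Sum>A | A \<noteq> 0 \<and> A + v ^ 3 / A = U. \<rho> A ^ 2)" for U
  have "(\<Sum>U\<in>UNIV. N U) = card (UNIV :: 'a set)"
  proof -
    have "(\<Sum>U\<in>UNIV. N U) = (\<Sum>U\<in>UNIV. \<Sum>u | u \<in> UNIV \<and> u ^ 3 - 3 * u * v = U. 1)"
      by (simp add: N_def)
    also have "\<dots> = (\<Sum>u\<in>(UNIV :: 'a set). 1)"
      by (rule sum.group) auto
    finally show ?thesis by simp
  qed
  moreover have "(\<Sum>U\<in>UNIV. w U) = 0"
  proof -
    have "(\<Sum>U\<in>UNIV. w U) = (\<Sum>U\<in>UNIV. \<Sum>A | A \<in> UNIV - {0} \<and> A + v ^ 3 / A = U. \<rho> A ^ 2)"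
      by (simp add: w_def)
    also have "\<dots> = (\<Sum>A\<in>UNIV-{0}. \<rho> A ^ 2)"
      by (rule sum.group) auto
    also have "\<dots> = (\<Sum>A\<in>UNIV. char_cnj \<rho> A)"
      using rho by (intro sum.mono_neutral_cong_left) (auto simp: rho_square char_cnj_def)
    also have "\<dots> = 0" using rho by (simp add: sum_mult_char)
    finally show ?thesis .
  qed
  ultimately have "(\<Sum>U\<in>UNIV. 1 + Re (w U) - real (N U)) = 0"
    by (simp add: sum.distrib sum_subtractf flip: Re_sum of_nat_sum)
  moreover have "1 + Re (w U) - real (N U) \<ge> 0" "Im (w U) = 0" for U
    using card_cubic_roots_bound[OF v, of U] by (simp_all add: N_def w_def)
  ultimately have "1 + Re (w U) - real (N U) = 0" for U
    by (subst (asm) sum_nonneg_eq_0_iff) auto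
  then have "Re (of_nat (N U)) = Re (1 + w U)" by (simp add: algebra_simps)
  then show ?thesis
    using \<open>\<And>U. Im (w U) = 0\<close> by (simp add: complex_eq_iff flip: N_def w_def)
qed

text \<open>In the coordinates u, v the product of the three variables is 1 + u^3 + v^3 - 3uv. For
  fixed nonzero v the root count replaces u by pairs A, B with AB = v^3, for which 1 + A + B + AB
  splits, and the double sum becomes a product of two Jacobi sums.\<close>

lemma jacobi_triplication:
  assumes order3: "{\<phi>. mult_char \<phi> \<and> char_pow \<phi> 3 = triv_char} = {triv_char, \<rho>, char_cnj \<rho>}"
    and distinct: "\<rho> \<noteq> char_cnj \<rho>"
    and chi: "mult_char \<chi>" "\<chi> \<noteq> triv_char"
  shows "\<chi> 27 * jacobi [\<chi>, \<chi>, \<chi>] = jacobi [\<chi>, \<rho>] * jacobi [\<chi>, char_cnj \<rho>]"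
proof -
  note mult = mult_char_mult[OF chi(1)]
  define K where "K \<phi> = (\<Sum>x\<in>UNIV. \<chi> (1 + x) * \<phi> x)" for \<phi> :: "'a \<Rightarrow> complex"
  have sum_neg: "(\<Sum>x\<in>UNIV. f (- x)) = (\<Sum>x\<in>UNIV. f x)" for f :: "'a \<Rightarrow> complex"
    using sum_reflect[of f 0] by simp
  have K_eq: "K \<phi> = \<phi> (-1) * (\<Sum>x\<in>UNIV. \<chi> (1 - x) * \<phi> x)" if "mult_char \<phi>" for \<phi>
    unfolding K_def sum_neg[of "\<lambda>x. \<chi> (1 + x) * \<phi> x", symmetric] sum_distrib_left
  proof (intro sum.cong refl)
    fix x
    show "\<chi> (1 + - x) * \<phi> (- x) = \<phi> (- 1) * (\<chi> (1 - x) * \<phi> x)"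
      using mult_char_minus[OF that, of x] by simp
  qed
  have K_rho: "K \<rho> = jacobi [\<chi>, \<rho>]" "K (char_cnj \<rho>) = jacobi [\<chi>, char_cnj \<rho>]"
    using K_eq[of \<rho>] K_eq[of "char_cnj \<rho>"] rho rho_minus_1
    by (simp_all add: jacobi_2') (simp add: char_cnj_def)
  have K_triv: "K triv_char = -1"
    using K_eq[of triv_char] jacobi_triv_right[OF chi] by (simp add: triv_char_def)
  have sum_order3: "(\<Sum>\<phi> | mult_char \<phi> \<and> char_pow \<phi> 3 = triv_char. f \<phi>) = f triv_char + f \<rho> + f (char_cnj \<rho>)"
    for f :: "('a \<Rightarrow> complex) \<Rightarrow> complex"
  proof -
    have "triv_char \<noteq> char_cnj \<rho>" using rho(2) by (metis char_cnj_eq_triv_iff)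
    then show ?thesis unfolding order3 using distinct rho(2) by (simp add: add.assoc)
  qed
  \<comment> \<open>Rescaling by 3 makes the three variables add up to 3, like the values of 1 + uX
    + vX^2 at the cube roots of unity.\<close>
  have "\<chi> 27 * jacobi [\<chi>, \<chi>, \<chi>] = (\<Sum>x\<in>UNIV. \<Sum>y\<in>UNIV. \<chi> ((3 * x) * (3 * y) * (3 - 3 * x - 3 * y)))"
    unfolding jacobi_3 sum_distrib_left
  proof (intro sum.cong refl)
    fix x y :: 'a
    have "(3 * x) * (3 * y) * (3 - 3 * x - 3 * y) = 27 * (x * y * (1 - x - y))" by Groebner_Basis.algebra
    then show "\<chi> 27 * (\<chi> x * \<chi> y * \<chi> (1 - x - y)) = \<chi> ((3 * x) * (3 * y) * (3 - 3 * x - 3 * y))"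
      by (simp only: mult)
  qed
  also have "\<dots> = (\<Sum>x\<in>UNIV. \<Sum>y\<in>UNIV. \<chi> (x * y * (3 - x - y)))"
    by (subst sum_scale[OF three, of "\<lambda>x. \<Sum>y\<in>UNIV. \<chi> (x * (3 * y) * (3 - x - 3 * y))"],
        subst sum_scale[OF three, of "\<lambda>y. \<chi> (x * y * (3 - x - y))" for x]) (rule refl)
  also have "\<dots> = (\<Sum>(x, y)\<in>UNIV. \<chi> (x * y * (3 - x - y)))"
    by (simp add: sum.cartesian_product)
  \<comment> \<open>A discrete Fourier transform of length three: x, y, 3 - x - y are the values of
    1 + uX + vX^2 at 1, \<zeta>, \<zeta>^2, and interpolation inverts it.\<close>
  also have "\<dots> = (\<Sum>(u, v)\<in>UNIV. \<chi> (1 + u ^ 3 + v ^ 3 - 3 * u * v))"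
  proof (rule sum.reindex_bij_witness[symmetric, of UNIV
        "\<lambda>(x, y). ((x + \<zeta>\<^sup>2 * y + \<zeta> * (3 - x - y)) / 3, (x + \<zeta> * y + \<zeta>\<^sup>2 * (3 - x - y)) / 3)"
        "\<lambda>(u, v). (1 + u + v, 1 + \<zeta> * u + \<zeta>\<^sup>2 * v)" UNIV])
    let ?i = "\<lambda>(x, y). ((x + \<zeta>\<^sup>2 * y + \<zeta> * (3 - x - y)) / 3, (x + \<zeta> * y + \<zeta>\<^sup>2 * (3 - x - y)) / 3)"
    let ?j = "\<lambda>(u, v). (1 + u + v, 1 + \<zeta> * u + \<zeta>\<^sup>2 * v)"
    fix a :: "'a \<times> 'a"
    obtain u v where a: "a = (u, v)" by (cases a)
    have "1 + u + v + \<zeta>\<^sup>2 * (1 + \<zeta> * u + \<zeta>\<^sup>2 * v) + \<zeta> * (3 - (1 + u + v) - (1 + \<zeta> * u + \<zeta>\<^sup>2 * v)) = 3 * u"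
      and "1 + u + v + \<zeta> * (1 + \<zeta> * u + \<zeta>\<^sup>2 * v) + \<zeta>\<^sup>2 * (3 - (1 + u + v) - (1 + \<zeta> * u + \<zeta>\<^sup>2 * v)) = 3 * v"
      using zeta by Groebner_Basis.algebra+
    then show "?i (?j a) = a" using three by (simp add: a)
    have "(1 + u + v) * (1 + \<zeta> * u + \<zeta>\<^sup>2 * v) * (3 - (1 + u + v) - (1 + \<zeta> * u + \<zeta>\<^sup>2 * v)) =
        1 + u ^ 3 + v ^ 3 - 3 * u * v" using zeta by Groebner_Basis.algebra
    then show "(case ?j a of (x, y) \<Rightarrow> \<chi> (x * y * (3 - x - y))) =
        (case a of (u, v) \<Rightarrow> \<chi> (1 + u ^ 3 + v ^ 3 - 3 * u * v))" by (simp add: a)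
  next
    let ?i = "\<lambda>(x, y). ((x + \<zeta>\<^sup>2 * y + \<zeta> * (3 - x - y)) / 3, (x + \<zeta> * y + \<zeta>\<^sup>2 * (3 - x - y)) / 3)"
    let ?j = "\<lambda>(u, v). (1 + u + v, 1 + \<zeta> * u + \<zeta>\<^sup>2 * v)"
    fix a :: "'a \<times> 'a"
    obtain x y where a: "a = (x, y)" by (cases a)
    obtain u v where uv: "?i a = (u, v)" by (cases "?i a")
    then have "3 * u = x + \<zeta>\<^sup>2 * y + \<zeta> * (3 - x - y)" "3 * v = x + \<zeta> * y + \<zeta>\<^sup>2 * (3 - x - y)"
      using three by (auto simp: a)
    then have "3 * (1 + u + v) = 3 * x" "3 * (1 + \<zeta> * u + \<zeta>\<^sup>2 * v) = 3 * y"
      using zeta by Groebner_Basis.algebra+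
    then have "1 + u + v = x" "1 + \<zeta> * u + \<zeta>\<^sup>2 * v = y"
      using three mult_left_cancel by blast+
    then show "?j (?i a) = a" unfolding uv by (simp add: a)
  qed auto
  also have "\<dots> = (\<Sum>v\<in>UNIV. \<Sum>u\<in>UNIV. \<chi> (1 + u ^ 3 + v ^ 3 - 3 * u * v))"
    by (subst sum.swap) (simp add: sum.cartesian_product)
  also have "\<dots> = (\<Sum>v\<in>UNIV. (if v = 0 then \<Sum>u\<in>UNIV. \<chi> (1 + u ^ 3) else 0) +
      (\<Sum>A\<in>UNIV. \<rho> A * cnj (\<rho> (v ^ 3 / A)) * (\<chi> (1 + A) * \<chi> (1 + v ^ 3 / A))) * triv_char v)"
  proof (intro sum.cong refl)
    fix v :: 'a
    show "(\<Sum>u\<in>UNIV. \<chi> (1 + u ^ 3 + v ^ 3 - 3 * u * v)) = (if v = 0 then \<Sum>u\<in>UNIV. \<chi> (1 + u ^ 3) else 0) +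
      (\<Sum>A\<in>UNIV. \<rho> A * cnj (\<rho> (v ^ 3 / A)) * (\<chi> (1 + A) * \<chi> (1 + v ^ 3 / A))) * triv_char v"
    proof (cases "v = 0")
      case False
      have "(\<Sum>u\<in>UNIV. \<chi> (1 + u ^ 3 + v ^ 3 - 3 * u * v)) =
          (\<Sum>U\<in>UNIV. \<Sum>u | u \<in> UNIV \<and> u ^ 3 - 3 * u * v = U. \<chi> (1 + u ^ 3 + v ^ 3 - 3 * u * v))"
        by (rule sum.group[symmetric]) auto
      also have "\<dots> = (\<Sum>U\<in>UNIV. of_nat (card {u. u ^ 3 - 3 * u * v = U}) * \<chi> (1 + v ^ 3 + U))"
      proof (intro sum.cong refl)
        fix U
        have "(\<Sum>u | u \<in> UNIV \<and> u ^ 3 - 3 * u * v = U. \<chi> (1 + u ^ 3 + v ^ 3 - 3 * u * v)) =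
          (\<Sum>u | u \<in> UNIV \<and> u ^ 3 - 3 * u * v = U. \<chi> (1 + v ^ 3 + U))"
          by (intro sum.cong refl arg_cong[where f=\<chi>]) auto
        then show "(\<Sum>u | u \<in> UNIV \<and> u ^ 3 - 3 * u * v = U. \<chi> (1 + u ^ 3 + v ^ 3 - 3 * u * v)) =
          of_nat (card {u. u ^ 3 - 3 * u * v = U}) * \<chi> (1 + v ^ 3 + U)" by simp
      qed
      \<comment> \<open>The constant 1 of the root count meets a full sum of the nontrivial \<chi>
        and disappears; only the \<rho> part survives.\<close>
      also have "\<dots> = (\<Sum>U\<in>UNIV. \<chi> (U + (1 + v ^ 3))) +
          (\<Sum>U\<in>UNIV. \<Sum>A | A \<in> UNIV - {0} \<and> A + v ^ 3 / A = U. \<rho> A ^ 2 * \<chi> (1 + v ^ 3 + (A + v ^ 3 / A)))"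
        by (simp add: card_cubic_roots[OF False] distrib_right sum.distrib sum_distrib_right add_ac)
      also have "(\<Sum>U\<in>UNIV. \<chi> (U + (1 + v ^ 3))) = 0"
        unfolding sum_translate using chi by (simp add: sum_mult_char)
      also have "(\<Sum>U\<in>UNIV. \<Sum>A | A \<in> UNIV - {0} \<and> A + v ^ 3 / A = U. \<rho> A ^ 2 * \<chi> (1 + v ^ 3 + (A + v ^ 3 / A))) =
         (\<Sum>A\<in>UNIV-{0}. \<rho> A ^ 2 * \<chi> (1 + v ^ 3 + (A + v ^ 3 / A)))"
        by (rule sum.group) auto
      also have "\<dots> = (\<Sum>A\<in>UNIV. \<rho> A * cnj (\<rho> (v ^ 3 / A)) * (\<chi> (1 + A) * \<chi> (1 + v ^ 3 / A)))"
      proof (intro sum.mono_neutral_cong_left)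
        fix A :: 'a assume "A \<in> UNIV - {0}"
        then have "A \<noteq> 0" by simp
        then have "1 + v ^ 3 + (A + v ^ 3 / A) = (1 + A) * (1 + v ^ 3 / A)"
          by (simp add: field_simps)
        moreover have "cnj (\<rho> (v ^ 3 / A)) = \<rho> A"
          using rho(1) \<open>A \<noteq> 0\<close> rho_of_cube[OF False]
          by (simp add: cnj_mult_char divide_inverse mult_char_mult mult_char_inverse)
        ultimately show "\<rho> A ^ 2 * \<chi> (1 + v ^ 3 + (A + v ^ 3 / A)) =
            \<rho> A * cnj (\<rho> (v ^ 3 / A)) * (\<chi> (1 + A) * \<chi> (1 + v ^ 3 / A))"
          by (simp add: mult power2_eq_square)
      qed (use rho in auto)
      finally show ?thesis using False by (simp add: triv_char_def)
    qed (simp add: triv_char_def)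
  qed
  \<comment> \<open>The inner sum depends on v only through V = v^3, so the sum over nonzero v
    becomes a sum over V twisted by the characters \<phi> of exponent 3. Writing V = AB then
    decouples A from B.\<close>
  also have "\<dots> = (\<Sum>u\<in>UNIV. \<chi> (1 + u ^ 3)) +
     (\<Sum>\<phi> | mult_char \<phi> \<and> char_pow \<phi> 3 = triv_char. K (char_mult \<rho> \<phi>) * K (char_mult (char_cnj \<rho>) \<phi>))"
  proof -
    have "(\<Sum>V\<in>UNIV. (\<Sum>A\<in>UNIV. \<rho> A * cnj (\<rho> (V / A)) * (\<chi> (1 + A) * \<chi> (1 + V / A))) * \<phi> V) =
      K (char_mult \<rho> \<phi>) * K (char_mult (char_cnj \<rho>) \<phi>)" if phi: "mult_char \<phi>" for \<phi>
    proof -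
      have "(\<Sum>V\<in>UNIV. (\<Sum>A\<in>UNIV. \<rho> A * cnj (\<rho> (V / A)) * (\<chi> (1 + A) * \<chi> (1 + V / A))) * \<phi> V) =
         (\<Sum>A\<in>UNIV. \<Sum>V\<in>UNIV. \<rho> A * cnj (\<rho> (V / A)) * (\<chi> (1 + A) * \<chi> (1 + V / A)) * \<phi> V)"
        by (subst sum.swap) (simp add: sum_distrib_right)
      also have "\<dots> = (\<Sum>A\<in>UNIV. \<chi> (1 + A) * char_mult \<rho> \<phi> A * K (char_mult (char_cnj \<rho>) \<phi>))"
      proof (intro sum.cong refl)
        fix A :: 'a
        show "(\<Sum>V\<in>UNIV. \<rho> A * cnj (\<rho> (V / A)) * (\<chi> (1 + A) * \<chi> (1 + V / A)) * \<phi> V) =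
           \<chi> (1 + A) * char_mult \<rho> \<phi> A * K (char_mult (char_cnj \<rho>) \<phi>)"
        proof (cases "A = 0")
          case False
          then show ?thesis
            using sum_scale[OF False, of "\<lambda>V. \<rho> A * cnj (\<rho> (V / A)) * (\<chi> (1 + A) * \<chi> (1 + V / A)) * \<phi> V"]
            by (simp add: K_def sum_distrib_left char_mult_def char_cnj_def mult_char_mult[OF phi] mult_ac)
        qed (use rho in \<open>simp add: char_mult_def\<close>)
      qed
      finally show ?thesis by (simp add: K_def[of "char_mult \<rho> \<phi>"] sum_distrib_right)
    qed
    then show ?thesis
      unfolding sum.distrib
        sum_power_eq_sum_chars[of "\<lambda>V. \<Sum>A\<in>UNIV. \<rho> A * cnj (\<rho> (V / A)) * (\<chi> (1 + A) * \<chi> (1 + V / A))"]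
      by simp
  qed
  \<comment> \<open>This contribution of v = 0 cancels the two cross terms that contain
    \<open>K triv_char = -1\<close>, and only \<phi> trivial remains.\<close>
  also have "(\<Sum>u\<in>UNIV. \<chi> (1 + u ^ 3)) = K \<rho> + K (char_cnj \<rho>)"
    using sum_via_power[of 3 "\<lambda>x. \<chi> (1 + x)"] chi(1) K_triv by (simp add: sum_order3 flip: K_def)
  also have "(\<Sum>\<phi> | mult_char \<phi> \<and> char_pow \<phi> 3 = triv_char. K (char_mult \<rho> \<phi>) * K (char_mult (char_cnj \<rho>) \<phi>)) =
      K \<rho> * K (char_cnj \<rho>) - K (char_cnj \<rho>) - K \<rho>"
  proof -
    have "char_mult \<rho> \<rho> = char_cnj \<rho>"
      by (simp add: char_mult_def char_cnj_def flip: rho_square power2_eq_square)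
    moreover from this have "char_mult (char_cnj \<rho>) (char_cnj \<rho>) = \<rho>"
      by (metis char_cnj_cnj char_cnj_mult)
    ultimately show ?thesis using rho(1) by (simp add: sum_order3 K_triv)
  qed
  finally show ?thesis by (simp add: K_rho)
qed

end

section \<open>Product relations for Gauss sums\<close>

context additive_character
begin

text \<open>Away from \<chi> = 1 and \<chi> = \<rho> all relevant products are nontrivial, so Jacobi
  sums are quotients of Gauss sums. The two exceptional characters are checked directly.\<close>

lemma gauss_duplication:
  assumes chi: "mult_char \<chi>" and rho: "mult_char \<rho>" "\<rho> \<noteq> triv_char"
    and order2: "{\<phi>. mult_char \<phi> \<and> char_pow \<phi> 2 = triv_char} = {triv_char, \<rho>}"
    and two: "(2::'a) \<noteq> 0"
  shows "\<chi> 4 * gauss \<chi> * gauss (char_mult \<chi> \<rho>) = gauss \<rho> * gauss (char_mult \<chi> \<chi>)"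
proof -
  have "mult_char \<rho> \<and> char_pow \<rho> 2 = triv_char" using order2 by blast
  then have rho2: "char_mult \<rho> \<rho> = triv_char"
    by (auto simp: char_mult_def char_pow_def fun_eq_iff triv_char_def power2_eq_square split: if_splits)
  have four: "(4::'a) = 2 ^ 2" by simp
  consider "\<chi> = triv_char" | "\<chi> = \<rho>" | "\<chi> \<noteq> triv_char" "\<chi> \<noteq> \<rho>" by blast
  then show ?thesis
  proof cases
    case 1
    moreover have "(4::'a) \<noteq> 0" using two four by (metis power_not_zero)
    ultimately show ?thesis using rho by (simp add: triv_char_def)
  next
    case 2
    have "\<rho> 4 = \<rho> 2 ^ 2"
      unfolding four by (rule mult_char_power[OF rho(1)])
    then have "\<rho> 4 = char_mult \<rho> \<rho> 2"
      by (simp add: char_mult_def power2_eq_square)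
    then show ?thesis using two 2 by (simp add: rho2 triv_char_def)
  next
    case 3
    have "char_mult \<chi> \<chi> \<noteq> triv_char"
    proof
      assume "char_mult \<chi> \<chi> = triv_char"
      then have "char_pow \<chi> 2 = triv_char"
        using chi by (auto simp: char_mult_def char_pow_def fun_eq_iff triv_char_def power2_eq_square)
      then show False using 3 chi order2 by blast
    qed
    moreover have "char_mult \<chi> \<rho> \<noteq> triv_char"
    proof
      assume "char_mult \<chi> \<rho> = triv_char"
      then have "char_mult (char_mult \<chi> \<rho>) \<rho> = \<rho>" using rho by simp
      then show False using 3 chi by (simp add: char_mult_assoc rho2)
    qed
    ultimately have "gauss \<chi> * gauss \<chi> = gauss (char_mult \<chi> \<chi>) * jacobi [\<chi>, \<chi>]"
        "gauss \<chi> * gauss \<rho> = gauss (char_mult \<chi> \<rho>) * jacobi [\<chi>, \<rho>]"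
      using gauss_prod_eq_jacobi[of "[\<chi>, \<chi>]"] gauss_prod_eq_jacobi[of "[\<chi>, \<rho>]"] chi rho by simp_all
    moreover have "\<chi> 4 * jacobi [\<chi>, \<chi>] = jacobi [\<chi>, \<rho>]"
      using jacobi_duplication[OF chi _ rho(2) order2 two] 3 by simp
    ultimately have "gauss \<chi> * (gauss \<rho> * gauss (char_mult \<chi> \<chi>)) =
        gauss \<chi> * (\<chi> 4 * gauss \<chi> * gauss (char_mult \<chi> \<rho>))" by Groebner_Basis.algebra
    then show ?thesis using chi by simp
  qed
qed

text \<open>Same passage from Jacobi to Gauss sums; the factor q is g(\<rho>) times g of its
  conjugate, as \<rho>(-1) = 1.\<close>

lemma gauss_triplication:
  assumes chi: "mult_char \<chi>" and zeta: "\<zeta>\<^sup>2 + \<zeta> + (1::'a) = 0"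
    and two: "(2::'a) \<noteq> 0" and three: "(3::'a) \<noteq> 0"
    and rho: "mult_char \<rho>" "\<rho> \<noteq> triv_char" "\<rho> \<noteq> char_cnj \<rho>"
    and order3: "{\<phi>. mult_char \<phi> \<and> char_pow \<phi> 3 = triv_char} = {triv_char, \<rho>, char_cnj \<rho>}"
  shows "\<chi> 27 * gauss \<chi> * gauss (char_mult \<chi> \<rho>) * gauss (char_mult \<chi> (char_cnj \<rho>)) =
    of_nat CARD('a) * gauss (char_mult \<chi> (char_mult \<chi> \<chi>))"
proof -
  have rho3: "char_pow \<rho> 3 = triv_char" using order3 by blast
  note ctx = zeta two three rho(1,2) rho3
  have rho_rho: "char_mult \<rho> \<rho> = char_cnj \<rho>"
    using rho_square[OF ctx] by (simp add: char_mult_def char_cnj_def power2_eq_square)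
  then have rho_rho': "char_mult (char_cnj \<rho>) (char_cnj \<rho>) = \<rho>"
    by (metis char_cnj_cnj char_cnj_mult)
  have rr: "gauss \<rho> * gauss (char_cnj \<rho>) = of_nat CARD('a)"
    using gauss_cnj[OF rho(1,2)] rho_minus_1[OF ctx] by simp
  have "(27::'a) = 3 ^ 3" by simp
  then have rho27: "\<rho> 27 = 1" using rho_of_cube[OF ctx three] by simp
  consider "\<chi> = triv_char" | "\<chi> = \<rho>" | "\<chi> = char_cnj \<rho>"
    | "\<chi> \<notin> {triv_char, \<rho>, char_cnj \<rho>}" by blast
  then show ?thesis
  proof cases
    case 1
    have "(27::'a) \<noteq> 0" using three \<open>(27::'a) = 3 ^ 3\<close> by (metis power_not_zero)
    then show ?thesis using 1 rr rho by (simp add: triv_char_def)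
  next
    case 2
    then show ?thesis using rho27 rr rho by (simp add: rho_rho mult_ac)
  next
    case 3
    then show ?thesis using rho27 rr rho by (simp add: rho_rho' mult_ac char_cnj_def[of \<rho>, THEN fun_cong])
  next
    case 4
    then have "char_pow \<chi> 3 \<noteq> triv_char" using order3 chi by blast
    then have "char_mult \<chi> (char_mult \<chi> \<chi>) \<noteq> triv_char"
      using chi by (auto simp: char_mult_def char_pow_def fun_eq_iff triv_char_def power3_eq_cube mult.assoc split: if_splits)
    moreover have "char_mult \<chi> \<rho> \<noteq> triv_char" "char_mult \<chi> (char_cnj \<rho>) \<noteq> triv_char"
      unfolding char_mult_commute[of \<chi>] using 4 chi rho by (simp_all add: char_mult_eq_triv_iff)
    ultimately have "gauss \<chi> * (gauss \<chi> * gauss \<chi>) = gauss (char_mult \<chi> (char_mult \<chi> \<chi>)) * jacobi [\<chi>, \<chi>, \<chi>]"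
        "gauss \<chi> * gauss \<rho> = gauss (char_mult \<chi> \<rho>) * jacobi [\<chi>, \<rho>]"
        "gauss \<chi> * gauss (char_cnj \<rho>) = gauss (char_mult \<chi> (char_cnj \<rho>)) * jacobi [\<chi>, char_cnj \<rho>]"
      using gauss_prod_eq_jacobi[of "[\<chi>, \<chi>, \<chi>]"] gauss_prod_eq_jacobi[of "[\<chi>, \<rho>]"]
        gauss_prod_eq_jacobi[of "[\<chi>, char_cnj \<rho>]"] chi rho by simp_all
    moreover have "\<chi> 27 * jacobi [\<chi>, \<chi>, \<chi>] = jacobi [\<chi>, \<rho>] * jacobi [\<chi>, char_cnj \<rho>]"
      using jacobi_triplication[OF ctx order3 rho(3) chi] 4 by simp
    ultimately have "gauss \<chi> * gauss \<chi> * (of_nat CARD('a) * gauss (char_mult \<chi> (char_mult \<chi> \<chi>))) =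
        gauss \<chi> * gauss \<chi> * (\<chi> 27 * gauss \<chi> * gauss (char_mult \<chi> \<rho>) * gauss (char_mult \<chi> (char_cnj \<rho>)))"
      using rr by Groebner_Basis.algebra
    then show ?thesis using chi by simp
  qed
qed

end

subsection \<open>The constant term of a sixth power modulo \<open>z\<^sup>6 = 1\<close>\<close>

text \<open>Multiplicities \<open>m\<close> with \<open>\<Sum>\<^sub>j m\<^sub>j = 6\<close> and \<open>\<Sum>\<^sub>j j m\<^sub>j \<equiv> 0\<close> modulo 6, one per orbit under cyclic shifts,
  with weight \<open>6! / \<Prod>\<^sub>j m\<^sub>j!\<close> times the size of the orbit divided by 6. The representatives are
  chosen to match the parameters of the hypergeometric functions in the theorem.\<close>
definition dwork_orbits :: "(nat \<times> nat list) list" where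
  "dwork_orbits =
    [(1, [6,0,0,0,0,0]), (30, [4,1,0,0,0,1]), (30, [4,0,1,0,1,0]), (15, [4,0,0,2,0,0]),
     (20, [3,0,0,0,3,0]), (60, [3,2,0,0,1,0]), (60, [3,0,1,0,0,2]), (90, [2,0,0,0,2,2]),
     (30, [2,0,2,0,2,0]), (120, [3,1,1,1,0,0]), (120, [3,0,0,1,1,1]), (180, [2,1,0,2,0,1]),
     (180, [2,0,2,1,0,1]), (360, [2,1,1,0,1,1])]"

definition orbit_monomial :: "(nat \<Rightarrow> complex) \<Rightarrow> nat list \<Rightarrow> complex" where
  "orbit_monomial G m = (\<Prod>j<6. G j ^ (m ! j))"

text \<open>Multiplication in the group ring of the cyclic group of order 6; the summand 6 keeps the
  subtraction on naturals from truncating.\<close>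

definition cyclic_conv :: "(nat \<Rightarrow> complex) \<Rightarrow> (nat \<Rightarrow> complex) \<Rightarrow> nat \<Rightarrow> complex" where
  "cyclic_conv A B s = (\<Sum>i<6. A i * B ((s + 6 - i) mod 6))"

lemma lessThan_6: "{..<6::nat} = {0, 1, 2, 3, 4, 5}"
  by auto

lemma cyclic_conv:
  assumes z: "z ^ 6 = (1::complex)"
  shows "(\<Sum>i<6. A i * z ^ i) * (\<Sum>j<6. B j * z ^ j) = (\<Sum>s<6. cyclic_conv A B s * z ^ s)"
proof -
  have zmod: "z ^ k = z ^ (k mod 6)" for k
  proof -
    have "z ^ k = (z ^ 6) ^ (k div 6) * z ^ (k mod 6)" by (simp flip: power_mult power_add)
    then show ?thesis by (simp add: z)
  qed
  have "(\<Sum>s<6. cyclic_conv A B s * z ^ s) = (\<Sum>i<6. \<Sum>s<6. A i * B ((s + 6 - i) mod 6) * z ^ s)"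
    unfolding cyclic_conv_def sum_distrib_right by (rule sum.swap)
  also have "\<dots> = (\<Sum>i<6. \<Sum>j<6. A i * B j * z ^ (i + j))"
  proof (rule sum.cong[OF refl])
    fix i :: nat assume "i \<in> {..<6}"
    then have i: "i < 6" by simp
    have "(i + (s + 6 - i) mod 6) mod 6 = s" if "s < 6" for s
    proof -
      have "i + (s + 6 - i) = s + 6" using i by simp
      then show ?thesis using that by (simp add: mod_add_right_eq)
    qed
    moreover have "((i + s) mod 6 + 6 - i) mod 6 = s" if "s < 6" for s
    proof (cases "i + s < 6")
      case False
      then have "(i + s) mod 6 = i + s - 6" using that i by (simp add: mod_if)
      then show ?thesis using False that i by simp
    qed (use that in simp)
    ultimately have "(i + (s + 6 - i) mod 6) mod 6 = s" "((i + s) mod 6 + 6 - i) mod 6 = s" if "s < 6" for s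
      using that by blast+
    then show "(\<Sum>s<6. A i * B ((s + 6 - i) mod 6) * z ^ s) = (\<Sum>j<6. A i * B j * z ^ (i + j))"
      by (intro sum.reindex_bij_witness[of _ "\<lambda>j. (i + j) mod 6" "\<lambda>s. (s + 6 - i) mod 6"])
        (auto simp: zmod[of "i + j" for j])
  qed
  finally show ?thesis
    by (simp add: sum_product power_add mult_ac)
qed

text \<open>All six shifts are taken even when the orbit is shorter; the orbit-size factor in the
  weights compensates for the repetition.\<close>

definition orbit_polynomial :: "(nat \<Rightarrow> complex) \<Rightarrow> complex" where
  "orbit_polynomial G =
    (\<Sum>(w, m)\<leftarrow>dwork_orbits. of_nat w * (\<Sum>i<6. orbit_monomial (\<lambda>j. G ((i + j) mod 6)) m))"

text \<open>A polynomial identity in six variables, checked by expansion. Squaring a cube keeps the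
  intermediate expressions small.\<close>

lemma orbit_polynomial_eq_cyclic_conv:
  defines "sq \<equiv> \<lambda>G. cyclic_conv G G"
  defines "cube \<equiv> \<lambda>G. cyclic_conv (sq G) G"
  shows "sq (cube G) 0 = orbit_polynomial G"
  unfolding sq_def cube_def cyclic_conv_def orbit_polynomial_def dwork_orbits_def orbit_monomial_def lessThan_6
  by (simp del: power_Suc) (simp add: algebra_simps eval_nat_numeral)

text \<open>Only the existence of coefficients independent of \<open>z\<close> matters: those with
  nonzero index are later removed by orthogonality.\<close>

lemma sixth_power_expansion:
  "\<exists>P. P 0 = orbit_polynomial G \<and>
     (\<forall>z. z ^ 6 = 1 \<longrightarrow> (\<Sum>j<6. G j * z ^ j) ^ 6 = (\<Sum>s<6. P s * z ^ s))"
proof (intro exI conjI allI impI)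
  let ?C = "cyclic_conv (cyclic_conv G G) G"
  show "cyclic_conv ?C ?C 0 = orbit_polynomial G"
    by (rule orbit_polynomial_eq_cyclic_conv)
  fix z :: complex assume z: "z ^ 6 = 1"
  have "(\<Sum>j<6. G j * z ^ j) ^ 6 = (\<Sum>j<6. G j * z ^ j) ^ 3 * (\<Sum>j<6. G j * z ^ j) ^ 3"
    by (simp flip: power_add)
  also have "(\<Sum>j<6. G j * z ^ j) ^ 3 = (\<Sum>s<6. ?C s * z ^ s)"
    by (simp only: power3_eq_cube cyclic_conv[OF z])
  finally show "(\<Sum>j<6. G j * z ^ j) ^ 6 = (\<Sum>s<6. cyclic_conv ?C ?C s * z ^ s)"
    by (simp only: cyclic_conv[OF z])
qed

subsection \<open>Characters of order dividing six\<close>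

lemma char_pow_0 [simp]: "char_pow A 0 = triv_char"
  by (simp add: char_pow_def triv_char_def fun_eq_iff)

lemma char_pow_char_pow: "char_pow (char_pow A a) b = char_pow A (a * b)"
  by (simp add: char_pow_def fun_eq_iff power_mult)

lemma char_mult_char_pow: "char_mult (char_pow A a) (char_pow A b) = char_pow A (a + b)"
  by (simp add: char_mult_def char_pow_def fun_eq_iff power_add)

lemma char_pow_eq_power: "mult_char A \<Longrightarrow> k > 0 \<Longrightarrow> char_pow A k x = A x ^ k"
  by (simp add: char_pow_def zero_power)

text \<open>Translation by 1 permutes the field, so the q ones it adds sum to 0.\<close>

lemma of_nat_CARD_eq_0: "of_nat CARD('a::{finite,field}) = (0 :: 'a)"
proof -
  have "(\<Sum>x\<in>UNIV. x + 1) = (\<Sum>x\<in>UNIV. x :: 'a)"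
    by (rule sum_translate)
  then show ?thesis by (simp add: sum.distrib)
qed

context
  fixes \<omega> :: "'a::{finite,field} \<Rightarrow> complex"
  assumes generator: "char_generator \<omega>"
begin

lemma mult_char_generator [simp]: "mult_char \<omega>"
  using generator by (simp add: char_generator_def)

lemma char_pow_generator_mod: "char_pow \<omega> k = char_pow \<omega> (k mod (CARD('a) - 1))"
proof
  fix x
  show "char_pow \<omega> k x = char_pow \<omega> (k mod (CARD('a) - 1)) x"
  proof (cases "x = 0")
    case False
    have "\<omega> x ^ k = (\<omega> x ^ (CARD('a) - 1)) ^ (k div (CARD('a) - 1)) * \<omega> x ^ (k mod (CARD('a) - 1))"
      by (simp only: power_mult[symmetric] power_add[symmetric] mult_div_mod_eq)
    then show ?thesis
      using False mult_char_power_card[OF mult_char_generator False] by (simp add: char_pow_def)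
  qed (simp add: char_pow_def)
qed

lemma mult_chars_eq_powers: "{\<chi>. mult_char \<chi>} = char_pow \<omega> ` {..<CARD('a) - 1}"
proof
  show "{\<chi>. mult_char \<chi>} \<subseteq> char_pow \<omega> ` {..<CARD('a) - 1}"
  proof
    fix \<chi> assume "\<chi> \<in> {\<chi> :: 'a \<Rightarrow> complex. mult_char \<chi>}"
    then obtain k where "\<chi> = char_pow \<omega> k"
      using generator by (auto simp: char_generator_def)
    then have "\<chi> = char_pow \<omega> (k mod (CARD('a) - 1))" using char_pow_generator_mod by simp
    then show "\<chi> \<in> char_pow \<omega> ` {..<CARD('a) - 1}"
      using card_field_gt_1[where 'a='a] by simp
  qed
qed auto

lemma char_pow_generator_eq_iff:
  "char_pow \<omega> i = char_pow \<omega> j \<longleftrightarrow> i mod (CARD('a) - 1) = j mod (CARD('a) - 1)"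
proof
  have "inj_on (char_pow \<omega>) {..<CARD('a) - 1}"
    using card_mult_chars[where 'a='a] unfolding mult_chars_eq_powers
    by (intro eq_card_imp_inj_on) simp_all
  moreover assume "char_pow \<omega> i = char_pow \<omega> j"
  then have "char_pow \<omega> (i mod (CARD('a) - 1)) = char_pow \<omega> (j mod (CARD('a) - 1))"
    using char_pow_generator_mod[of i] char_pow_generator_mod[of j] by simp
  ultimately show "i mod (CARD('a) - 1) = j mod (CARD('a) - 1)"
    using card_field_gt_1[where 'a='a] by (simp add: inj_on_def)
next
  assume "i mod (CARD('a) - 1) = j mod (CARD('a) - 1)"
  then show "char_pow \<omega> i = char_pow \<omega> j"
    using char_pow_generator_mod[of i] char_pow_generator_mod[of j] by simp
qed

lemma chars_of_exponent:
  assumes n: "CARD('a) - 1 = d * e"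
  shows "{\<chi>. mult_char \<chi> \<and> char_pow \<chi> d = triv_char} = (\<lambda>j. char_pow \<omega> (j * e)) ` {..<d}"
proof -
  have de: "d > 0" "e > 0" using n card_field_gt_1[where 'a='a] by (auto intro: Nat.gr0I)
  have iff: "char_pow (char_pow \<omega> k) d = triv_char \<longleftrightarrow> e dvd k" for k
  proof -
    have "char_pow (char_pow \<omega> k) d = triv_char \<longleftrightarrow> d * e dvd d * k"
      using char_pow_generator_eq_iff[of "d * k" 0] unfolding n
      by (simp add: char_pow_char_pow mult.commute dvd_eq_mod_eq_0)
    then show ?thesis using de by simp
  qed
  show ?thesis
  proof (intro equalityI subsetI)
    fix \<chi> assume chi: "\<chi> \<in> {\<chi> :: 'a \<Rightarrow> complex. mult_char \<chi> \<and> char_pow \<chi> d = triv_char}"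
    then obtain k where k: "\<chi> = char_pow \<omega> k" "k < d * e"
      using mult_chars_eq_powers n by auto
    then obtain j where "k = e * j" using chi iff by auto
    then show "\<chi> \<in> (\<lambda>j. char_pow \<omega> (j * e)) ` {..<d}"
      using k de by (auto simp: mult.commute)
  qed (auto simp: iff)
qed

end

section \<open>Powers of \<omega>6 and the product relation for six\<close>

locale sextic_characters = additive_character \<psi> for \<psi> :: "'a::{finite,field} \<Rightarrow> complex" +
  fixes \<omega> :: "'a \<Rightarrow> complex"
  assumes generator: "char_generator \<omega>"
    and card_mod_6: "CARD('a) mod 6 = 1"
begin

text \<open>The powers of \<omega>6, with exponents significant modulo 6: \<omega>6, \<omega>3,
  \<omega>2 and the conjugates of \<omega>3 and \<omega>6 are \<open>W 1\<close> to
  \<open>W 5\<close>.\<close>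

definition W :: "nat \<Rightarrow> 'a \<Rightarrow> complex" where
  "W j = char_pow \<omega> (j * ((CARD('a) - 1) div 6))"

lemma card_minus_1: "CARD('a) - 1 = 6 * ((CARD('a) - 1) div 6)"
  using card_mod_6 by presburger

lemma mult_char_W [simp]: "mult_char (W j)"
  using generator by (simp add: W_def)

lemma W_0 [simp]: "W 0 = triv_char"
  by (simp add: W_def)

lemma W_eq_iff: "W i = W j \<longleftrightarrow> i mod 6 = j mod 6"
proof -
  let ?t = "(CARD('a) - 1) div 6"
  have "?t > 0" using card_minus_1 card_field_gt_1[where 'a='a] by (auto intro: Nat.gr0I)
  have "W i = W j \<longleftrightarrow> (i * ?t) mod (6 * ?t) = (j * ?t) mod (6 * ?t)"
    unfolding W_def char_pow_generator_eq_iff[OF generator] using card_minus_1 by simp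
  then show ?thesis using \<open>?t > 0\<close> by simp
qed

lemma W_mod [simp]: "W (j mod 6) = W j"
  by (simp add: W_eq_iff)

lemma W_mult: "char_mult (W i) (W j) = W ((i + j) mod 6)"
  unfolding W_mod by (simp add: W_def char_mult_char_pow distrib_right)

lemma W_mult_assoc: "char_mult (char_mult \<chi> (W i)) (W j) = char_mult \<chi> (W ((i + j) mod 6))"
  by (simp only: char_mult_assoc W_mult)

lemma W_eq_triv_iff: "W j = triv_char \<longleftrightarrow> j mod 6 = 0"
  using W_eq_iff[of j 0] by simp

lemma cnj_W: "char_cnj (W j) = W ((5 * j) mod 6)"
proof -
  have "char_mult (W j) (W ((5 * j) mod 6)) = triv_char"
    unfolding W_mult W_eq_triv_iff by presburger
  then show ?thesis by (simp only: char_mult_eq_triv_iff mult_char_W)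
qed

lemma W_power: "char_pow (W i) j = W (i * j)"
  by (simp add: W_def char_pow_char_pow mult_ac)

lemma W_apply: "x \<noteq> 0 \<Longrightarrow> W j x = W 1 x ^ j"
  by (simp add: W_def char_pow_def mult.commute flip: power_mult)

lemma chars_of_exponent_6: "{\<chi>. mult_char \<chi> \<and> char_pow \<chi> 6 = triv_char} = W ` {..<6}"
  unfolding W_def by (rule chars_of_exponent[OF generator card_minus_1])

lemma chars_of_exponent_2: "{\<chi>. mult_char \<chi> \<and> char_pow \<chi> 2 = triv_char} = {triv_char, W 3}"
proof -
  have "CARD('a) - 1 = 2 * (3 * ((CARD('a) - 1) div 6))" using card_minus_1 by simp
  note chars_of_exponent[OF generator this]
  moreover have "{..<2::nat} = {0, 1}" by auto
  ultimately show ?thesis by (simp add: W_def mult_ac)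
qed

lemma chars_of_exponent_3:
  "{\<chi>. mult_char \<chi> \<and> char_pow \<chi> 3 = triv_char} = {triv_char, W 2, char_cnj (W 2)}"
proof -
  have "CARD('a) - 1 = 3 * (2 * ((CARD('a) - 1) div 6))" using card_minus_1 by simp
  note chars_of_exponent[OF generator this]
  moreover have "{..<3::nat} = {0, 1, 2}" by auto
  moreover have "char_cnj (W 2) = W 4" by (simp add: cnj_W)
  ultimately show ?thesis by (simp add: W_def mult_ac)
qed

text \<open>Since q = 6k + 1 is 0 in the field, 6 is invertible there.\<close>

lemma two_nonzero: "(2::'a) \<noteq> 0" and three_nonzero: "(3::'a) \<noteq> 0"
proof -
  have "of_nat CARD('a) = (of_nat (6 * (CARD('a) div 6) + 1) :: 'a)"
    using card_mod_6 by (metis mult_div_mod_eq)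
  then have *: "6 * of_nat (CARD('a) div 6) + 1 = (0::'a)"
    by (simp only: of_nat_CARD_eq_0 of_nat_add of_nat_mult of_nat_numeral of_nat_1)
  have six: "(6::'a) = 2 * 3" by simp
  have "(6::'a) \<noteq> 0" using * by auto
  then show "(2::'a) \<noteq> 0" "(3::'a) \<noteq> 0"
    using six by (metis mult_zero_left, metis mult_zero_right)
qed

text \<open>If cubing were injective, every element would be a cube and \<open>W 2\<close>, whose
  cube is trivial, would be trivial itself.\<close>

lemma cube_root_of_unity: obtains \<zeta> :: 'a where "\<zeta>\<^sup>2 + \<zeta> + 1 = 0"
proof -
  have "\<not> inj (\<lambda>x::'a. x ^ 3)"
  proof
    assume "inj (\<lambda>x::'a. x ^ 3)"
    then have surj: "surj (\<lambda>x::'a. x ^ 3)" by (simp add: finite_UNIV_inj_surj)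
    have "W 2 x = triv_char x" for x
    proof (cases "x = 0")
      case False
      obtain y where "x = y ^ 3" using surj by (metis surjE)
      then have "W 2 x = char_pow (W 2) 3 y" "y \<noteq> 0"
        using False by (auto simp: mult_char_power char_pow_def)
      then show ?thesis using False W_eq_triv_iff[of 6] by (simp add: W_power triv_char_def)
    qed (simp add: triv_char_def)
    then have "W 2 = triv_char" by blast
    then show False by (simp add: W_eq_triv_iff)
  qed
  then obtain x y :: 'a where xy: "x ^ 3 = y ^ 3" "x \<noteq> y" by (auto simp: inj_def)
  then have "y \<noteq> 0" by auto
  define z where "z = x / y"
  have "z ^ 3 = 1" "z \<noteq> 1" using xy \<open>y \<noteq> 0\<close> by (auto simp: z_def power_divide)
  moreover have "(z - 1) * (z\<^sup>2 + z + 1) = z ^ 3 - 1"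
    by (simp add: algebra_simps power2_eq_square power3_eq_cube)
  ultimately have "z\<^sup>2 + z + 1 = 0" by simp
  then show thesis using that by blast
qed

text \<open>The constant of the product relation for six. It is also minus the product of the Gauss
  sums of all \<open>W j\<close> with j < 6, as the relation at the trivial character shows.\<close>

definition dwork_const :: complex where
  "dwork_const = of_nat CARD('a) ^ 2 * W 3 (-1) * gauss (W 3)"

lemma gauss_W3_square: "gauss (W 3) * gauss (W 3) = W 3 (-1) * of_nat CARD('a)"
  using gauss_cnj[of "W 3"] by (simp add: W_eq_triv_iff cnj_W)

lemma prod_lessThan_6: "(\<Prod>j<6::nat. f j) = f 0 * f 1 * f 2 * f 3 * f 4 * (f 5 :: complex)"
  by (simp add: lessThan_6 mult_ac)

text \<open>Three duplications, for the pairs (0,3), (2,5), (4,1), produce the twists of \<chi>^2 by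
  the characters of exponent 3, to which triplication applies. The arguments combine by 4^3 * 27^2 =
  6^6.\<close>

lemma gauss_six:
  assumes chi: "mult_char \<chi>"
  shows "\<chi> (6 ^ 6) * (\<Prod>j<6. gauss (char_mult \<chi> (W j))) = dwork_const * gauss (char_pow \<chi> 6)"
proof -
  define G where "G j = gauss (char_mult \<chi> (W j))" for j
  define H where "H j = gauss (char_mult (char_mult \<chi> \<chi>) (W j))" for j
  have dup: "\<chi> 4 * W (2 * r) 4 * G (2 * r) * G ((2 * r + 3) mod 6) = gauss (W 3) * H ((4 * r) mod 6)" for r
  proof -
    have "char_mult (char_mult \<chi> (W (2 * r))) (char_mult \<chi> (W (2 * r))) =
        char_mult (char_mult \<chi> \<chi>) (char_mult (W (2 * r)) (W (2 * r)))"
      by (simp only: char_mult_assoc char_mult_left_commute)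
    also have "\<dots> = char_mult (char_mult \<chi> \<chi>) (W ((4 * r) mod 6))"
      unfolding W_mult by (simp add: mult_2[symmetric])
    finally have sq: "char_mult (char_mult \<chi> (W (2 * r))) (char_mult \<chi> (W (2 * r))) =
        char_mult (char_mult \<chi> \<chi>) (W ((4 * r) mod 6))" .
    have "char_mult \<chi> (W (2 * r)) 4 = \<chi> 4 * W (2 * r) 4" by (simp add: char_mult_def)
    then show ?thesis
      using gauss_duplication[of "char_mult \<chi> (W (2 * r))" "W 3"] chi two_nonzero chars_of_exponent_2
      by (simp only: sq W_mult_assoc G_def H_def) (simp add: W_eq_triv_iff)
  qed
  obtain \<zeta> :: 'a where zeta: "\<zeta>\<^sup>2 + \<zeta> + 1 = 0" by (rule cube_root_of_unity)
  have "char_mult (char_mult \<chi> \<chi>) (char_mult (char_mult \<chi> \<chi>) (char_mult \<chi> \<chi>)) = char_pow \<chi> 6"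
    using chi by (auto simp: char_mult_def char_pow_def fun_eq_iff eval_nat_numeral)
  then have trip: "\<chi> 27 ^ 2 * H 0 * H 2 * H 4 = of_nat CARD('a) * gauss (char_pow \<chi> 6)"
    using gauss_triplication[of "char_mult \<chi> \<chi>" \<zeta> "W 2"] chi two_nonzero three_nonzero zeta chars_of_exponent_3
    by (simp add: cnj_W W_eq_triv_iff W_eq_iff H_def char_mult_def[of \<chi> \<chi>, THEN fun_cong] power2_eq_square)
  have four: "(4::'a) = 2 ^ 2" by simp
  have "(4::'a) \<noteq> 0" using two_nonzero four by (metis power_not_zero)
  then have "W 2 4 * W 4 4 = 1"
    using W_mult[of 2 4] by (simp add: char_mult_def fun_eq_iff triv_char_def)
  moreover have "\<chi> (6 ^ 6) = \<chi> 4 ^ 3 * \<chi> 27 ^ 2"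
  proof -
    have "(6::'a) ^ 6 = 4 ^ 3 * 27 ^ 2" by simp
    then show ?thesis by (simp only: mult_char_mult[OF chi] mult_char_power[OF chi])
  qed
  moreover have "\<chi> 4 * G 0 * G 3 = gauss (W 3) * H 0"
      "\<chi> 4 * W 2 4 * G 2 * G 5 = gauss (W 3) * H 4" "\<chi> 4 * W 4 4 * G 4 * G 1 = gauss (W 3) * H 2"
    using dup[of 0] dup[of 1] dup[of 2] \<open>(4::'a) \<noteq> 0\<close> by (simp_all add: triv_char_def)
  ultimately have "\<chi> (6 ^ 6) * (G 0 * G 1 * G 2 * G 3 * G 4 * G 5) =
      (\<chi> 27 ^ 2 * H 0 * H 2 * H 4) * gauss (W 3) ^ 3"
    by Groebner_Basis.algebra
  also have "\<dots> = dwork_const * gauss (char_pow \<chi> 6)"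
    unfolding trip dwork_const_def using gauss_W3_square by Groebner_Basis.algebra
  finally show ?thesis by (simp add: prod_lessThan_6 G_def)
qed

end

lemma sum_lists_prod:
  fixes f :: "'a::finite \<Rightarrow> 'b::comm_semiring_1"
  shows "(\<Sum>xs | length xs = n. prod_list (map f xs)) = (\<Sum>x\<in>UNIV. f x) ^ n"
proof (induction n)
  case (Suc n)
  show ?case
    using sum_lists_Suc[where n=n and P="\<lambda>_. True" and f="\<lambda>xs. prod_list (map f xs)"]
    by (simp add: Suc sum_distrib_left[symmetric] sum_distrib_right[symmetric])
qed simp

subsection \<open>Counting points with Gauss sums\<close>

context additive_character
begin

lemma sum_gauss_chars:
  assumes "v \<noteq> 0"
  shows "(\<Sum>\<eta> | mult_char \<eta>. gauss (char_cnj \<eta>) * \<eta> v) = (of_nat CARD('a) - 1) * \<psi> v"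
proof -
  have "(\<Sum>\<eta> | mult_char \<eta>. gauss (char_cnj \<eta>) * \<eta> v) = (\<Sum>\<eta> | mult_char \<eta>. \<Sum>x\<in>UNIV. \<psi> x * \<eta> (v / x))"
    unfolding gauss_def sum_distrib_right
    by (intro sum.cong refl)
      (simp add: char_cnj_def cnj_mult_char divide_inverse mult_char_mult mult_char_inverse mult_ac)
  also have "\<dots> = (\<Sum>x\<in>UNIV. \<psi> x * (\<Sum>\<eta> | mult_char \<eta>. \<eta> (v / x)))"
    by (subst sum.swap) (simp add: sum_distrib_left)
  also have "\<dots> = (\<Sum>x\<in>UNIV. if x = v then (of_nat CARD('a) - 1) * \<psi> v else 0)"
    using assms by (intro sum.cong refl) (auto simp: sum_over_mult_chars)
  finally show ?thesis by simp
qed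

text \<open>The correction at the trivial character is the identity -q = -1 - (q - 1).\<close>

lemma inverse_gauss:
  assumes "mult_char \<chi>"
  shows "of_nat CARD('a) / gauss \<chi> =
    \<chi> (-1) * gauss (char_cnj \<chi>) - (if \<chi> = triv_char then of_nat CARD('a) - 1 else 0)"
proof (cases "\<chi> = triv_char")
  case False
  have "\<chi> (-1) * (gauss \<chi> * gauss (char_cnj \<chi>)) = of_nat CARD('a)"
    using gauss_cnj[OF assms False] mult_char_minus_1_square[OF assms]
    by (simp flip: mult.assoc)
  then show ?thesis using False assms by (simp add: field_simps)
qed (simp add: triv_char_def)

text \<open>Character expansion of \<open>\<psi>\<close> with g of the conjugate rewritten through
  1/g. The trivial character accounts for the -1, which also makes the formula correct at y =
  0.\<close>

lemma psi_minus_1_expansion: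
  "of_nat CARD('a) * (\<Sum>\<chi> | mult_char \<chi>. \<chi> (- y) / gauss \<chi>) = (of_nat CARD('a) - 1) * (\<psi> y - 1)"
proof (cases "y = 0")
  case False
  have "of_nat CARD('a) * (\<Sum>\<chi> | mult_char \<chi>. \<chi> (- y) / gauss \<chi>) =
      (\<Sum>\<chi> | mult_char \<chi>. gauss (char_cnj \<chi>) * \<chi> y - (if \<chi> = triv_char then of_nat CARD('a) - 1 else 0))"
    unfolding sum_distrib_left
  proof (intro sum.cong refl)
    fix \<chi> assume "\<chi> \<in> {\<chi> :: 'a \<Rightarrow> complex. mult_char \<chi>}"
    then have chi: "mult_char \<chi>" by simp
    have "of_nat CARD('a) * (\<chi> (- y) / gauss \<chi>) = \<chi> (- y) * (of_nat CARD('a) / gauss \<chi>)" by simp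
    also have "\<dots> = \<chi> (-1) * \<chi> (-1) * gauss (char_cnj \<chi>) * \<chi> y -
        \<chi> (- y) * (if \<chi> = triv_char then of_nat CARD('a) - 1 else 0)"
      unfolding inverse_gauss[OF chi] mult_char_minus[OF chi, of y] by (simp add: algebra_simps)
    finally show "of_nat CARD('a) * (\<chi> (- y) / gauss \<chi>) =
        gauss (char_cnj \<chi>) * \<chi> y - (if \<chi> = triv_char then of_nat CARD('a) - 1 else 0)"
      using False chi by (simp add: triv_char_def split: if_splits)
  qed
  also have "\<dots> = (of_nat CARD('a) - 1) * \<psi> y - (of_nat CARD('a) - 1)"
    by (simp add: sum_subtractf sum_gauss_chars[OF False] finite_mult_chars)
  finally show ?thesis by (simp add: algebra_simps)
qed simp

text \<open>Expand \<open>\<psi>\<close> in characters; summing over x leaves those whose n-th power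
  matches \<chi>. If \<chi> is not an n-th power, both sides are 0.\<close>

lemma twisted_power_sum:
  assumes chi: "mult_char \<chi>" and w: "w \<noteq> 0" and n: "n > 0"
  shows "(\<Sum>x\<in>UNIV. \<chi> x * \<psi> (w * x ^ n)) =
    (\<Sum>\<eta> | mult_char \<eta> \<and> char_pow \<eta> n = \<chi>. gauss \<eta> * char_cnj \<eta> w)"
proof -
  let ?q1 = "complex_of_nat CARD('a) - 1"
  have "?q1 * (\<Sum>x\<in>UNIV. \<chi> x * \<psi> (w * x ^ n)) =
      (\<Sum>x\<in>UNIV. \<Sum>\<eta> | mult_char \<eta>. gauss (char_cnj \<eta>) * \<eta> w * char_mult \<chi> (char_pow \<eta> n) x)"
    unfolding sum_distrib_left
  proof (intro sum.cong refl)
    fix x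
    show "?q1 * (\<chi> x * \<psi> (w * x ^ n)) =
        (\<Sum>\<eta> | mult_char \<eta>. gauss (char_cnj \<eta>) * \<eta> w * char_mult \<chi> (char_pow \<eta> n) x)"
    proof (cases "x = 0")
      case False
      have "?q1 * (\<chi> x * \<psi> (w * x ^ n)) = \<chi> x * (\<Sum>\<eta> | mult_char \<eta>. gauss (char_cnj \<eta>) * \<eta> (w * x ^ n))"
        using False w by (subst sum_gauss_chars) simp_all
      then show ?thesis
        using False unfolding sum_distrib_left
        by (simp add: char_mult_def char_pow_def mult_char_mult mult_char_power mult_ac)
    qed (use chi in \<open>simp add: char_mult_def\<close>)
  qed
  also have "\<dots> = (\<Sum>\<eta> | mult_char \<eta>. gauss (char_cnj \<eta>) * \<eta> w * (\<Sum>x\<in>UNIV. char_mult \<chi> (char_pow \<eta> n) x))"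
    by (subst sum.swap) (simp add: sum_distrib_left)
  also have "\<dots> = (\<Sum>\<eta> | mult_char \<eta>. gauss \<eta> * char_cnj \<eta> w * (\<Sum>x\<in>UNIV. char_mult \<chi> (char_pow (char_cnj \<eta>) n) x))"
    by (subst sum_mult_char_cnj[symmetric]) simp
  also have "\<dots> = ?q1 * (\<Sum>\<eta> | mult_char \<eta> \<and> char_pow \<eta> n = \<chi>. gauss \<eta> * char_cnj \<eta> w)"
    unfolding sum_distrib_left[of ?q1]
  proof (intro sum.mono_neutral_cong_right finite_mult_chars ballI)
    have iff: "char_mult \<chi> (char_pow (char_cnj \<eta>) n) = triv_char \<longleftrightarrow> char_pow \<eta> n = \<chi>"
      if "mult_char \<eta>" for \<eta> :: "'a \<Rightarrow> complex"
    proof -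
      have "char_pow (char_cnj \<eta>) n = char_cnj (char_pow \<eta> n)"
        by (simp add: char_pow_def char_cnj_def fun_eq_iff)
      then show ?thesis
        using chi that by (simp add: char_mult_eq_triv_iff) (metis char_cnj_cnj)
    qed
    show "gauss \<eta> * char_cnj \<eta> w * (\<Sum>x\<in>UNIV. char_mult \<chi> (char_pow (char_cnj \<eta>) n) x) = 0"
      if "\<eta> \<in> {\<eta>. mult_char \<eta>} - {\<eta>. mult_char \<eta> \<and> char_pow \<eta> n = \<chi>}" for \<eta>
      using that chi by (simp add: sum_mult_char iff)
    show "gauss \<eta> * char_cnj \<eta> w * (\<Sum>x\<in>UNIV. char_mult \<chi> (char_pow (char_cnj \<eta>) n) x) =
        ?q1 * (gauss \<eta> * char_cnj \<eta> w)" if "\<eta> \<in> {\<eta>. mult_char \<eta> \<and> char_pow \<eta> n = \<chi>}" for \<eta>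
      using that chi by (simp add: sum_mult_char iff)
  qed auto
  finally show ?thesis using card_field_gt_1[where 'a='a] by simp
qed

end

context sextic_characters
begin

lemma chars_same_sixth_power:
  assumes "mult_char \<eta>"
  shows "{\<phi>. mult_char \<phi> \<and> char_pow \<phi> 6 = char_pow \<eta> 6} = (\<lambda>j. char_mult \<eta> (W j)) ` {..<6}"
proof -
  have pow_mult: "char_pow (char_mult A B) 6 = char_mult (char_pow A 6) (char_pow B 6)" for A B :: "'a \<Rightarrow> complex"
    by (simp add: char_pow_def char_mult_def fun_eq_iff power_mult_distrib)
  have pow_cnj: "char_pow (char_cnj A) 6 = char_cnj (char_pow A 6)" for A :: "'a \<Rightarrow> complex"
    by (simp add: char_pow_def char_cnj_def fun_eq_iff)
  have W6: "char_pow (W j) 6 = triv_char" for j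
    by (simp add: W_power W_eq_triv_iff)
  show ?thesis
  proof (intro equalityI subsetI)
    fix \<phi> assume phi: "\<phi> \<in> {\<phi>. mult_char \<phi> \<and> char_pow \<phi> 6 = char_pow \<eta> 6}"
    then have "char_mult (char_cnj \<eta>) \<phi> \<in> {\<chi>. mult_char \<chi> \<and> char_pow \<chi> 6 = triv_char}"
      using assms by (simp add: pow_mult pow_cnj)
    then obtain j where "j < 6" "char_mult (char_cnj \<eta>) \<phi> = W j"
      unfolding chars_of_exponent_6 by auto
    then have "\<phi> = char_mult \<eta> (W j)" using assms phi by (metis char_mult_cnj_left_cancel(1) mem_Collect_eq)
    then show "\<phi> \<in> (\<lambda>j. char_mult \<eta> (W j)) ` {..<6}" using \<open>j < 6\<close> by blast
  qed (use assms in \<open>auto simp: pow_mult W6\<close>)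
qed

lemma inj_on_char_mult_W:
  assumes "mult_char \<eta>"
  shows "inj_on (\<lambda>j. char_mult \<eta> (W j)) {..<6}"
proof (rule inj_onI)
  fix i j :: nat assume ij: "i \<in> {..<6}" "j \<in> {..<6}" "char_mult \<eta> (W i) = char_mult \<eta> (W j)"
  then have "W i = W j" using assms by (metis char_mult_cnj_left_cancel(2) mult_char_W)
  then show "i = j" using ij by (simp add: W_eq_iff)
qed

text \<open>The sixth root of unity at which the polynomial in the Gauss sums is evaluated; it is
  conjugated because \<open>twisted_power_sum\<close> yields conjugate characters at
  \<open>w\<close>.\<close>

definition root_of :: "'a \<Rightarrow> complex" where
  "root_of w = cnj (W 1 w)"

lemma root_of_power_6: "w \<noteq> 0 \<Longrightarrow> root_of w ^ 6 = 1"
  using W_apply[of w 6] W_eq_triv_iff[of 6]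
  by (simp add: root_of_def triv_char_def flip: complex_cnj_power)

lemma cnj_W_apply: "w \<noteq> 0 \<Longrightarrow> char_cnj (W j) w = root_of w ^ j"
  using W_apply[of w j] by (simp add: root_of_def char_cnj_def)

definition gauss_W :: "('a \<Rightarrow> complex) \<Rightarrow> nat \<Rightarrow> complex" where
  "gauss_W \<eta> j = gauss (char_mult \<eta> (W j))"

lemma sixth_power_sum:
  assumes "mult_char \<eta>" "w \<noteq> 0"
  shows "(\<Sum>x\<in>UNIV. char_pow \<eta> 6 x * \<psi> (w * x ^ 6)) =
    char_cnj \<eta> w * (\<Sum>j<6. gauss_W \<eta> j * root_of w ^ j)"
proof -
  have "(\<Sum>x\<in>UNIV. char_pow \<eta> 6 x * \<psi> (w * x ^ 6)) =
      (\<Sum>j<6. gauss (char_mult \<eta> (W j)) * char_cnj (char_mult \<eta> (W j)) w)"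
    using assms
    by (simp add: twisted_power_sum chars_same_sixth_power sum.reindex[OF inj_on_char_mult_W])
  also have "\<dots> = (\<Sum>j<6. char_cnj \<eta> w * (gauss_W \<eta> j * root_of w ^ j))"
    using assms(2)
    by (intro sum.cong refl) (simp add: char_cnj_mult char_mult_def[of "char_cnj _"] cnj_W_apply gauss_W_def)
  finally show ?thesis by (simp add: sum_distrib_left)
qed

text \<open>Summing over nonzero w extracts the constant term, by orthogonality of the powers of
  \<omega>6.\<close>

lemma sum_root_of_polynomial:
  "(\<Sum>w\<in>UNIV. triv_char w * (\<Sum>j<6. G j * root_of w ^ j) ^ 6) =
    (of_nat CARD('a) - 1) * orbit_polynomial G"
proof -
  obtain P where P0: "P 0 = orbit_polynomial G"
    and P: "\<And>z. z ^ 6 = 1 \<Longrightarrow> (\<Sum>j<6. G j * z ^ j) ^ 6 = (\<Sum>s<6. P s * z ^ s)"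
    using sixth_power_expansion[of G] by blast
  have "(\<Sum>w\<in>UNIV. triv_char w * (\<Sum>j<6. G j * root_of w ^ j) ^ 6) =
      (\<Sum>w\<in>UNIV. \<Sum>s<6. P s * char_cnj (W s) w)"
  proof (intro sum.cong refl)
    fix w :: 'a
    show "triv_char w * (\<Sum>j<6. G j * root_of w ^ j) ^ 6 = (\<Sum>s<6. P s * char_cnj (W s) w)"
    proof (cases "w = 0")
      case True
      then show ?thesis by (simp add: triv_char_def char_cnj_def)
    next
      case False
      then show ?thesis by (simp add: P root_of_power_6 cnj_W_apply triv_char_def)
    qed
  qed
  also have "\<dots> = (\<Sum>s<6. P s * (\<Sum>w\<in>UNIV. char_cnj (W s) w))"
    by (subst sum.swap) (simp add: sum_distrib_left)
  also have "\<dots> = (\<Sum>s<6::nat. if s = 0 then P 0 * (of_nat CARD('a) - 1) else 0)"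
    by (intro sum.cong refl) (auto simp: sum_mult_char W_eq_triv_iff)
  finally show ?thesis by (simp add: P0 mult.commute)
qed

text \<open>The inner sum vanishes unless \<chi> is a sixth power, and a sixth power has exactly six
  sixth roots \<eta>.\<close>

lemma sum_sixth_power_fibers:
  assumes w: "w \<noteq> 0"
  shows "6 * (\<Sum>\<chi> | mult_char \<chi>. f \<chi> * (\<Sum>x\<in>UNIV. \<chi> x * \<psi> (w * x ^ 6)) ^ 6) =
    (\<Sum>\<eta> | mult_char \<eta>. f (char_pow \<eta> 6) * (\<Sum>x\<in>UNIV. char_pow \<eta> 6 x * \<psi> (w * x ^ 6)) ^ 6)"
proof -
  define A where "A \<chi> = (\<Sum>x\<in>UNIV. \<chi> x * \<psi> (w * x ^ 6))" for \<chi>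
  \<comment> \<open>One of the six equal factors is expanded over the sixth roots of \<chi> and the
    other five are kept. This regroups the sum by \<eta> without asking which \<chi> are sixth
    powers.\<close>
  let ?F = "\<lambda>\<eta>. f (char_pow \<eta> 6) * A (char_pow \<eta> 6) ^ 5 * (gauss \<eta> * char_cnj \<eta> w)"
  have "(\<Sum>\<chi> | mult_char \<chi>. f \<chi> * A \<chi> ^ 6) =
      (\<Sum>\<chi>\<in>{\<chi>. mult_char \<chi>}. \<Sum>\<eta> | \<eta> \<in> {\<eta>. mult_char \<eta>} \<and> char_pow \<eta> 6 = \<chi>. ?F \<eta>)"
  proof (intro sum.cong refl)
    fix \<chi> :: "'a \<Rightarrow> complex" assume "\<chi> \<in> {\<chi>. mult_char \<chi>}"
    then have eq: "A \<chi> = (\<Sum>\<eta> | mult_char \<eta> \<and> char_pow \<eta> 6 = \<chi>. gauss \<eta> * char_cnj \<eta> w)"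
      unfolding A_def using w by (simp add: twisted_power_sum)
    have "f \<chi> * A \<chi> ^ 6 = f \<chi> * A \<chi> ^ 5 * A \<chi>" by (simp add: eval_nat_numeral)
    also have "\<dots> = f \<chi> * A \<chi> ^ 5 * (\<Sum>\<eta> | mult_char \<eta> \<and> char_pow \<eta> 6 = \<chi>. gauss \<eta> * char_cnj \<eta> w)"
      by (rule arg_cong[OF eq])
    finally show "f \<chi> * A \<chi> ^ 6 = (\<Sum>\<eta> | \<eta> \<in> {\<eta>. mult_char \<eta>} \<and> char_pow \<eta> 6 = \<chi>. ?F \<eta>)"
      by (simp add: sum_distrib_left)
  qed
  also have "\<dots> = (\<Sum>\<eta> | mult_char \<eta>. ?F \<eta>)"
    by (rule sum.group) (auto simp: finite_mult_chars)
  finally have "6 * (\<Sum>\<chi> | mult_char \<chi>. f \<chi> * A \<chi> ^ 6) = (\<Sum>j<6::nat. \<Sum>\<eta> | mult_char \<eta>. ?F \<eta>)"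
    by simp
  \<comment> \<open>Averaging over the six twists restores the expanded factor.\<close>
  also have "\<dots> = (\<Sum>j<6. \<Sum>\<eta> | mult_char \<eta>. ?F (char_mult \<eta> (W j)))"
    by (intro sum.cong refl sum_mult_char_shift[symmetric] mult_char_W)
  also have "\<dots> = (\<Sum>\<eta> | mult_char \<eta>. \<Sum>j<6. ?F (char_mult \<eta> (W j)))" by (rule sum.swap)
  also have "\<dots> = (\<Sum>\<eta> | mult_char \<eta>. f (char_pow \<eta> 6) * A (char_pow \<eta> 6) ^ 6)"
  proof (intro sum.cong refl)
    fix \<eta> :: "'a \<Rightarrow> complex" assume "\<eta> \<in> {\<eta>. mult_char \<eta>}"
    then have eta: "mult_char \<eta>" by simp
    have pow: "char_pow (char_mult \<eta> (W j)) 6 = char_pow \<eta> 6" if "j < 6" for j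
      using chars_same_sixth_power[OF eta] that by blast
    have eq: "A (char_pow \<eta> 6) = (\<Sum>j<6. gauss (char_mult \<eta> (W j)) * char_cnj (char_mult \<eta> (W j)) w)"
      unfolding A_def using w eta
      by (simp add: twisted_power_sum chars_same_sixth_power sum.reindex[OF inj_on_char_mult_W])
    have "(\<Sum>j<6. ?F (char_mult \<eta> (W j))) = f (char_pow \<eta> 6) * A (char_pow \<eta> 6) ^ 5 *
        (\<Sum>j<6. gauss (char_mult \<eta> (W j)) * char_cnj (char_mult \<eta> (W j)) w)"
      by (simp add: pow sum_distrib_left)
    also have "\<dots> = f (char_pow \<eta> 6) * A (char_pow \<eta> 6) ^ 5 * A (char_pow \<eta> 6)"
      by (rule arg_cong[OF eq[symmetric]])
    finally show "(\<Sum>j<6. ?F (char_mult \<eta> (W j))) = f (char_pow \<eta> 6) * A (char_pow \<eta> 6) ^ 6"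
      by (simp add: eval_nat_numeral)
  qed
  finally show ?thesis by (simp add: A_def)
qed

end

lemma cyclic_shift_bij:
  assumes "i < (6::nat)"
  shows "bij_betw (\<lambda>j. (i + j) mod 6) {..<6} {..<6}"
proof (rule bij_betw_byWitness[where f' = "\<lambda>j. (j + 6 - i) mod 6"])
  show "\<forall>j\<in>{..<6}. ((i + j) mod 6 + 6 - i) mod 6 = j"
  proof
    fix j :: nat assume j: "j \<in> {..<6}"
    show "((i + j) mod 6 + 6 - i) mod 6 = j"
    proof (cases "i + j < 6")
      case False
      then have "(i + j) mod 6 = i + j - 6" using j assms by (simp add: mod_if)
      then show ?thesis using False j assms by simp
    qed (use j in simp)
  qed
  show "\<forall>j\<in>{..<6}. (i + (j + 6 - i) mod 6) mod 6 = j"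
  proof
    fix j :: nat assume "j \<in> {..<6}"
    moreover have "i + (j + 6 - i) = j + 6" using assms by simp
    ultimately show "(i + (j + 6 - i) mod 6) mod 6 = j" by (simp add: mod_add_right_eq)
  qed
qed auto

lemma prod_cyclic_shift:
  fixes f :: "nat \<Rightarrow> 'b::comm_monoid_mult"
  assumes "i < 6"
  shows "(\<Prod>j<6. f ((i + j) mod 6)) = (\<Prod>j<6. f j)"
  using prod.reindex_bij_betw[OF cyclic_shift_bij[OF assms]] .

context sextic_characters
begin

lemma W_power_6: "x \<noteq> 0 \<Longrightarrow> W i x ^ 6 = 1"
  using fun_cong[OF W_power[of i 6], of x] W_eq_triv_iff[of "i * 6"]
  by (simp add: char_pow_def triv_char_def)

text \<open>In the untwisted power sum the term x = 0 adds 1, which cancels the Gauss sum -1 of the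
  trivial character; hence the value 0 at index 0.\<close>

definition gauss_W0 :: "nat \<Rightarrow> complex" where
  "gauss_W0 j = (if j = 0 then 0 else gauss (W j))"

lemma psi_power_sum: "\<psi> (w * sum_list (map (\<lambda>x. x ^ 6) xs)) = prod_list (map (\<lambda>x. \<psi> (w * x ^ 6)) xs)"
  by (induction xs) (simp_all add: add distrib_left)

lemma sum_psi_sixth_power:
  assumes "w \<noteq> 0"
  shows "(\<Sum>x\<in>UNIV. \<psi> (w * x ^ 6)) = (\<Sum>j<6. gauss_W0 j * root_of w ^ j)"
proof -
  have "(\<Sum>x\<in>UNIV. \<psi> (w * x ^ 6)) =
      (\<Sum>x\<in>UNIV. (if x = 0 then 1 else 0) + char_pow triv_char 6 x * \<psi> (w * x ^ 6))"
    by (intro sum.cong refl) (simp add: char_pow_def triv_char_def)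
  also have "\<dots> = 1 + (\<Sum>j<6. gauss (W j) * root_of w ^ j)"
    using assms sixth_power_sum[of triv_char w] by (simp add: sum.distrib gauss_W_def triv_char_def)
  also have "\<dots> = (\<Sum>j<6. gauss_W0 j * root_of w ^ j)"
    by (simp add: lessThan_6 gauss_W0_def)
  finally show ?thesis .
qed

text \<open>Once the product term is expanded in characters, the sum over lists factors into six
  equal one-variable sums. The powers of \<eta>(w) cancel, so \<open>w\<close> survives only through
  \<open>root_of w\<close>.\<close>

lemma power_sum_character_expansion:
  assumes w: "w \<noteq> 0"
  shows "6 * (of_nat CARD('a) - 1) *
      (\<Sum>xs | length xs = 6. \<psi> (w * sum_list (map (\<lambda>x. x ^ 6) xs)) * (\<psi> (- (a * w * prod_list xs)) - 1)) =
    of_nat CARD('a) * (\<Sum>\<eta> | mult_char \<eta>.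
      \<eta> a ^ 6 / gauss (char_pow \<eta> 6) * (\<Sum>j<6. gauss_W \<eta> j * root_of w ^ j) ^ 6)"
proof -
  let ?S = "\<lambda>xs. \<psi> (w * sum_list (map (\<lambda>x. x ^ 6) xs))"
  have char_prod_list: "\<chi> (prod_list xs) = prod_list (map \<chi> xs)" if "mult_char \<chi>" for \<chi> :: "'a \<Rightarrow> complex" and xs
    using that by (induction xs) (simp_all add: mult_char_mult)
  have prod_list_mult: "prod_list (map f xs) * prod_list (map g xs) = prod_list (map (\<lambda>x. f x * g x) xs)"
    for f g :: "'a \<Rightarrow> complex" and xs
    by (induction xs) (simp_all add: mult_ac)
  have "(of_nat CARD('a) - 1) * (\<Sum>xs | length xs = 6. ?S xs * (\<psi> (- (a * w * prod_list xs)) - 1)) =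
      (\<Sum>xs | length xs = 6. ?S xs * ((of_nat CARD('a) - 1) * (\<psi> (- (a * w * prod_list xs)) - 1)))"
    by (simp add: sum_distrib_left mult_ac)
  also have "\<dots> = (\<Sum>xs | length xs = 6. \<Sum>\<chi> | mult_char \<chi>.
      of_nat CARD('a) * (\<chi> (a * w) / gauss \<chi> * (?S xs * \<chi> (prod_list xs))))"
    unfolding psi_minus_1_expansion[symmetric] sum_distrib_left
    by (intro sum.cong refl) (simp add: mult_char_mult)
  also have "\<dots> = of_nat CARD('a) * (\<Sum>\<chi> | mult_char \<chi>. \<chi> (a * w) / gauss \<chi> *
      (\<Sum>xs | length xs = 6. ?S xs * \<chi> (prod_list xs)))"
    by (subst sum.swap) (simp add: sum_distrib_left)
  also have "(\<Sum>\<chi> | mult_char \<chi>. \<chi> (a * w) / gauss \<chi> * (\<Sum>xs | length xs = 6. ?S xs * \<chi> (prod_list xs))) =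
      (\<Sum>\<chi> | mult_char \<chi>. \<chi> (a * w) / gauss \<chi> * (\<Sum>x\<in>UNIV. \<chi> x * \<psi> (w * x ^ 6)) ^ 6)"
    by (intro sum.cong refl)
      (simp add: char_prod_list psi_power_sum prod_list_mult mult.commute flip: sum_lists_prod)
  finally have "6 * (of_nat CARD('a) - 1) *
      (\<Sum>xs | length xs = 6. ?S xs * (\<psi> (- (a * w * prod_list xs)) - 1)) =
      of_nat CARD('a) * (6 * (\<Sum>\<chi> | mult_char \<chi>. \<chi> (a * w) / gauss \<chi> * (\<Sum>x\<in>UNIV. \<chi> x * \<psi> (w * x ^ 6)) ^ 6))"
    by (simp only: mult_ac)
  also have "\<dots> = of_nat CARD('a) * (\<Sum>\<eta> | mult_char \<eta>. char_pow \<eta> 6 (a * w) / gauss (char_pow \<eta> 6) *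
      (char_cnj \<eta> w * (\<Sum>j<6. gauss_W \<eta> j * root_of w ^ j)) ^ 6)"
    unfolding sum_sixth_power_fibers[OF w] using w by (simp add: sixth_power_sum)
  also have "(\<Sum>\<eta> | mult_char \<eta>. char_pow \<eta> 6 (a * w) / gauss (char_pow \<eta> 6) *
      (char_cnj \<eta> w * (\<Sum>j<6. gauss_W \<eta> j * root_of w ^ j)) ^ 6) =
    (\<Sum>\<eta> | mult_char \<eta>. \<eta> a ^ 6 / gauss (char_pow \<eta> 6) * (\<Sum>j<6. gauss_W \<eta> j * root_of w ^ j) ^ 6)"
  proof (intro sum.cong refl)
    fix \<eta> assume "\<eta> \<in> {\<eta> :: 'a \<Rightarrow> complex. mult_char \<eta>}"
    then have "char_pow \<eta> 6 (a * w) * char_cnj \<eta> w ^ 6 = \<eta> a ^ 6"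
      using w by (simp add: char_pow_eq_power mult_char_mult char_cnj_def cnj_mult_char field_simps)
    then show "char_pow \<eta> 6 (a * w) / gauss (char_pow \<eta> 6) *
      (char_cnj \<eta> w * (\<Sum>j<6. gauss_W \<eta> j * root_of w ^ j)) ^ 6 =
      \<eta> a ^ 6 / gauss (char_pow \<eta> 6) * (\<Sum>j<6. gauss_W \<eta> j * root_of w ^ j) ^ 6"
      by (simp add: power_mult_distrib flip: mult.assoc)
  qed
  finally show ?thesis .
qed

text \<open>Detect the equation by summing \<open>\<psi>\<close> over multiples w. The value w = 0
  gives the main term; for w nonzero, splitting the product factor as 1 + (\<psi> - 1) gives the
  diagonal part and the character sum.\<close>

lemma affine_count_expansion:
  "of_nat (card {xs :: 'a list. length xs = 6 \<and> sum_list (map (\<lambda>x. x ^ 6) xs) = a * prod_list xs}) =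
    of_nat CARD('a) ^ 5 + (of_nat CARD('a) - 1) / of_nat CARD('a) * orbit_polynomial gauss_W0 +
    (\<Sum>\<eta> | mult_char \<eta>. \<eta> a ^ 6 / gauss (char_pow \<eta> 6) * orbit_polynomial (gauss_W \<eta>)) / 6"
proof -
  let ?q = "complex_of_nat CARD('a)" and ?L = "{xs :: 'a list. length xs = 6}"
  let ?S = "\<lambda>xs :: 'a list. sum_list (map (\<lambda>x. x ^ 6) xs)"
  let ?N = "card {xs :: 'a list. length xs = 6 \<and> ?S xs = a * prod_list xs}"
  let ?R = "\<Sum>\<eta> | mult_char \<eta>. \<eta> a ^ 6 / gauss (char_pow \<eta> 6) * orbit_polynomial (gauss_W \<eta>)"
  have finL: "finite ?L" using finite_lists_length_eq_UNIV[of 6 "\<lambda>_. True"] by simp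
  define E where "E w = (\<Sum>xs\<in>?L. \<psi> (w * ?S xs) * \<psi> (- (a * w * prod_list xs)))" for w
  have "?q * of_nat ?N = (\<Sum>xs\<in>?L. if ?S xs - a * prod_list xs = 0 then ?q else 0)"
    using finL by (simp add: sum.If_cases Collect_conj_eq[symmetric] Int_def mult.commute)
  also have "\<dots> = (\<Sum>xs\<in>?L. \<Sum>w\<in>UNIV. \<psi> (w * ?S xs) * \<psi> (- (a * w * prod_list xs)))"
  proof (intro sum.cong refl)
    fix xs
    have "(\<Sum>w\<in>UNIV. \<psi> (w * ?S xs) * \<psi> (- (a * w * prod_list xs))) =
        (\<Sum>w\<in>UNIV. \<psi> ((?S xs - a * prod_list xs) * w))"
      by (intro sum.cong refl) (simp add: algebra_simps flip: add)
    then show "(if ?S xs - a * prod_list xs = 0 then ?q else 0) =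
        (\<Sum>w\<in>UNIV. \<psi> (w * ?S xs) * \<psi> (- (a * w * prod_list xs)))"
      by (simp only: sum_psi_scale)
  qed
  also have "\<dots> = (\<Sum>w\<in>UNIV. E w)" unfolding E_def by (rule sum.swap)
  also have "\<dots> = (\<Sum>w\<in>UNIV. (if w = 0 then ?q ^ 6 else 0) +
     (triv_char w * (\<Sum>j<6. gauss_W0 j * root_of w ^ j) ^ 6 +
     ?q / (6 * (?q - 1)) * (\<Sum>\<eta> | mult_char \<eta>. \<eta> a ^ 6 / gauss (char_pow \<eta> 6) *
       (triv_char w * (\<Sum>j<6. gauss_W \<eta> j * root_of w ^ j) ^ 6))))"
  proof (intro sum.cong refl)
    fix w :: 'a
    show "E w = (if w = 0 then ?q ^ 6 else 0) +
     (triv_char w * (\<Sum>j<6. gauss_W0 j * root_of w ^ j) ^ 6 +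
     ?q / (6 * (?q - 1)) * (\<Sum>\<eta> | mult_char \<eta>. \<eta> a ^ 6 / gauss (char_pow \<eta> 6) *
       (triv_char w * (\<Sum>j<6. gauss_W \<eta> j * root_of w ^ j) ^ 6)))"
    proof (cases "w = 0")
      case True
      have "(\<Sum>xs\<in>?L. prod_list (map (\<lambda>_. 1) xs)) = ?q ^ 6"
        unfolding sum_lists_prod by simp
      then show ?thesis using True by (simp add: E_def triv_char_def map_replicate_const)
    next
      case False
      have "E w = (\<Sum>xs\<in>?L. \<psi> (w * ?S xs)) +
          (\<Sum>xs\<in>?L. \<psi> (w * ?S xs) * (\<psi> (- (a * w * prod_list xs)) - 1))"
        unfolding E_def by (simp add: algebra_simps flip: sum.distrib)
      also have "(\<Sum>xs\<in>?L. \<psi> (w * ?S xs)) = (\<Sum>j<6. gauss_W0 j * root_of w ^ j) ^ 6"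
        unfolding psi_power_sum sum_lists_prod by (simp add: sum_psi_sixth_power[OF False])
      also have "(\<Sum>xs\<in>?L. \<psi> (w * ?S xs) * (\<psi> (- (a * w * prod_list xs)) - 1)) =
          ?q / (6 * (?q - 1)) * (\<Sum>\<eta> | mult_char \<eta>. \<eta> a ^ 6 / gauss (char_pow \<eta> 6) *
            (\<Sum>j<6. gauss_W \<eta> j * root_of w ^ j) ^ 6)"
        using power_sum_character_expansion[OF False, of a] card_nonzero
        by (simp add: field_simps del: sum_divide_distrib)
      finally show ?thesis using False by (simp add: triv_char_def)
    qed
  qed
  also have "\<dots> = ?q ^ 6 + ((?q - 1) * orbit_polynomial gauss_W0 + ?q / (6 * (?q - 1)) *
      (\<Sum>\<eta> | mult_char \<eta>. \<eta> a ^ 6 / gauss (char_pow \<eta> 6) *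
        (\<Sum>w\<in>UNIV. triv_char w * (\<Sum>j<6. gauss_W \<eta> j * root_of w ^ j) ^ 6)))"
  proof -
    have "(\<Sum>w\<in>UNIV. \<Sum>\<eta> | mult_char \<eta>. \<eta> a ^ 6 / gauss (char_pow \<eta> 6) *
         (triv_char w * (\<Sum>j<6. gauss_W \<eta> j * root_of w ^ j) ^ 6)) =
       (\<Sum>\<eta> | mult_char \<eta>. \<eta> a ^ 6 / gauss (char_pow \<eta> 6) *
         (\<Sum>w\<in>UNIV. triv_char w * (\<Sum>j<6. gauss_W \<eta> j * root_of w ^ j) ^ 6))"
      by (subst sum.swap) (simp only: sum_distrib_left)
    then show ?thesis
      unfolding sum.distrib sum_root_of_polynomial[of gauss_W0] sum_distrib_left[symmetric, of "?q / (6 * (?q - 1))"]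
      by simp
  qed
  also have "(\<Sum>\<eta> | mult_char \<eta>. \<eta> a ^ 6 / gauss (char_pow \<eta> 6) *
        (\<Sum>w\<in>UNIV. triv_char w * (\<Sum>j<6. gauss_W \<eta> j * root_of w ^ j) ^ 6)) = (?q - 1) * ?R"
    unfolding sum_root_of_polynomial sum_distrib_left[of "?q - 1"] by (simp only: mult_ac)
  also have "?q ^ 6 + ((?q - 1) * orbit_polynomial gauss_W0 + ?q / (6 * (?q - 1)) * ((?q - 1) * ?R)) =
      ?q * (?q ^ 5 + (?q - 1) / ?q * orbit_polynomial gauss_W0 + ?R / 6)"
    using card_nonzero by (simp add: field_simps eval_nat_numeral)
  finally show ?thesis using card_nonzero by simp
qed

text \<open>For \<open>n = 0\<close> this is \<open>1 / g(\<chi>)\<close>, except at the trivial character, where it is \<open>- 1 / q\<close> instead of \<open>- 1\<close>.\<close>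
definition kappa :: "nat \<Rightarrow> ('a \<Rightarrow> complex) \<Rightarrow> complex" where
  "kappa n \<chi> = (if n = 0 then \<chi> (-1) * gauss (char_cnj \<chi>) / of_nat CARD('a) else gauss \<chi> ^ (n - 1))"

lemma kappa_eq:
  assumes "mult_char \<chi>"
  shows "kappa n \<chi> = gauss \<chi> ^ n / gauss \<chi> * (if \<chi> = triv_char \<and> n = 0 then 1 / of_nat CARD('a) else 1)"
proof (cases "n = 0")
  case True
  show ?thesis
  proof (cases "\<chi> = triv_char")
    case False
    then have "\<chi> (-1) * gauss (char_cnj \<chi>) = of_nat CARD('a) / gauss \<chi>"
      using inverse_gauss[OF assms] by simp
    then show ?thesis using True False by (simp add: kappa_def)
  qed (use True in \<open>simp add: kappa_def triv_char_def[of "-1"]\<close>)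
next
  case False
  then show ?thesis using assms by (cases n) (simp_all add: kappa_def)
qed

definition orbit_sum :: "'a \<Rightarrow> nat list \<Rightarrow> complex" where
  "orbit_sum a m = (\<Sum>\<eta> | mult_char \<eta>. \<eta> a ^ 6 * (\<Prod>j<6. kappa (m ! j) (char_mult \<eta> (W j))))"

lemma gauss_W_shift: "gauss_W (char_mult \<eta> (W i)) j = gauss_W \<eta> ((i + j) mod 6)"
  by (simp only: gauss_W_def W_mult_assoc)

lemma dwork_const_nonzero [simp]: "dwork_const \<noteq> 0"
  by (simp add: dwork_const_def)

lemma prod_gauss_W_eq:
  assumes "mult_char \<eta>"
  shows "\<eta> 6 ^ 6 / gauss (char_pow \<eta> 6) = dwork_const / (\<Prod>j<6. gauss_W \<eta> j)"
proof -
  have "(\<Prod>j<6. gauss_W \<eta> j) \<noteq> 0" using assms by (simp add: gauss_W_def)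
  then show ?thesis
    using gauss_six[OF assms, unfolded mult_char_power[OF assms]] assms
    by (simp add: field_simps gauss_W_def)
qed

text \<open>\<open>kappa\<close> differs from g^(n-1) only for n = 0 at the trivial character, so a
  correction arises only for \<eta> a power of \<omega>6 and a monomial lacking that factor. There
  the product of the six Gauss sums is \<open>- dwork_const\<close>, and -1/q against -1 leaves
  (q-1)/q times the monomial.\<close>

lemma prod_kappa:
  assumes eta: "mult_char \<eta>"
  shows "dwork_const * (\<Prod>j<6. kappa (m ! j) (char_mult \<eta> (W j))) =
    dwork_const * orbit_monomial (gauss_W \<eta>) m / (\<Prod>j<6. gauss_W \<eta> j) +
    (of_nat CARD('a) - 1) / of_nat CARD('a) *
      (\<Sum>i<6. if \<eta> = W i then orbit_monomial (\<lambda>j. gauss_W0 ((i + j) mod 6)) m else 0)"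
proof -
  let ?q = "complex_of_nat CARD('a)"
  have kap: "kappa (m ! j) (char_mult \<eta> (W j)) = gauss_W \<eta> j ^ (m ! j) / gauss_W \<eta> j *
      (if char_mult \<eta> (W j) = triv_char \<and> m ! j = 0 then 1 / ?q else 1)" for j
    using eta by (simp only: kappa_eq mult_char_char_mult mult_char_W gauss_W_def)
  have prod_kap: "(\<Prod>j<6. kappa (m ! j) (char_mult \<eta> (W j))) =
      orbit_monomial (gauss_W \<eta>) m / (\<Prod>j<6. gauss_W \<eta> j) *
      (\<Prod>j<6. if char_mult \<eta> (W j) = triv_char \<and> m ! j = 0 then 1 / ?q else 1)"
    by (simp only: kap prod.distrib prod_dividef orbit_monomial_def)
  show ?thesis
  proof (cases "\<eta> \<in> W ` {..<6}")
    case False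
    have "char_mult \<eta> (W j) \<noteq> triv_char" for j
    proof
      assume "char_mult \<eta> (W j) = triv_char"
      then have "W j = char_cnj \<eta>" using eta by (simp add: char_mult_eq_triv_iff)
      then have "\<eta> = W ((5 * j) mod 6)" by (metis char_cnj_cnj cnj_W)
      moreover have "W ((5 * j) mod 6) \<in> W ` {..<6}" by (rule imageI) simp
      ultimately have "\<eta> \<in> W ` {..<6}"
        by (rule ssubst[where P="\<lambda>\<chi>. \<chi> \<in> W ` {..<6}"])
      with False show False by contradiction
    qed
    moreover have "(\<Sum>i<6. if \<eta> = W i then orbit_monomial (\<lambda>j. gauss_W0 ((i + j) mod 6)) m else 0) = 0"
      using False by (intro sum.neutral) auto
    ultimately show ?thesis unfolding prod_kap by simp
  next
    case True
    then obtain i where i: "i < 6" "\<eta> = W i" by auto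
    \<comment> \<open>The one index whose twist of \<eta> is trivial; the outer mod covers i =
      0.\<close>
    define j0 where "j0 = (6 - i) mod 6"
    have j0: "j0 < 6" by (simp add: j0_def)
    have triv_iff: "(i + j) mod 6 = 0 \<longleftrightarrow> j = j0" if "j < 6" for j
    proof -
      have "(i + j) mod 6 = (if i + j < 6 then i + j else i + j - 6)"
        using that i(1) by (simp add: mod_if)
      moreover have "j0 = (if i = 0 then 0 else 6 - i)"
        using i(1) by (simp add: j0_def)
      ultimately show ?thesis using that i(1) by (auto split: if_splits)
    qed
    let ?M = "orbit_monomial (gauss_W \<eta>) m"
    have G: "gauss_W \<eta> j = gauss (W ((i + j) mod 6))" for j
      by (simp only: gauss_W_def i(2) W_mult)
    have "(\<Prod>j<6. gauss_W \<eta> j) = (\<Prod>j<6. gauss_W triv_char j)"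
      unfolding G using prod_cyclic_shift[OF i(1), of "\<lambda>j. gauss (W j)"] by (simp add: gauss_W_def)
    also have "\<dots> = - dwork_const"
    proof -
      have "(6::'a) = 2 * 3" by simp
      then have "(6::'a) \<noteq> 0" using two_nonzero three_nonzero by (metis mult_eq_0_iff)
      then have "triv_char ((6::'a) ^ 6) = 1"
        unfolding triv_char_def using power_not_zero[of "6::'a" 6] by (simp only: if_False) simp
      moreover have "char_pow triv_char 6 = (triv_char :: 'a \<Rightarrow> complex)"
        by (simp add: char_pow_def triv_char_def fun_eq_iff)
      ultimately show ?thesis
        using gauss_six[of triv_char] unfolding gauss_W_def by (simp only: mult_char_triv gauss_triv) simp
    qed
    finally have prodG: "(\<Prod>j<6. gauss_W \<eta> j) = - dwork_const" .
    have "(\<Prod>j<6. if char_mult \<eta> (W j) = triv_char \<and> m ! j = 0 then 1 / ?q else 1) =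
        (\<Prod>j<6. if j = j0 then (if m ! j0 = 0 then 1 / ?q else 1) else 1)"
      by (intro prod.cong refl) (auto simp: i(2) W_mult W_eq_triv_iff triv_iff simp del: W_mod)
    also have "\<dots> = (if m ! j0 = 0 then 1 / ?q else 1)" using j0 by simp
    finally have P1: "(\<Prod>j<6. if char_mult \<eta> (W j) = triv_char \<and> m ! j = 0 then 1 / ?q else 1) =
        (if m ! j0 = 0 then 1 / ?q else 1)" .
    have "orbit_monomial (\<lambda>j. gauss_W0 ((i + j) mod 6)) m =
        (\<Prod>j<6. gauss_W \<eta> j ^ (m ! j) * (if j = j0 then (if m ! j0 = 0 then 1 else 0) else 1))"
      unfolding orbit_monomial_def
      by (intro prod.cong refl) (auto simp: gauss_W0_def triv_iff G simp del: W_mod)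
    also have "\<dots> = ?M * (if m ! j0 = 0 then 1 else 0)"
      using j0 by (simp add: prod.distrib orbit_monomial_def)
    finally have P2: "orbit_monomial (\<lambda>j. gauss_W0 ((i + j) mod 6)) m = ?M * (if m ! j0 = 0 then 1 else 0)" .
    have "(\<Sum>k<6. if \<eta> = W k then orbit_monomial (\<lambda>j. gauss_W0 ((k + j) mod 6)) m else 0) =
        (\<Sum>k<6. if k = i then orbit_monomial (\<lambda>j. gauss_W0 ((i + j) mod 6)) m else 0)"
      using i by (intro sum.cong refl) (auto simp: W_eq_iff)
    also have "\<dots> = ?M * (if m ! j0 = 0 then 1 else 0)" using i(1) by (simp add: P2)
    finally show ?thesis
      unfolding prod_kap P1 prodG using card_nonzero by (simp add: field_simps)
  qed
qed

text \<open>A cyclic shift of a monomial amounts to twisting \<eta>, which does not change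
  \<eta>(lam)^6; so the six shifts agree and cancel the 1/6. The corrections from
  \<open>prod_kappa\<close> are exactly the diagonal part.\<close>

lemma affine_count:
  "of_nat (card {xs :: 'a list. length xs = 6 \<and> sum_list (map (\<lambda>x. x ^ 6) xs) = 6 * lam * prod_list xs}) =
    of_nat CARD('a) ^ 5 + (\<Sum>(w, m)\<leftarrow>dwork_orbits. of_nat w * (dwork_const * orbit_sum lam m))"
  if lam: "lam \<noteq> 0"
proof -
  let ?q = "complex_of_nat CARD('a)"
  let ?A = "\<lambda>m. \<Sum>i<6. orbit_monomial (\<lambda>j. gauss_W0 ((i + j) mod 6)) m"
  let ?B = "\<lambda>m. \<Sum>\<eta> | mult_char \<eta>. \<eta> lam ^ 6 * (dwork_const * orbit_monomial (gauss_W \<eta>) m / (\<Prod>j<6. gauss_W \<eta> j))"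
  have orbit: "dwork_const * orbit_sum lam m = ?B m + (?q - 1) / ?q * ?A m" for m
  proof -
    have lam_W: "W i lam ^ 6 = 1" for i
      using lam by (rule W_power_6)
    have "dwork_const * orbit_sum lam m =
        (\<Sum>\<eta> | mult_char \<eta>. \<eta> lam ^ 6 * (dwork_const * (\<Prod>j<6. kappa (m ! j) (char_mult \<eta> (W j)))))"
      by (simp add: orbit_sum_def sum_distrib_left mult_ac)
    also have "\<dots> = ?B m + (\<Sum>\<eta> | mult_char \<eta>. \<Sum>i<6.
        if \<eta> = W i then (?q - 1) / ?q * orbit_monomial (\<lambda>j. gauss_W0 ((i + j) mod 6)) m else 0)"
      unfolding sum.distrib[symmetric]
    proof (intro sum.cong refl)
      fix \<eta> assume "\<eta> \<in> {\<eta> :: 'a \<Rightarrow> complex. mult_char \<eta>}"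
      then have "mult_char \<eta>" by simp
      have "\<eta> lam ^ 6 * ((?q - 1) / ?q * (\<Sum>i<6. if \<eta> = W i then orbit_monomial (\<lambda>j. gauss_W0 ((i + j) mod 6)) m else 0)) =
          (\<Sum>i<6. if \<eta> = W i then (?q - 1) / ?q * orbit_monomial (\<lambda>j. gauss_W0 ((i + j) mod 6)) m else 0)"
        unfolding sum_distrib_left by (intro sum.cong refl) (simp add: lam_W)
      then show "\<eta> lam ^ 6 * (dwork_const * (\<Prod>j<6. kappa (m ! j) (char_mult \<eta> (W j)))) =
          \<eta> lam ^ 6 * (dwork_const * orbit_monomial (gauss_W \<eta>) m / (\<Prod>j<6. gauss_W \<eta> j)) +
          (\<Sum>i<6. if \<eta> = W i then (?q - 1) / ?q * orbit_monomial (\<lambda>j. gauss_W0 ((i + j) mod 6)) m else 0)"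
        unfolding prod_kappa[OF \<open>mult_char \<eta>\<close>] by (simp only: distrib_left)
    qed
    also have "(\<Sum>\<eta> | mult_char \<eta>. \<Sum>i<6.
        if \<eta> = W i then (?q - 1) / ?q * orbit_monomial (\<lambda>j. gauss_W0 ((i + j) mod 6)) m else 0) = (?q - 1) / ?q * ?A m"
      by (subst sum.swap) (simp add: finite_mult_chars sum_distrib_left sum_divide_distrib)
    finally show ?thesis .
  qed
  have B: "(\<Sum>\<eta> | mult_char \<eta>. \<eta> (6 * lam) ^ 6 / gauss (char_pow \<eta> 6) *
      orbit_monomial (\<lambda>j. gauss_W \<eta> ((i + j) mod 6)) m) = ?B m" if "i < 6" for i m
  proof -
    have "(\<Sum>\<eta> | mult_char \<eta>. \<eta> (6 * lam) ^ 6 / gauss (char_pow \<eta> 6) *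
      orbit_monomial (\<lambda>j. gauss_W \<eta> ((i + j) mod 6)) m) =
      (\<Sum>\<eta> | mult_char \<eta>. char_mult \<eta> (W i) lam ^ 6 * (dwork_const *
        orbit_monomial (gauss_W (char_mult \<eta> (W i))) m / (\<Prod>j<6. gauss_W (char_mult \<eta> (W i)) j)))"
    proof (intro sum.cong refl)
      fix \<eta> assume "\<eta> \<in> {\<eta> :: 'a \<Rightarrow> complex. mult_char \<eta>}"
      then have eta: "mult_char \<eta>" by simp
      have "W i lam ^ 6 = 1"
        using lam by (rule W_power_6)
      then have 1: "char_mult \<eta> (W i) lam ^ 6 = \<eta> lam ^ 6"
        by (simp add: char_mult_def power_mult_distrib)
      have "\<eta> (6 * lam) ^ 6 / gauss (char_pow \<eta> 6) = \<eta> lam ^ 6 * (\<eta> 6 ^ 6 / gauss (char_pow \<eta> 6))"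
        using eta by (simp add: mult_char_mult power_mult_distrib)
      then show "\<eta> (6 * lam) ^ 6 / gauss (char_pow \<eta> 6) * orbit_monomial (\<lambda>j. gauss_W \<eta> ((i + j) mod 6)) m =
        char_mult \<eta> (W i) lam ^ 6 * (dwork_const *
        orbit_monomial (gauss_W (char_mult \<eta> (W i))) m / (\<Prod>j<6. gauss_W (char_mult \<eta> (W i)) j))"
        unfolding 1 gauss_W_shift[abs_def] prod_cyclic_shift[OF that] prod_gauss_W_eq[OF eta] by simp
    qed
    also have "\<dots> = ?B m"
      by (rule sum_mult_char_shift[OF mult_char_W])
    finally show ?thesis .
  qed
  have "(\<Sum>\<eta> | mult_char \<eta>. \<eta> (6 * lam) ^ 6 / gauss (char_pow \<eta> 6) * orbit_polynomial (gauss_W \<eta>)) =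
      6 * (\<Sum>(w, m)\<leftarrow>dwork_orbits. of_nat w * ?B m)"
  proof -
    have "(\<Sum>\<eta> | mult_char \<eta>. f \<eta> * (\<Sum>(w, m)\<leftarrow>xs. of_nat w * (\<Sum>i<6. h \<eta> i m))) =
        (\<Sum>(w, m)\<leftarrow>xs. of_nat w * (\<Sum>i<6. \<Sum>\<eta> | mult_char \<eta>. f \<eta> * h \<eta> i m))"
      for f :: "('a \<Rightarrow> complex) \<Rightarrow> complex" and h :: "('a \<Rightarrow> complex) \<Rightarrow> nat \<Rightarrow> nat list \<Rightarrow> complex" and xs
    proof (induction xs)
      case (Cons x xs)
      obtain w m where x: "x = (w, m)" by (cases x)
      have "(\<Sum>\<eta> | mult_char \<eta>. f \<eta> * (of_nat w * (\<Sum>i<6. h \<eta> i m))) =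
          of_nat w * (\<Sum>i<6. \<Sum>\<eta> | mult_char \<eta>. f \<eta> * h \<eta> i m)"
        by (subst sum.swap) (simp add: sum_distrib_left mult_ac)
      then show ?case by (simp add: x distrib_left sum.distrib Cons)
    qed simp
    then have "(\<Sum>\<eta> | mult_char \<eta>. \<eta> (6 * lam) ^ 6 / gauss (char_pow \<eta> 6) * orbit_polynomial (gauss_W \<eta>)) =
        (\<Sum>(w, m)\<leftarrow>dwork_orbits. of_nat w * (\<Sum>i<6. \<Sum>\<eta> | mult_char \<eta>. \<eta> (6 * lam) ^ 6 / gauss (char_pow \<eta> 6) *
          orbit_monomial (\<lambda>j. gauss_W \<eta> ((i + j) mod 6)) m))"
      unfolding orbit_polynomial_def .
    also have "\<dots> = (\<Sum>(w, m)\<leftarrow>dwork_orbits. 6 * (of_nat w * ?B m))"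
    proof -
      have "(\<Sum>i<6. \<Sum>\<eta> | mult_char \<eta>. \<eta> (6 * lam) ^ 6 / gauss (char_pow \<eta> 6) *
          orbit_monomial (\<lambda>j. gauss_W \<eta> ((i + j) mod 6)) m) = 6 * ?B m" for m
      proof -
        have "(\<Sum>i<6. \<Sum>\<eta> | mult_char \<eta>. \<eta> (6 * lam) ^ 6 / gauss (char_pow \<eta> 6) *
          orbit_monomial (\<lambda>j. gauss_W \<eta> ((i + j) mod 6)) m) = (\<Sum>i<6::nat. ?B m)"
          by (rule sum.cong[OF refl]) (rule B, simp)
        then show ?thesis by (simp only: sum_constant card_lessThan of_nat_numeral)
      qed
      then show ?thesis by (simp only: mult.left_commute[of 6])
    qed
    finally show ?thesis by (simp add: case_prod_unfold flip: sum_list_const_mult)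
  qed
  then have "of_nat (card {xs :: 'a list. length xs = 6 \<and> sum_list (map (\<lambda>x. x ^ 6) xs) = 6 * lam * prod_list xs}) =
     ?q ^ 5 + ((\<Sum>(w, m)\<leftarrow>dwork_orbits. of_nat w * ?B m) + (?q - 1) / ?q * (\<Sum>(w, m)\<leftarrow>dwork_orbits. of_nat w * ?A m))"
    unfolding affine_count_expansion by (simp add: orbit_polynomial_def)
  also have "(\<Sum>(w, m)\<leftarrow>dwork_orbits. of_nat w * ?B m) + (?q - 1) / ?q * (\<Sum>(w, m)\<leftarrow>dwork_orbits. of_nat w * ?A m) =
     (\<Sum>(w, m)\<leftarrow>dwork_orbits. of_nat w * (dwork_const * orbit_sum lam m))"
    unfolding orbit by (simp add: case_prod_unfold distrib_left sum_list_addf mult_ac flip: sum_list_const_mult)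
  finally show ?thesis .
qed

end

subsection \<open>Greene's hypergeometric functions\<close>

text \<open>The binomial theorem over a finite field: after exchanging sums, orthogonality leaves
  the single point y = 1/(1-w).\<close>

lemma sum_nbinom:
  fixes A :: "'a::{finite,field} \<Rightarrow> complex"
  assumes A: "mult_char A" and w: "w \<noteq> 0"
  shows "(\<Sum>\<chi> | mult_char \<chi>. nbinom (char_mult A \<chi>) \<chi> * \<chi> w) =
    (of_nat CARD('a) - 1) / of_nat CARD('a) * char_cnj A (1 - w)"
proof -
  have "(\<Sum>\<chi> | mult_char \<chi>. nbinom (char_mult A \<chi>) \<chi> * \<chi> w) =
      (\<Sum>\<chi> | mult_char \<chi>. \<Sum>y\<in>UNIV. A y / of_nat CARD('a) * \<chi> (- (y * w / (1 - y))))"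
  proof (intro sum.cong refl)
    fix \<chi> assume "\<chi> \<in> {\<chi> :: 'a \<Rightarrow> complex. mult_char \<chi>}"
    then have chi: "mult_char \<chi>" by simp
    have "\<chi> (- (y * w / (1 - y))) = \<chi> (-1) * \<chi> y * \<chi> w * cnj (\<chi> (1 - y))" for y
      unfolding mult_char_minus[OF chi, of "y * w / (1 - y)"] using chi
      by (simp add: mult_char_mult mult_char_inverse cnj_mult_char divide_inverse)
    then show "nbinom (char_mult A \<chi>) \<chi> * \<chi> w =
        (\<Sum>y\<in>UNIV. A y / of_nat CARD('a) * \<chi> (- (y * w / (1 - y))))"
      by (simp add: nbinom_def jacobi_2 char_mult_def char_cnj_def sum_distrib_left sum_distrib_right mult_ac)
  qed
  also have "\<dots> = (\<Sum>y\<in>UNIV. A y / of_nat CARD('a) * (\<Sum>\<chi> | mult_char \<chi>. \<chi> (- (y * w / (1 - y)))))"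
    by (subst sum.swap) (simp add: sum_distrib_left)
  also have "\<dots> = (\<Sum>y\<in>UNIV. if y = 1 / (1 - w)
      then (of_nat CARD('a) - 1) / of_nat CARD('a) * A (1 / (1 - w)) else 0)"
  proof (intro sum.cong refl)
    fix y
    \<comment> \<open>Division by zero is harmless: at y = 1 the quotient is 0, hence not -1, and at
      w = 1 the point 1/(1-w) becomes 0, where \<open>A\<close> vanishes.\<close>
    have "- (y * w / (1 - y)) = 1 \<longleftrightarrow> w \<noteq> 1 \<and> y = 1 / (1 - w)"
    proof (cases "y = 1")
      case False
      have "- (y * w / (1 - y)) = 1 \<longleftrightarrow> y * (1 - w) = 1"
        using False by (simp add: field_simps)
      also have "\<dots> \<longleftrightarrow> w \<noteq> 1 \<and> y = 1 / (1 - w)"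
        by (cases "w = 1") (simp_all add: nonzero_eq_divide_eq)
      finally show ?thesis .
    qed (use w in \<open>auto simp: field_simps\<close>)
    then show "A y / of_nat CARD('a) * (\<Sum>\<chi> | mult_char \<chi>. \<chi> (- (y * w / (1 - y)))) =
      (if y = 1 / (1 - w) then (of_nat CARD('a) - 1) / of_nat CARD('a) * A (1 / (1 - w)) else 0)"
      using A by (auto simp: sum_over_mult_chars)
  qed
  also have "\<dots> = (of_nat CARD('a) - 1) / of_nat CARD('a) * char_cnj A (1 - w)"
    using A by (simp add: mult_char_inverse char_cnj_def cnj_mult_char divide_inverse)
  finally show ?thesis .
qed

text \<open>The involution x -> x/(x-1) fixes 0 and exchanges 1 with infinity, hence the characters
  attached to them.\<close>

lemma jacobi_reflect:
  fixes A B :: "'a::{finite,field} \<Rightarrow> complex"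
  assumes A: "mult_char A" and B: "mult_char B"
  shows "jacobi [A, B] = A (-1) * jacobi [A, char_cnj (char_mult A B)]"
proof -
  have "jacobi [A, B] = (\<Sum>x\<in>UNIV-{1}. A x * B (1 - x))"
    unfolding jacobi_2 using B by (intro sum.mono_neutral_right) auto
  also have "\<dots> = (\<Sum>y\<in>UNIV-{1}. A (-1) * (A y * char_cnj (char_mult A B) (1 - y)))"
  proof (rule sum.reindex_bij_witness[of _ "\<lambda>y. y / (y - 1)" "\<lambda>y. y / (y - 1)"])
    fix x assume "x \<in> UNIV - {1::'a}"
    then have x: "x \<noteq> 1" by simp
    then have d: "x / (x - 1) - 1 = 1 / (x - 1)" by (simp add: field_simps)
    show "x / (x - 1) / (x / (x - 1) - 1) = x" unfolding d using x by simp
    show "x / (x - 1) \<in> UNIV - {1}" using d x by auto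
    have "1 - x / (x - 1) = inverse (1 - x)" using x by (simp add: field_simps)
    moreover have "A (-1) * A (x / (x - 1)) = A (x / (1 - x))"
    proof -
      have "x / (1 - x) = -1 * (x / (x - 1))" using x by (simp add: field_simps)
      then show ?thesis by (simp only: mult_char_mult[OF A])
    qed
    moreover have "A (x / (1 - x)) * inverse (inverse (A (1 - x))) = A x"
      using A x by (simp add: mult_char_divide)
    ultimately show "A (-1) * (A (x / (x - 1)) * char_cnj (char_mult A B) (1 - x / (x - 1))) = A x * B (1 - x)"
      using A B by (simp add: char_cnj_def char_mult_def cnj_mult_char mult_char_inverse flip: mult.assoc)
  next
    fix x assume "x \<in> UNIV - {1::'a}"
    then have x: "x \<noteq> 1" by simp
    then have d: "x / (x - 1) - 1 = 1 / (x - 1)" by (simp add: field_simps)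
    show "x / (x - 1) / (x / (x - 1) - 1) = x" unfolding d using x by simp
    show "x / (x - 1) \<in> UNIV - {1}" using d x by auto
  qed
  also have "\<dots> = A (-1) * jacobi [A, char_cnj (char_mult A B)]"
    unfolding jacobi_2 sum_distrib_left using A B
    by (intro sum.mono_neutral_left) (auto simp: char_cnj_def char_mult_def)
  finally show ?thesis .
qed

text \<open>Theorem 3.6 of Greene's \<open>Hypergeometric functions over finite fields\<close>.\<close>
lemma greene_F_2_1:
  fixes A0 A1 B1 :: "'a::{finite,field} \<Rightarrow> complex"
  assumes mc: "mult_char A0" "mult_char A1" "mult_char B1" and x: "x \<noteq> 0"
  shows "greene_F [A0, A1] [B1] x = of_nat CARD('a) / (of_nat CARD('a) - 1) *
    (\<Sum>\<chi> | mult_char \<chi>. nbinom (char_mult A0 \<chi>) \<chi> * nbinom (char_mult A1 \<chi>) (char_mult B1 \<chi>) * \<chi> x)"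
proof -
  let ?q = "complex_of_nat CARD('a)"
  let ?s = "char_mult A1 B1 (-1)"
  have q: "?q \<noteq> 0" "?q - 1 \<noteq> 0" using card_field_gt_1[where 'a='a] by auto
  have "greene_F [A0, A1] [B1] x = ?s / ?q *
      (\<Sum>y\<in>UNIV. A1 y * char_mult (char_cnj A1) B1 (1 - y) * char_cnj A0 (1 - x * y))"
    using x by (simp add: greene_F_def triv_char_def)
  also have "(\<Sum>y\<in>UNIV. A1 y * char_mult (char_cnj A1) B1 (1 - y) * char_cnj A0 (1 - x * y)) =
      (\<Sum>y\<in>UNIV. \<Sum>\<chi> | mult_char \<chi>. ?q / (?q - 1) * (nbinom (char_mult A0 \<chi>) \<chi> * \<chi> x) *
        (char_mult A1 \<chi> y * char_mult (char_cnj A1) B1 (1 - y)))"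
  proof (intro sum.cong refl)
    fix y :: 'a
    show "A1 y * char_mult (char_cnj A1) B1 (1 - y) * char_cnj A0 (1 - x * y) =
      (\<Sum>\<chi> | mult_char \<chi>. ?q / (?q - 1) * (nbinom (char_mult A0 \<chi>) \<chi> * \<chi> x) *
        (char_mult A1 \<chi> y * char_mult (char_cnj A1) B1 (1 - y)))"
    \<comment> \<open>\<open>sum_nbinom\<close> needs a nonzero argument x y; at y = 0 both sides
      vanish through \<open>A1\<close>.\<close>
    proof (cases "y = 0")
      case False
      have "char_cnj A0 (1 - x * y) =
          ?q / (?q - 1) * (\<Sum>\<chi> | mult_char \<chi>. nbinom (char_mult A0 \<chi>) \<chi> * \<chi> (x * y))"
        using sum_nbinom[OF mc(1), of "x * y"] x False q by simp
      then show ?thesis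
        by (simp add: sum_distrib_left mult_char_mult char_mult_def[of A1] mult_ac)
    qed (use mc in \<open>simp add: char_mult_def[of A1]\<close>)
  qed
  also have "\<dots> = (\<Sum>\<chi> | mult_char \<chi>. ?q / (?q - 1) * (nbinom (char_mult A0 \<chi>) \<chi> * \<chi> x) *
      jacobi [char_mult A1 \<chi>, char_mult (char_cnj A1) B1])"
    by (subst sum.swap) (simp add: jacobi_2 sum_distrib_left)
  also have "\<dots> = (\<Sum>\<chi> | mult_char \<chi>. ?q * ?s * (?q / (?q - 1) *
      (nbinom (char_mult A0 \<chi>) \<chi> * nbinom (char_mult A1 \<chi>) (char_mult B1 \<chi>) * \<chi> x)))"
  proof (intro sum.cong refl)
    fix \<chi> assume "\<chi> \<in> {\<chi> :: 'a \<Rightarrow> complex. mult_char \<chi>}"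
    then have chi: "mult_char \<chi>" by simp
    have "char_mult (char_mult A1 \<chi>) (char_mult (char_cnj A1) B1) = char_mult B1 \<chi>"
      using mc chi by (metis char_mult_assoc char_mult_commute char_mult_cnj_left_cancel(1) mult_char_char_mult)
    then have "jacobi [char_mult A1 \<chi>, char_mult (char_cnj A1) B1] =
        char_mult A1 \<chi> (-1) * jacobi [char_mult A1 \<chi>, char_cnj (char_mult B1 \<chi>)]"
      using jacobi_reflect[of "char_mult A1 \<chi>" "char_mult (char_cnj A1) B1"] mc chi by simp
    also have "\<dots> = ?q * ?s * nbinom (char_mult A1 \<chi>) (char_mult B1 \<chi>)"
      using mc chi q mult_char_minus_1_cases[of B1] mult_char_minus_1_cases[of \<chi>]
      by (auto simp: nbinom_def char_mult_def)
    finally show "?q / (?q - 1) * (nbinom (char_mult A0 \<chi>) \<chi> * \<chi> x) *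
      jacobi [char_mult A1 \<chi>, char_mult (char_cnj A1) B1] = ?q * ?s * (?q / (?q - 1) *
      (nbinom (char_mult A0 \<chi>) \<chi> * nbinom (char_mult A1 \<chi>) (char_mult B1 \<chi>) * \<chi> x))"
      by simp
  qed
  also have "?s / ?q * \<dots> = ?s * ?s * (\<Sum>\<chi> | mult_char \<chi>. ?q / (?q - 1) *
      (nbinom (char_mult A0 \<chi>) \<chi> * nbinom (char_mult A1 \<chi>) (char_mult B1 \<chi>) * \<chi> x))"
    unfolding sum_distrib_left[of "?q * ?s", symmetric] using q by simp
  also have "?s * ?s = 1" using mc by simp
  finally show ?thesis by (simp only: mult_1_left sum_distrib_left)
qed

text \<open>One series for both branches of the definition; the first factor is made uniform by
  giving it the lower parameter \<open>triv_char\<close>.\<close>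

lemma greene_F_series:
  fixes A :: "'a::{finite,field} \<Rightarrow> complex"
  assumes "mult_char A" "list_all mult_char As" "list_all mult_char Bs"
    and "length As = length Bs" "Bs \<noteq> []" "x \<noteq> 0"
  shows "greene_F (A # As) Bs x = of_nat CARD('a) / (of_nat CARD('a) - 1) *
    (\<Sum>\<chi> | mult_char \<chi>.
      prod_list (map2 (\<lambda>A B. nbinom (char_mult A \<chi>) (char_mult B \<chi>)) (A # As) (triv_char # Bs)) * \<chi> x)"
proof (cases "length Bs = 1")
  case True
  then obtain B A1 where "Bs = [B]" "As = [A1]" using assms(4) by (auto simp: length_Suc_conv)
  then show ?thesis using assms greene_F_2_1[of A A1 B x] by simp
qed (simp add: greene_F_def)

context sextic_characters
begin

text \<open>As A \<noteq> B, the Jacobi sum is a quotient of Gauss sums. \<open>kappa 0\<close> is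
  defined by the conjugate Gauss sum, so the formula holds without exception for \<eta>.\<close>

lemma nbinom_gauss:
  assumes A: "mult_char A" and B: "mult_char B" and eta: "mult_char \<eta>" and ne: "A \<noteq> B"
  shows "nbinom (char_mult A (char_cnj \<eta>)) (char_mult B (char_cnj \<eta>)) =
    A (-1) * B (-1) / gauss (char_mult A (char_cnj B)) *
    (kappa 0 (char_mult \<eta> (char_cnj A)) * gauss (char_mult \<eta> (char_cnj B)))"
proof -
  let ?A = "char_mult A (char_cnj \<eta>)" and ?B = "char_mult \<eta> (char_cnj B)"
  have cnjB: "char_cnj (char_mult B (char_cnj \<eta>)) = ?B" by (simp add: char_cnj_mult char_mult_commute)
  have AB: "char_mult ?A ?B = char_mult A (char_cnj B)"
    using A B eta by (simp add: char_mult_assoc)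
  have "char_mult A (char_cnj B) \<noteq> triv_char"
    using A B ne by (metis char_cnj_cnj char_mult_eq_triv_iff mult_char_char_cnj)
  then have "gauss ?A * gauss ?B = gauss (char_mult A (char_cnj B)) * jacobi [?A, ?B]"
    using gauss_prod_eq_jacobi[of "[?A, ?B]"] A B eta by (simp add: AB)
  then have "jacobi [?A, ?B] = gauss ?A * gauss ?B / gauss (char_mult A (char_cnj B))"
    using A B by (simp add: field_simps)
  moreover have "gauss ?A = of_nat CARD('a) * (char_mult \<eta> (char_cnj A) (-1) * kappa 0 (char_mult \<eta> (char_cnj A)))"
    using A eta mult_char_minus_1_square[of "char_mult \<eta> (char_cnj A)"]
    by (simp add: kappa_def char_cnj_mult char_mult_commute[of A] flip: mult.assoc)
  moreover have "char_mult B (char_cnj \<eta>) (-1) * char_mult \<eta> (char_cnj A) (-1) = A (-1) * B (-1)"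
    using A B eta mult_char_minus_1_cases[of A] mult_char_minus_1_cases[of \<eta>]
    by (auto simp: char_mult_def char_cnj_def)
  ultimately show ?thesis
    unfolding nbinom_def cnjB by (simp flip: mult.assoc)
qed

text \<open>The factors independent of \<eta>; the index \<open>a + 5 * b\<close> stands for a - b
  modulo 6.\<close>

definition greene_const :: "nat list \<Rightarrow> nat list \<Rightarrow> complex" where
  "greene_const as bs = prod_list (map2 (\<lambda>a b. W a (-1) * W b (-1) / gauss (W ((a + 5 * b) mod 6))) as bs)"

text \<open>Substitute the conjugate of \<eta> for \<chi>, which turns \<chi>(1/lam^6) into
  \<eta>(lam)^6. The leading 0 of \<open>bs\<close> is the implicit lower parameter; Greene's
  function receives only the tail.\<close>

lemma greene_F_W:
  assumes as: "as \<noteq> []" "length as = length bs" "hd bs = 0" "length bs \<ge> 2"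
    and ne: "list_all2 (\<lambda>a b. a mod 6 \<noteq> b mod 6) as bs" and lam: "lam \<noteq> 0"
  shows "greene_F (map W as) (map W (tl bs)) (1 / lam ^ 6) =
    of_nat CARD('a) / (of_nat CARD('a) - 1) * greene_const as bs *
    (\<Sum>\<eta> | mult_char \<eta>. \<eta> lam ^ 6 *
      prod_list (map2 (\<lambda>a b. kappa 0 (char_mult \<eta> (W ((5 * a) mod 6))) * gauss (char_mult \<eta> (W ((5 * b) mod 6)))) as bs))"
proof -
  let ?q = "complex_of_nat CARD('a)"
  have bs: "map W bs = triv_char # map W (tl bs)" using as by (cases bs) auto
  have "greene_F (map W as) (map W (tl bs)) (1 / lam ^ 6) = ?q / (?q - 1) * (\<Sum>\<chi> | mult_char \<chi>.
      prod_list (map2 (\<lambda>A B. nbinom (char_mult A \<chi>) (char_mult B \<chi>)) (map W as) (map W bs)) * \<chi> (1 / lam ^ 6))"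
  proof -
    obtain a as' where a: "as = a # as'" using as(1) by (cases as) auto
    have "tl bs \<noteq> []" using as(4) by (cases bs) auto
    then show ?thesis
      using greene_F_series[of "W a" "map W as'" "map W (tl bs)" "1 / lam ^ 6"] as a lam
      unfolding bs by (simp add: list_all_iff)
  qed
  also have "(\<Sum>\<chi> | mult_char \<chi>.
      prod_list (map2 (\<lambda>A B. nbinom (char_mult A \<chi>) (char_mult B \<chi>)) (map W as) (map W bs)) * \<chi> (1 / lam ^ 6)) =
    (\<Sum>\<eta> | mult_char \<eta>.
      prod_list (map2 (\<lambda>A B. nbinom (char_mult A (char_cnj \<eta>)) (char_mult B (char_cnj \<eta>))) (map W as) (map W bs)) *
        char_cnj \<eta> (1 / lam ^ 6))"
    by (rule sum_mult_char_cnj[symmetric])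
  also have "\<dots> = (\<Sum>\<eta> | mult_char \<eta>. greene_const as bs * (\<eta> lam ^ 6 *
      prod_list (map2 (\<lambda>a b. kappa 0 (char_mult \<eta> (W ((5 * a) mod 6))) * gauss (char_mult \<eta> (W ((5 * b) mod 6)))) as bs)))"
  proof (intro sum.cong refl)
    fix \<eta> assume "\<eta> \<in> {\<eta> :: 'a \<Rightarrow> complex. mult_char \<eta>}"
    then have eta: "mult_char \<eta>" by simp
    have "prod_list (map2 (\<lambda>A B. nbinom (char_mult A (char_cnj \<eta>)) (char_mult B (char_cnj \<eta>))) (map W as) (map W bs)) =
        greene_const as bs * prod_list (map2 (\<lambda>a b. kappa 0 (char_mult \<eta> (W ((5 * a) mod 6))) *
          gauss (char_mult \<eta> (W ((5 * b) mod 6)))) as bs)"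
      using ne
    proof (induction rule: list_all2_induct)
      case (Cons a as b bs)
      have "nbinom (char_mult (W a) (char_cnj \<eta>)) (char_mult (W b) (char_cnj \<eta>)) =
          W a (-1) * W b (-1) / gauss (W ((a + 5 * b) mod 6)) *
          (kappa 0 (char_mult \<eta> (W ((5 * a) mod 6))) * gauss (char_mult \<eta> (W ((5 * b) mod 6))))"
        using nbinom_gauss[of "W a" "W b" \<eta>] eta Cons.hyps
        by (simp add: W_eq_iff cnj_W) (simp add: W_mult)
      then show ?case using Cons.IH by (simp add: greene_const_def mult_ac)
    qed (simp add: greene_const_def)
    moreover have "char_cnj \<eta> (1 / lam ^ 6) = \<eta> lam ^ 6"
      using eta by (simp add: char_cnj_def cnj_mult_char mult_char_divide mult_char_power)
    ultimately show "prod_list (map2 (\<lambda>A B. nbinom (char_mult A (char_cnj \<eta>)) (char_mult B (char_cnj \<eta>))) (map W as) (map W bs)) *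
        char_cnj \<eta> (1 / lam ^ 6) = greene_const as bs * (\<eta> lam ^ 6 *
      prod_list (map2 (\<lambda>a b. kappa 0 (char_mult \<eta> (W ((5 * a) mod 6))) * gauss (char_mult \<eta> (W ((5 * b) mod 6)))) as bs))"
      by simp
  qed
  finally show ?thesis by (simp add: sum_distrib_left mult_ac)
qed

lemma kappa_simps [simp]: "kappa (Suc 0) \<chi> = 1" "kappa 2 \<chi> = gauss \<chi>"
  "kappa 3 \<chi> = gauss \<chi> * gauss \<chi>" "kappa 4 \<chi> = gauss \<chi> * (gauss \<chi> * gauss \<chi>)"
  "kappa 6 \<chi> = gauss \<chi> * (gauss \<chi> * (gauss \<chi> * (gauss \<chi> * gauss \<chi>)))"
  by (simp_all add: kappa_def eval_nat_numeral)

text \<open>In the last assumption \<open>k\<close> and \<open>g\<close> abstract \<open>kappa\<close> and \<open>gauss\<close>, so that for concrete lists it is a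
  comparison of monomials.\<close>
lemma greene_F_orbit_sum:
  assumes "as \<noteq> []" "length as = length bs" "hd bs = 0" "length bs \<ge> 2"
    and "list_all2 (\<lambda>a b. a mod 6 \<noteq> b mod 6) as bs" and "lam \<noteq> 0"
    and "\<And>k g. k (Suc 0) = (\<lambda>_. 1) \<Longrightarrow> k 2 = g \<Longrightarrow> k 3 = (\<lambda>j. g j * g j) \<Longrightarrow> k 4 = (\<lambda>j. g j * (g j * g j)) \<Longrightarrow>
      k 6 = (\<lambda>j. g j * (g j * (g j * (g j * g j)))) \<Longrightarrow>
      prod_list (map2 (\<lambda>a b. k 0 ((5 * a) mod 6) * g ((5 * b) mod 6)) as bs) =
      (k (m ! 0) 0 * k (m ! 1) 1 * k (m ! 2) 2 * k (m ! 3) 3 * k (m ! 4) 4 * k (m ! 5) (5::nat) :: complex)"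
  shows "greene_F (map W as) (map W (tl bs)) (1 / lam ^ 6) =
    of_nat CARD('a) / (of_nat CARD('a) - 1) * (greene_const as bs * orbit_sum lam m)"
proof -
  have "prod_list (map2 (\<lambda>a b. kappa 0 (char_mult \<eta> (W ((5 * a) mod 6))) * gauss (char_mult \<eta> (W ((5 * b) mod 6)))) as bs) =
      (\<Prod>j<6. kappa (m ! j) (char_mult \<eta> (W j)))" for \<eta>
    unfolding prod_lessThan_6
    by (rule assms(7)[of "\<lambda>n j. kappa n (char_mult \<eta> (W j))" "\<lambda>j. gauss (char_mult \<eta> (W j))"])
      (simp_all add: fun_eq_iff)
  then show ?thesis
    using greene_F_W[OF assms(1-6)] by (simp only: orbit_sum_def mult.assoc)
qed

context
  fixes lam :: 'a
  assumes lam: "lam \<noteq> 0"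
begin

text \<open>Multiplicities are read off the parameters: an upper \<open>W a\<close> gives
  multiplicity 0 at index -a, a lower \<open>W b\<close> occurring k times (counting the implicit
  \<open>W 0\<close>) gives k + 1 at index -b, and every other index gets 1.\<close>

lemma greene_F_orbits:
  shows
    "greene_F [W 1, W 2, W 3, W 4, W 5] [W 0, W 0, W 0, W 0] (1 / lam ^ 6) =
      of_nat CARD('a) / (of_nat CARD('a) - 1) * (greene_const [1, 2, 3, 4, 5] [0, 0, 0, 0, 0] * orbit_sum lam [6, 0, 0, 0, 0, 0])"
    "greene_F [W 2, W 3, W 4] [W 0, W 0] (1 / lam ^ 6) =
      of_nat CARD('a) / (of_nat CARD('a) - 1) * (greene_const [2, 3, 4] [0, 0, 0] * orbit_sum lam [4, 1, 0, 0, 0, 1])"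
    "greene_F [W 1, W 3, W 5] [W 0, W 0] (1 / lam ^ 6) =
      of_nat CARD('a) / (of_nat CARD('a) - 1) * (greene_const [1, 3, 5] [0, 0, 0] * orbit_sum lam [4, 0, 1, 0, 1, 0])"
    "greene_F [W 1, W 5, W 4, W 2] [W 0, W 0, W 3] (1 / lam ^ 6) =
      of_nat CARD('a) / (of_nat CARD('a) - 1) * (greene_const [1, 5, 4, 2] [0, 0, 0, 3] * orbit_sum lam [4, 0, 0, 2, 0, 0])"
    "greene_F [W 1, W 3, W 4, W 5] [W 0, W 2, W 2] (1 / lam ^ 6) =
      of_nat CARD('a) / (of_nat CARD('a) - 1) * (greene_const [1, 3, 4, 5] [0, 0, 2, 2] * orbit_sum lam [3, 0, 0, 0, 3, 0])"
    "greene_F [W 1, W 4, W 3] [W 0, W 5] (1 / lam ^ 6) =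
      of_nat CARD('a) / (of_nat CARD('a) - 1) * (greene_const [1, 4, 3] [0, 0, 5] * orbit_sum lam [3, 2, 0, 0, 1, 0])"
    "greene_F [W 2, W 5, W 3] [W 0, W 1] (1 / lam ^ 6) =
      of_nat CARD('a) / (of_nat CARD('a) - 1) * (greene_const [2, 5, 3] [0, 0, 1] * orbit_sum lam [3, 0, 1, 0, 0, 2])"
    "greene_F [W 3, W 4, W 5] [W 1, W 2] (1 / lam ^ 6) =
      of_nat CARD('a) / (of_nat CARD('a) - 1) * (greene_const [3, 4, 5] [0, 1, 2] * orbit_sum lam [2, 0, 0, 0, 2, 2])"
    "greene_F [W 1, W 3, W 5] [W 2, W 4] (1 / lam ^ 6) =
      of_nat CARD('a) / (of_nat CARD('a) - 1) * (greene_const [1, 3, 5] [0, 2, 4] * orbit_sum lam [2, 0, 2, 0, 2, 0])"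
    "greene_F [W 1, W 2] [W 0] (1 / lam ^ 6) =
      of_nat CARD('a) / (of_nat CARD('a) - 1) * (greene_const [1, 2] [0, 0] * orbit_sum lam [3, 1, 1, 1, 0, 0])"
    "greene_F [W 4, W 5] [W 0] (1 / lam ^ 6) =
      of_nat CARD('a) / (of_nat CARD('a) - 1) * (greene_const [4, 5] [0, 0] * orbit_sum lam [3, 0, 0, 1, 1, 1])"
    "greene_F [W 2, W 4] [W 3] (1 / lam ^ 6) =
      of_nat CARD('a) / (of_nat CARD('a) - 1) * (greene_const [2, 4] [0, 3] * orbit_sum lam [2, 1, 0, 2, 0, 1])"
    "greene_F [W 2, W 5] [W 4] (1 / lam ^ 6) =
      of_nat CARD('a) / (of_nat CARD('a) - 1) * (greene_const [2, 5] [0, 4] * orbit_sum lam [2, 0, 2, 1, 0, 1])"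
proof -
  show "greene_F [W 1, W 2, W 3, W 4, W 5] [W 0, W 0, W 0, W 0] (1 / lam ^ 6) =
      of_nat CARD('a) / (of_nat CARD('a) - 1) * (greene_const [1, 2, 3, 4, 5] [0, 0, 0, 0, 0] * orbit_sum lam [6, 0, 0, 0, 0, 0])"
    using greene_F_orbit_sum[of "[1, 2, 3, 4, 5]" "[0, 0, 0, 0, 0]" lam "[6, 0, 0, 0, 0, 0]"] lam by (simp del: W_0)
  show "greene_F [W 2, W 3, W 4] [W 0, W 0] (1 / lam ^ 6) =
      of_nat CARD('a) / (of_nat CARD('a) - 1) * (greene_const [2, 3, 4] [0, 0, 0] * orbit_sum lam [4, 1, 0, 0, 0, 1])"
    using greene_F_orbit_sum[of "[2, 3, 4]" "[0, 0, 0]" lam "[4, 1, 0, 0, 0, 1]"] lam by (simp del: W_0)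
  show "greene_F [W 1, W 3, W 5] [W 0, W 0] (1 / lam ^ 6) =
      of_nat CARD('a) / (of_nat CARD('a) - 1) * (greene_const [1, 3, 5] [0, 0, 0] * orbit_sum lam [4, 0, 1, 0, 1, 0])"
    using greene_F_orbit_sum[of "[1, 3, 5]" "[0, 0, 0]" lam "[4, 0, 1, 0, 1, 0]"] lam by (simp del: W_0)
  show "greene_F [W 1, W 5, W 4, W 2] [W 0, W 0, W 3] (1 / lam ^ 6) =
      of_nat CARD('a) / (of_nat CARD('a) - 1) * (greene_const [1, 5, 4, 2] [0, 0, 0, 3] * orbit_sum lam [4, 0, 0, 2, 0, 0])"
    using greene_F_orbit_sum[of "[1, 5, 4, 2]" "[0, 0, 0, 3]" lam "[4, 0, 0, 2, 0, 0]"] lam by (simp del: W_0)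
  show "greene_F [W 1, W 3, W 4, W 5] [W 0, W 2, W 2] (1 / lam ^ 6) =
      of_nat CARD('a) / (of_nat CARD('a) - 1) * (greene_const [1, 3, 4, 5] [0, 0, 2, 2] * orbit_sum lam [3, 0, 0, 0, 3, 0])"
    using greene_F_orbit_sum[of "[1, 3, 4, 5]" "[0, 0, 2, 2]" lam "[3, 0, 0, 0, 3, 0]"] lam by (simp del: W_0)
  show "greene_F [W 1, W 4, W 3] [W 0, W 5] (1 / lam ^ 6) =
      of_nat CARD('a) / (of_nat CARD('a) - 1) * (greene_const [1, 4, 3] [0, 0, 5] * orbit_sum lam [3, 2, 0, 0, 1, 0])"
    using greene_F_orbit_sum[of "[1, 4, 3]" "[0, 0, 5]" lam "[3, 2, 0, 0, 1, 0]"] lam by (simp del: W_0)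
  show "greene_F [W 2, W 5, W 3] [W 0, W 1] (1 / lam ^ 6) =
      of_nat CARD('a) / (of_nat CARD('a) - 1) * (greene_const [2, 5, 3] [0, 0, 1] * orbit_sum lam [3, 0, 1, 0, 0, 2])"
    using greene_F_orbit_sum[of "[2, 5, 3]" "[0, 0, 1]" lam "[3, 0, 1, 0, 0, 2]"] lam by (simp del: W_0)
  show "greene_F [W 3, W 4, W 5] [W 1, W 2] (1 / lam ^ 6) =
      of_nat CARD('a) / (of_nat CARD('a) - 1) * (greene_const [3, 4, 5] [0, 1, 2] * orbit_sum lam [2, 0, 0, 0, 2, 2])"
    using greene_F_orbit_sum[of "[3, 4, 5]" "[0, 1, 2]" lam "[2, 0, 0, 0, 2, 2]"] lam by (simp del: W_0)
  show "greene_F [W 1, W 3, W 5] [W 2, W 4] (1 / lam ^ 6) =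
      of_nat CARD('a) / (of_nat CARD('a) - 1) * (greene_const [1, 3, 5] [0, 2, 4] * orbit_sum lam [2, 0, 2, 0, 2, 0])"
    using greene_F_orbit_sum[of "[1, 3, 5]" "[0, 2, 4]" lam "[2, 0, 2, 0, 2, 0]"] lam by (simp del: W_0)
  show "greene_F [W 1, W 2] [W 0] (1 / lam ^ 6) =
      of_nat CARD('a) / (of_nat CARD('a) - 1) * (greene_const [1, 2] [0, 0] * orbit_sum lam [3, 1, 1, 1, 0, 0])"
    using greene_F_orbit_sum[of "[1, 2]" "[0, 0]" lam "[3, 1, 1, 1, 0, 0]"] lam by (simp del: W_0)
  show "greene_F [W 4, W 5] [W 0] (1 / lam ^ 6) =
      of_nat CARD('a) / (of_nat CARD('a) - 1) * (greene_const [4, 5] [0, 0] * orbit_sum lam [3, 0, 0, 1, 1, 1])"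
    using greene_F_orbit_sum[of "[4, 5]" "[0, 0]" lam "[3, 0, 0, 1, 1, 1]"] lam by (simp del: W_0)
  show "greene_F [W 2, W 4] [W 3] (1 / lam ^ 6) =
      of_nat CARD('a) / (of_nat CARD('a) - 1) * (greene_const [2, 4] [0, 3] * orbit_sum lam [2, 1, 0, 2, 0, 1])"
    using greene_F_orbit_sum[of "[2, 4]" "[0, 3]" lam "[2, 1, 0, 2, 0, 1]"] lam by (simp del: W_0)
  show "greene_F [W 2, W 5] [W 4] (1 / lam ^ 6) =
      of_nat CARD('a) / (of_nat CARD('a) - 1) * (greene_const [2, 5] [0, 4] * orbit_sum lam [2, 0, 2, 1, 0, 1])"
    using greene_F_orbit_sum[of "[2, 5]" "[0, 4]" lam "[2, 0, 2, 1, 0, 1]"] lam by (simp del: W_0)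
qed

end

end

section \<open>Normalizing constants and the projective count\<close>

context sextic_characters
begin

lemma jacobi_W:
  "jacobi [W 3, W 4, W 5] = - gauss (W 3) * gauss (W 4) * gauss (W 5) / of_nat CARD('a)"
  "jacobi [W 1, W 2, W 3] = - gauss (W 1) * gauss (W 2) * gauss (W 3) / of_nat CARD('a)"
  "jacobi [W 1, W 1, W 4] = - gauss (W 1) * gauss (W 1) * gauss (W 4) / of_nat CARD('a)"
  "jacobi [W 2, W 2, W 2] = - gauss (W 2) * gauss (W 2) * gauss (W 2) / of_nat CARD('a)"
  "jacobi [W 1, W 1] = gauss (W 1) * gauss (W 1) / gauss (W 2)"
proof -
  have triv: "char_prod [W i, W j, W k] = triv_char \<longleftrightarrow> (i + j + k) mod 6 = 0" for i j k
  proof -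
    have "char_prod [W i, W j, W k] = W ((i + (j + k) mod 6) mod 6)"
      by (simp only: char_prod_simps char_mult_triv(2) mult_char_W W_mult)
    then show ?thesis by (simp only: W_eq_triv_iff) (simp add: mod_add_right_eq add.assoc)
  qed
  show "jacobi [W 3, W 4, W 5] = - gauss (W 3) * gauss (W 4) * gauss (W 5) / of_nat CARD('a)"
    using jacobi_eq_gauss_prod[of "[W 3, W 4, W 5]" "W 3"] unfolding triv
    by (simp add: W_eq_triv_iff mult.assoc)
  show "jacobi [W 1, W 2, W 3] = - gauss (W 1) * gauss (W 2) * gauss (W 3) / of_nat CARD('a)"
    using jacobi_eq_gauss_prod[of "[W 1, W 2, W 3]" "W 1"] unfolding triv
    by (simp add: W_eq_triv_iff mult.assoc)
  show "jacobi [W 1, W 1, W 4] = - gauss (W 1) * gauss (W 1) * gauss (W 4) / of_nat CARD('a)"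
    using jacobi_eq_gauss_prod[of "[W 1, W 1, W 4]" "W 1"] unfolding triv
    by (simp add: W_eq_triv_iff mult.assoc)
  show "jacobi [W 2, W 2, W 2] = - gauss (W 2) * gauss (W 2) * gauss (W 2) / of_nat CARD('a)"
    using jacobi_eq_gauss_prod[of "[W 2, W 2, W 2]" "W 2"] unfolding triv
    by (simp add: W_eq_triv_iff mult.assoc)
  have "char_prod [W 1, W 1] = W 2"
    by (simp only: char_prod_simps char_mult_triv(2) mult_char_W W_mult) (simp add: numeral_2_eq_2)
  then have "gauss (W 1) * gauss (W 1) = gauss (W 2) * jacobi [W 1, W 1]"
    using gauss_prod_eq_jacobi[of "[W 1, W 1]"] by (simp add: W_eq_triv_iff)
  then show "jacobi [W 1, W 1] = gauss (W 1) * gauss (W 1) / gauss (W 2)"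
    by (simp add: field_simps)
qed

text \<open>The normalizations below only use \<open>g(\<chi>) g(\<chi>\<inverse>) = \<chi>(-1) q\<close>, which eliminates
  \<open>g(\<omega>\<^sup>4\<^sup>t)\<close>, \<open>g(\<omega>\<^sup>5\<^sup>t)\<close> and \<open>q = \<omega>\<^sub>2(-1) g(\<omega>\<^sub>2)\<^sup>2\<close>.\<close>
lemma greene_const_dwork:
  defines "q \<equiv> complex_of_nat CARD('a)"
  shows
    "q ^ 4 * (q * greene_const [1, 2, 3, 4, 5] [0, 0, 0, 0, 0]) = 1 * dwork_const"
    "30 * q ^ 3 * W 1 (-1) * (q * greene_const [2, 3, 4] [0, 0, 0]) = 30 * dwork_const"
    "30 * q ^ 3 * (q * greene_const [1, 3, 5] [0, 0, 0]) = 30 * dwork_const"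
    "15 * q ^ 3 * W 1 (-1) * jacobi [W 3, W 4, W 5] * (q * greene_const [1, 5, 4, 2] [0, 0, 0, 3]) = - 15 * dwork_const"
    "20 * q ^ 3 * W 1 (-1) * jacobi [W 1, W 2, W 3] * (q * greene_const [1, 3, 4, 5] [0, 0, 2, 2]) = - 20 * dwork_const"
    "60 * q ^ 2 * W 1 (-1) * jacobi [W 1, W 1, W 4] * jacobi [W 3, W 4, W 5] *
       (q * greene_const [1, 4, 3] [0, 0, 5]) = 60 * dwork_const"
    "60 * q ^ 2 * jacobi [W 2, W 2, W 2] * jacobi [W 3, W 4, W 5] *
       (q * greene_const [2, 5, 3] [0, 0, 1]) = 60 * dwork_const"
    "90 * q ^ 3 * (q * greene_const [3, 4, 5] [0, 1, 2]) = 90 * dwork_const"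
    "30 * q ^ 2 * jacobi [W 1, W 1] * jacobi [W 1, W 2, W 3] *
       (q * greene_const [1, 3, 5] [0, 2, 4]) = - 30 * dwork_const"
    "120 * q ^ 2 * jacobi [W 1, W 2, W 3] * (q * greene_const [1, 2] [0, 0]) = - 120 * dwork_const"
    "120 * q ^ 2 * jacobi [W 3, W 4, W 5] * (q * greene_const [4, 5] [0, 0]) = - 120 * dwork_const"
    "180 * q ^ 2 * jacobi [W 1, W 2, W 3] * (q * greene_const [2, 4] [0, 3]) = - 180 * dwork_const"
    "180 * q ^ 2 * jacobi [W 1, W 2, W 3] * (q * greene_const [2, 5] [0, 4]) = - 180 * dwork_const"
proof -
  define s where "s = W 1 (-1)"
  define a b d where "a = gauss (W 1)" and "b = gauss (W 2)" and "d = gauss (W 3)"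
  have nz: "s \<noteq> 0" "a \<noteq> 0" "b \<noteq> 0" "d \<noteq> 0" "q \<noteq> 0" by (simp_all add: s_def a_def b_def d_def q_def)
  have s: "s = 1 \<or> s = -1" unfolding s_def by (rule mult_char_minus_1_cases) simp
  have W_s: "W j (-1) = s ^ j" for j unfolding s_def by (rule W_apply) simp
  have s2: "s ^ 2 = 1" "s ^ 3 = s" using s by auto
  have q: "q = s * d * d"
    using gauss_W3_square s s2 by (auto simp: q_def d_def W_s)
  have "b * gauss (W 4) = q"
    using gauss_cnj[of "W 2"] s by (auto simp: b_def q_def cnj_W W_eq_triv_iff W_s)
  then have g4: "gauss (W 4) = s * d * d / b" using nz by (simp add: q field_simps)
  have "a * gauss (W 5) = s * q"
    using gauss_cnj[of "W 1"] by (simp add: a_def q_def cnj_W W_eq_triv_iff W_s)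
  then have g5: "gauss (W 5) = d * d / a" using nz s by (auto simp: q field_simps)
  have const: "dwork_const = q ^ 2 * s * d"
    by (simp add: dwork_const_def q_def d_def W_s s2)
  have s_s: "s * s = 1" "s * (s * x) = x" for x using s by auto
  have triv: "triv_char (-1 :: 'a) = (1 :: complex)" by (simp add: triv_char_def)
  have b': "gauss (W (Suc (Suc 0))) = b" by (simp add: b_def numeral_2_eq_2)
  note defs = greene_const_def const jacobi_W a_def[symmetric] b_def[symmetric] d_def[symmetric]
    q_def[symmetric] b' W_s g4 g5 triv
  show
    "q ^ 4 * (q * greene_const [1, 2, 3, 4, 5] [0, 0, 0, 0, 0]) = 1 * dwork_const"
    "30 * q ^ 3 * W 1 (-1) * (q * greene_const [2, 3, 4] [0, 0, 0]) = 30 * dwork_const"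
    "30 * q ^ 3 * (q * greene_const [1, 3, 5] [0, 0, 0]) = 30 * dwork_const"
    "15 * q ^ 3 * W 1 (-1) * jacobi [W 3, W 4, W 5] * (q * greene_const [1, 5, 4, 2] [0, 0, 0, 3]) = - 15 * dwork_const"
    "20 * q ^ 3 * W 1 (-1) * jacobi [W 1, W 2, W 3] * (q * greene_const [1, 3, 4, 5] [0, 0, 2, 2]) = - 20 * dwork_const"
    "60 * q ^ 2 * W 1 (-1) * jacobi [W 1, W 1, W 4] * jacobi [W 3, W 4, W 5] *
       (q * greene_const [1, 4, 3] [0, 0, 5]) = 60 * dwork_const"
    "60 * q ^ 2 * jacobi [W 2, W 2, W 2] * jacobi [W 3, W 4, W 5] *
       (q * greene_const [2, 5, 3] [0, 0, 1]) = 60 * dwork_const"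
    "90 * q ^ 3 * (q * greene_const [3, 4, 5] [0, 1, 2]) = 90 * dwork_const"
    "30 * q ^ 2 * jacobi [W 1, W 1] * jacobi [W 1, W 2, W 3] *
       (q * greene_const [1, 3, 5] [0, 2, 4]) = - 30 * dwork_const"
    "120 * q ^ 2 * jacobi [W 1, W 2, W 3] * (q * greene_const [1, 2] [0, 0]) = - 120 * dwork_const"
    "120 * q ^ 2 * jacobi [W 3, W 4, W 5] * (q * greene_const [4, 5] [0, 0]) = - 120 * dwork_const"
    "180 * q ^ 2 * jacobi [W 1, W 2, W 3] * (q * greene_const [2, 4] [0, 3]) = - 180 * dwork_const"
    "180 * q ^ 2 * jacobi [W 1, W 2, W 3] * (q * greene_const [2, 5] [0, 4]) = - 180 * dwork_const"
    by (simp_all add: defs q del: W_mod One_nat_def) (simp_all add: nz field_simps eval_nat_numeral s_s)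
qed

text \<open>The degenerate case \<open>\<^sub>1F\<^sub>0\<close>.\<close>
lemma orbit_sum_1F0:
  assumes lam: "lam \<noteq> 0"
  shows "dwork_const * orbit_sum lam [2,1,1,0,1,1] =
    (of_nat CARD('a) - 1) * of_nat CARD('a) ^ 2 * W 3 (1 - lam ^ 6)"
proof -
  let ?q = "complex_of_nat CARD('a)"
  let ?s = "W 3 (-1)"
  have cnj3: "char_cnj (W 3) = W 3" by (simp add: cnj_W)
  have "(\<Sum>\<chi> | mult_char \<chi>. nbinom (char_mult (W 3) \<chi>) \<chi> * \<chi> (1 / lam ^ 6)) =
      (\<Sum>\<eta> | mult_char \<eta>. nbinom (char_mult (W 3) (char_cnj \<eta>)) (char_cnj \<eta>) * char_cnj \<eta> (1 / lam ^ 6))"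
    by (rule sum_mult_char_cnj[symmetric])
  also have "\<dots> = ?s / gauss (W 3) * orbit_sum lam [2,1,1,0,1,1]"
    unfolding orbit_sum_def sum_distrib_left
  proof (intro sum.cong refl)
    fix \<eta> assume "\<eta> \<in> {\<eta> :: 'a \<Rightarrow> complex. mult_char \<eta>}"
    then have eta: "mult_char \<eta>" by simp
    \<comment> \<open>The multiplicities 2 at index 0 and 0 at index 3 give the two factors of a
      single binomial; every multiplicity 1 contributes the factor 1.\<close>
    have "nbinom (char_mult (W 3) (char_cnj \<eta>)) (char_cnj \<eta>) =
        ?s / gauss (W 3) * (kappa 0 (char_mult \<eta> (W 3)) * gauss \<eta>)"
      using nbinom_gauss[of "W 3" triv_char \<eta>] eta
      by (simp add: cnj3 W_eq_triv_iff triv_char_def[of "-1"])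
    moreover have "char_cnj \<eta> (1 / lam ^ 6) = \<eta> lam ^ 6"
      using eta by (simp add: char_cnj_def cnj_mult_char mult_char_divide mult_char_power)
    ultimately show "nbinom (char_mult (W 3) (char_cnj \<eta>)) (char_cnj \<eta>) * char_cnj \<eta> (1 / lam ^ 6) =
        ?s / gauss (W 3) * (\<eta> lam ^ 6 * (\<Prod>j<6. kappa ([2,1,1,0,1,1] ! j) (char_mult \<eta> (W j))))"
      using eta by (simp add: prod_lessThan_6)
  qed
  finally have 1: "?s / gauss (W 3) * orbit_sum lam [2,1,1,0,1,1] = (?q - 1) / ?q * W 3 (1 - 1 / lam ^ 6)"
    using sum_nbinom[of "W 3" "1 / lam ^ 6"] lam by (simp add: cnj3)
  \<comment> \<open>The quadratic character is 1 at the square lam^6, so inverting the argument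
    costs only the sign \<omega>2(-1).\<close>
  have "1 - 1 / lam ^ 6 = -1 * (1 - lam ^ 6) / lam ^ 6" using lam by (simp add: field_simps)
  then have "W 3 (1 - 1 / lam ^ 6) = ?s * W 3 (1 - lam ^ 6)"
    using W_power_6[OF lam, of 3]
    by (simp only: mult_char_divide mult_char_mult mult_char_W mult_char_power) simp
  then have "orbit_sum lam [2,1,1,0,1,1] = gauss (W 3) * ((?q - 1) / ?q * W 3 (1 - lam ^ 6))"
  proof -
    have "orbit_sum lam [2,1,1,0,1,1] = (?s * ?s) * orbit_sum lam [2,1,1,0,1,1]" by simp
    also have "\<dots> = ?s * gauss (W 3) * (?s / gauss (W 3) * orbit_sum lam [2,1,1,0,1,1])" by simp
    also have "\<dots> = (?s * ?s) * (gauss (W 3) * ((?q - 1) / ?q * W 3 (1 - lam ^ 6)))"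
      unfolding 1 by (simp add: \<open>W 3 (1 - 1 / lam ^ 6) = _\<close>)
    finally show ?thesis by simp
  qed
  then have "dwork_const * orbit_sum lam [2,1,1,0,1,1] =
      ?q ^ 2 * ?s * (gauss (W 3) * gauss (W 3)) * ((?q - 1) / ?q * W 3 (1 - lam ^ 6))"
    by (simp add: dwork_const_def mult_ac)
  also have "\<dots> = (?s * ?s) * (?q - 1) * ?q ^ 2 * W 3 (1 - lam ^ 6)"
    unfolding gauss_W3_square by (simp add: power2_eq_square)
  also have "?s * ?s = 1" by simp
  finally show ?thesis by simp
qed

lemma dwork6_points_eq:
  assumes lam: "lam \<noteq> 0"
  shows "dwork6_points lam = (of_nat CARD('a) ^ 5 - 1) / (of_nat CARD('a) - 1) +
    (\<Sum>(w, m)\<leftarrow>dwork_orbits. of_nat w * dwork_const * orbit_sum lam m) / (of_nat CARD('a) - 1)"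
proof -
  let ?N = "{xs :: 'a list. length xs = 6 \<and> sum_list (map (\<lambda>x. x ^ 6) xs) = 6 * lam * prod_list xs}"
  have "{xs :: 'a list. length xs = 6 \<and> xs \<noteq> replicate 6 0 \<and>
      sum_list (map (\<lambda>x. x ^ 6) xs) = 6 * lam * prod_list xs} = ?N - {replicate 6 0}"
    by auto
  moreover have "replicate 6 0 \<in> ?N" by (simp add: eval_nat_numeral)
  moreover have "finite ?N" by (rule finite_lists_length_eq_UNIV)
  ultimately have "card {xs :: 'a list. length xs = 6 \<and> xs \<noteq> replicate 6 0 \<and>
      sum_list (map (\<lambda>x. x ^ 6) xs) = 6 * lam * prod_list xs} = card ?N - 1" "card ?N \<ge> 1"
    using card_Diff_singleton[of "replicate 6 0" ?N] card_mono[of ?N "{replicate 6 0}"] by simp_all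
  then have "dwork6_points lam = (of_nat (card ?N) - 1) / (of_nat CARD('a) - 1)"
    unfolding dwork6_points_def by (simp only: of_nat_diff of_nat_1)
  then show ?thesis
    unfolding affine_count[OF lam] by (simp add: diff_divide_distrib add_divide_distrib mult.assoc)
qed

lemma dwork6_points_greene:
  fixes lam :: 'a
  defines "q \<equiv> complex_of_nat CARD('a)" and "z \<equiv> 1 / lam ^ 6"
  assumes lam: "lam \<noteq> 0"
  shows "dwork6_points lam =
      (q ^ 5 - 1) / (q - 1) + 360 * q ^ 2 * W 3 (1 - lam ^ 6)
    + q ^ 4 * greene_F [W 1, W 2, W 3, W 4, W 5] [W 0, W 0, W 0, W 0] z
    + 30 * q ^ 3 * W 1 (-1) * greene_F [W 2, W 3, W 4] [W 0, W 0] z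
    + 30 * q ^ 3 * greene_F [W 1, W 3, W 5] [W 0, W 0] z
    - 15 * q ^ 3 * W 1 (-1) * jacobi [W 3, W 4, W 5] * greene_F [W 1, W 5, W 4, W 2] [W 0, W 0, W 3] z
    - 20 * q ^ 3 * W 1 (-1) * jacobi [W 1, W 2, W 3] * greene_F [W 1, W 3, W 4, W 5] [W 0, W 2, W 2] z
    + 60 * q ^ 2 * W 1 (-1) * jacobi [W 1, W 1, W 4] * jacobi [W 3, W 4, W 5]
        * greene_F [W 1, W 4, W 3] [W 0, W 5] z
    + 60 * q ^ 2 * jacobi [W 2, W 2, W 2] * jacobi [W 3, W 4, W 5]
        * greene_F [W 2, W 5, W 3] [W 0, W 1] z
    + 90 * q ^ 3 * greene_F [W 3, W 4, W 5] [W 1, W 2] z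
    - 30 * q ^ 2 * jacobi [W 1, W 1] * jacobi [W 1, W 2, W 3] * greene_F [W 1, W 3, W 5] [W 2, W 4] z
    - 120 * q ^ 2 * jacobi [W 1, W 2, W 3] * greene_F [W 1, W 2] [W 0] z
    - 120 * q ^ 2 * jacobi [W 3, W 4, W 5] * greene_F [W 4, W 5] [W 0] z
    - 180 * q ^ 2 * jacobi [W 1, W 2, W 3] * greene_F [W 2, W 4] [W 3] z
    - 180 * q ^ 2 * jacobi [W 1, W 2, W 3] * greene_F [W 2, W 5] [W 4] z"
proof -
  have q1: "q - 1 \<noteq> 0" unfolding q_def using card_field_gt_1[where 'a='a] by simp
  \<comment> \<open>The prefactor q/(q-1) of Greene's function supplies the division by q - 1 that
    the projective count requires.\<close>
  have orbit_term: "coef * F = w * dwork_const * S / (q - 1)"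
    if "F = q / (q - 1) * (K * S)" "coef * (q * K) = w * dwork_const" for coef F w K S :: complex
  proof -
    have "coef * F = coef * (q * K) * S / (q - 1)" using that(1) by simp
    then show ?thesis by (simp only: that(2))
  qed
  have "360 * dwork_const * orbit_sum lam [2,1,1,0,1,1] / (q - 1) =
      360 * (dwork_const * orbit_sum lam [2,1,1,0,1,1]) / (q - 1)" by simp
  also have "\<dots> = 360 * q ^ 2 * W 3 (1 - lam ^ 6)"
    unfolding orbit_sum_1F0[OF lam, folded q_def] using q1 by simp
  finally have "360 * dwork_const * orbit_sum lam [2,1,1,0,1,1] / (q - 1) = 360 * q ^ 2 * W 3 (1 - lam ^ 6)" .
  note W3 = this[symmetric]
  note orbits = greene_F_orbits[OF lam, folded q_def z_def]
  note norms = greene_const_dwork[folded q_def]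
  note terms = W3
    orbit_term[OF orbits(1) norms(1)]
    orbit_term[OF orbits(2) norms(2)]
    orbit_term[OF orbits(3) norms(3)]
    orbit_term[OF orbits(4) norms(4)]
    orbit_term[OF orbits(5) norms(5)]
    orbit_term[OF orbits(6) norms(6)]
    orbit_term[OF orbits(7) norms(7)]
    orbit_term[OF orbits(8) norms(8)]
    orbit_term[OF orbits(9) norms(9)]
    orbit_term[OF orbits(10) norms(10)]
    orbit_term[OF orbits(11) norms(11)]
    orbit_term[OF orbits(12) norms(12)]
    orbit_term[OF orbits(13) norms(13)]
  show ?thesis
    unfolding dwork6_points_eq[OF lam, folded q_def] terms
    by (simp add: dwork_orbits_def add_divide_distrib)
qed

end

theorem theorem1p3:
  fixes \<omega> :: "'a::{finite,field} \<Rightarrow> complex" and lam :: 'a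
  defines "q \<equiv> of_nat CARD('a) :: complex"
      and "t \<equiv> (CARD('a) - 1) div 6"
  defines "\<omega>6 \<equiv> char_pow \<omega> t" and "\<omega>3 \<equiv> char_pow \<omega> (2 * t)" and "\<omega>2 \<equiv> char_pow \<omega> (3 * t)"
      and "\<epsilon> \<equiv> (triv_char :: 'a \<Rightarrow> complex)"
      and "z \<equiv> 1 / lam ^ 6"
  assumes "CARD('a) mod 6 = 1"
      and "char_generator \<omega>"
      and "lam \<noteq> 0" and "lam ^ 6 \<noteq> 1"
  shows "dwork6_points lam =
      (q ^ 5 - 1) / (q - 1) + 360 * q ^ 2 * \<omega>2 (1 - lam ^ 6)
    + q ^ 4 * greene_F [\<omega>6, \<omega>3, \<omega>2, char_cnj \<omega>3, char_cnj \<omega>6] [\<epsilon>, \<epsilon>, \<epsilon>, \<epsilon>] z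
    + 30 * q ^ 3 * \<omega>6 (-1) * greene_F [\<omega>3, \<omega>2, char_cnj \<omega>3] [\<epsilon>, \<epsilon>] z
    + 30 * q ^ 3 * greene_F [\<omega>6, \<omega>2, char_cnj \<omega>6] [\<epsilon>, \<epsilon>] z
    - 15 * q ^ 3 * \<omega>6 (-1) * jacobi [\<omega>2, char_cnj \<omega>3, char_cnj \<omega>6]
        * greene_F [\<omega>6, char_cnj \<omega>6, char_cnj \<omega>3, \<omega>3] [\<epsilon>, \<epsilon>, \<omega>2] z
    - 20 * q ^ 3 * \<omega>6 (-1) * jacobi [\<omega>6, \<omega>3, \<omega>2]
        * greene_F [\<omega>6, \<omega>2, char_cnj \<omega>3, char_cnj \<omega>6] [\<epsilon>, \<omega>3, \<omega>3] z
    + 60 * q ^ 2 * \<omega>6 (-1) * jacobi [\<omega>6, \<omega>6, char_cnj \<omega>3] * jacobi [\<omega>2, char_cnj \<omega>3, char_cnj \<omega>6]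
        * greene_F [\<omega>6, char_cnj \<omega>3, \<omega>2] [\<epsilon>, char_cnj \<omega>6] z
    + 60 * q ^ 2 * jacobi [\<omega>3, \<omega>3, \<omega>3] * jacobi [\<omega>2, char_cnj \<omega>3, char_cnj \<omega>6]
        * greene_F [\<omega>3, char_cnj \<omega>6, \<omega>2] [\<epsilon>, \<omega>6] z
    + 90 * q ^ 3 * greene_F [\<omega>2, char_cnj \<omega>3, char_cnj \<omega>6] [\<omega>6, \<omega>3] z
    - 30 * q ^ 2 * jacobi [\<omega>6, \<omega>6] * jacobi [\<omega>6, \<omega>3, \<omega>2]
        * greene_F [\<omega>6, \<omega>2, char_cnj \<omega>6] [\<omega>3, char_cnj \<omega>3] z
    - 120 * q ^ 2 * jacobi [\<omega>6, \<omega>3, \<omega>2] * greene_F [\<omega>6, \<omega>3] [\<epsilon>] z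
    - 120 * q ^ 2 * jacobi [\<omega>2, char_cnj \<omega>3, char_cnj \<omega>6] * greene_F [char_cnj \<omega>3, char_cnj \<omega>6] [\<epsilon>] z
    - 180 * q ^ 2 * jacobi [\<omega>6, \<omega>3, \<omega>2] * greene_F [\<omega>3, char_cnj \<omega>3] [\<omega>2] z
    - 180 * q ^ 2 * jacobi [\<omega>6, \<omega>3, \<omega>2] * greene_F [\<omega>3, char_cnj \<omega>6] [char_cnj \<omega>3] z"
proof -
  \<comment> \<open>Any nontrivial additive character serves: the Gauss sums have disappeared from
    the final formula.\<close>
  obtain \<psi> :: "'a \<Rightarrow> complex" where "additive_character \<psi>"
    using additive_character_exists by blast
  then interpret sextic_characters \<psi> \<omega>
    by (intro sextic_characters.intro sextic_characters_axioms.intro assms)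
  have W: "\<omega>6 = W 1" "\<omega>3 = W 2" "\<omega>2 = W 3" "\<epsilon> = W 0"
    by (simp_all add: W_def \<omega>6_def \<omega>3_def \<omega>2_def t_def \<epsilon>_def)
  have cnj: "char_cnj (W 2) = W 4" "char_cnj (W 1) = W 5"
    by (simp_all only: cnj_W) simp_all
  show ?thesis
    unfolding W cnj q_def z_def by (rule dwork6_points_greene[OF \<open>lam \<noteq> 0\<close>])
qed

end
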